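(* Let $M$ be a compact oriented $n$-dimensional manifold and let $\mathcal{M}$ be the space of all smooth Riemannian metrics on $M$. Let $g_E$ be the Ebin metric on $\mathcal{M}$, $$(g_E)_g(h_1,h_2)=\int_M\mathrm{tr}(g^{-1}h_1g^{-1}h_2)\,\mathrm{vol}_g\qquad(g\in\mathcal{M},\ h_1,h_2\in T_g\mathcal{M}\cong\Gamma(S^2T^*M)),$$ and let $f:\mathcal{M}\to\mathbb{R}$ be $f(g)=2\,\mathrm{Vol}(g)=2\int_M\mathrm{vol}_g$. Then the pair $(g_E,f)$ is a homogeneous pair of degree $n/2$ with respect to the canonical $\mathbb{R}_{>0}$-action on $\mathcal{M}$.
   Context: $\mathcal{M}$ is an open cone in the Fréchet space $\Gamma(S^2T^*M)$ of smooth symmetric $(0,2)$-tensors, hence a Fréchet manifold with $T_g\mathcal{M}\cong\Gamma(S^2T^*M)$; $g^{-1}h_i\in\Gamma(T^*M\otimes TM)$ is the contraction of the dual metric of $g$ with $h_i$, and $\mathrm{vol}_g$ is the volume form of $g$. The canonical $\mathbb{R}_{>0}$-action is $m_\lambda(g)=\lambda g$. Homogeneous pair: for a free $\mathbb{R}_{>0}$-action $m$ on a (possibly infinite-dimensional) manifold $N$, with $P_x=\frac{d}{dt}m(e^t,x)|_{t=0}$, a (weak) pseudo-Riemannian metric $G$ and a smooth $f:N\to\mathbb{R}_{>0}$ form a homogeneous pair $(G,f)$ of degree $\alpha\in\mathbb{R}-\{0\}$ if $m_\lambda^*G=\lambda^\alpha G$, $m_\lambda^*f=\lambda^\alpha f$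 for all $\lambda>0$ and $G(P,\cdot)=df$. *)

theory Defs
  imports "HOL-Analysis.Analysis" "HOL-Library.Function_Algebras"
begin

section \<open>Function spaces as vector spaces\<close>

text \<open>Tensor fields are functions, added and scaled pointwise. The additive structure is that of
  \<^theory>\<open>HOL-Library.Function_Algebras\<close>.\<close>

instantiation "fun" :: (type, real_vector) real_vector
begin

definition scaleR_fun :: "real \<Rightarrow> ('a \<Rightarrow> 'b) \<Rightarrow> 'a \<Rightarrow> 'b" where
  "scaleR_fun r f = (\<lambda>x. r *\<^sub>R f x)"

instance
  by standard (simp_all add: scaleR_fun_def plus_fun_def fun_eq_iff scaleR_add_right scaleR_add_left)

end


section \<open>Smooth functions on open subsets of Euclidean space\<close>

definition partial_deriv :: "'n::finite \<Rightarrow> (real ^ 'n \<Rightarrow> 'b::real_normed_vector) \<Rightarrow> real ^ 'n \<Rightarrow> 'b"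
  where "partial_deriv i f x = frechet_derivative f (at x) (axis i 1)"

definition iter_partial :: "'n::finite list \<Rightarrow> (real ^ 'n \<Rightarrow> 'b::real_normed_vector) \<Rightarrow> real ^ 'n \<Rightarrow> 'b"
  where "iter_partial is f = foldr partial_deriv is f"

text \<open>Only used for open \<open>S\<close>. Total differentiability of all iterated partial derivatives makes
  each of them continuous, so this is smoothness in the usual sense.\<close>

definition smooth_on :: "(real ^ 'n::finite) set \<Rightarrow> (real ^ 'n \<Rightarrow> 'b::real_normed_vector) \<Rightarrow> bool"
  where "smooth_on S f \<longleftrightarrow> (\<forall>is. \<forall>x\<in>S. iter_partial is f differentiable (at x))"


section \<open>Compact oriented manifolds\<close>

text \<open>A chart is a domain together with a coordinate map; the values of the coordinate map outside
  its domain are irrelevant. The dimension is \<open>CARD('n)\<close>.\<close>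

type_synonym ('a, 'n) chart = "'a set \<times> ('a \<Rightarrow> real ^ 'n)"

definition chart_inv :: "('a, 'n::finite) chart \<Rightarrow> real ^ 'n \<Rightarrow> 'a"
  where "chart_inv c = inv_into (fst c) (snd c)"

definition transition :: "('a, 'n::finite) chart \<Rightarrow> ('a, 'n) chart \<Rightarrow> real ^ 'n \<Rightarrow> real ^ 'n"
  where "transition c d = snd d \<circ> chart_inv c"

definition transition_deriv ::
    "('a, 'n::finite) chart \<Rightarrow> ('a, 'n) chart \<Rightarrow> 'a \<Rightarrow> real ^ 'n \<Rightarrow> real ^ 'n"
  where "transition_deriv c d p = frechet_derivative (transition c d) (at (snd c p))"

definition is_chart :: "'a topology \<Rightarrow> ('a, 'n::finite) chart \<Rightarrow> bool"
  where "is_chart X c \<longleftrightarrow>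
    openin X (fst c) \<and> open (snd c ` fst c) \<and>
    homeomorphic_map (subtopology X (fst c)) (top_of_set (snd c ` fst c)) (snd c)"

definition smooth_atlas :: "'a topology \<Rightarrow> ('a, 'n::finite) chart set \<Rightarrow> bool"
  where "smooth_atlas X A \<longleftrightarrow>
    (\<forall>c\<in>A. is_chart X c) \<and>
    (\<Union>c\<in>A. fst c) = topspace X \<and>
    (\<forall>c\<in>A. \<forall>d\<in>A. smooth_on (snd c ` (fst c \<inter> fst d)) (transition c d))"

definition oriented_atlas :: "'a topology \<Rightarrow> ('a, 'n::finite) chart set \<Rightarrow> bool"
  where "oriented_atlas X A \<longleftrightarrow>
    smooth_atlas X A \<and>
    (\<forall>c\<in>A. \<forall>d\<in>A. \<forall>p\<in>fst c \<inter> fst d. det (matrix (transition_deriv c d p)) > 0)"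

definition compact_oriented_manifold :: "'a topology \<Rightarrow> ('a, 'n::finite) chart set \<Rightarrow> bool"
  where "compact_oriented_manifold X A \<longleftrightarrow>
    topspace X \<noteq> {} \<and> Hausdorff_space X \<and> second_countable X \<and> compact_space X \<and>
    oriented_atlas X A"


section \<open>Tangent spaces and symmetric tensor fields\<close>

text \<open>A tangent vector at \<open>p\<close> is given by its components in all charts around \<open>p\<close>; they are
  related by the derivatives of the transition maps. Components in other charts are set to \<open>0\<close>.\<close>

type_synonym ('a, 'n) tangent = "('a, 'n) chart \<Rightarrow> real ^ 'n"

definition tangent_space :: "('a, 'n::finite) chart set \<Rightarrow> 'a \<Rightarrow> ('a, 'n) tangent set"
  where "tangent_space A p = {v.
    (\<forall>c\<in>A. \<forall>d\<in>A. p \<in> fst c \<inter> fst d \<longrightarrow> v d = transition_deriv c d p (v c)) \<and>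
    (\<forall>c. \<not> (c \<in> A \<and> p \<in> fst c) \<longrightarrow> v c = 0)}"

text \<open>The coordinate vector field \<open>\<partial>/\<partial>x\<^sup>i\<close> of the chart \<open>c\<close>.\<close>

definition coord_vec :: "('a, 'n::finite) chart set \<Rightarrow> ('a, 'n) chart \<Rightarrow> 'n \<Rightarrow> 'a \<Rightarrow> ('a, 'n) tangent"
  where "coord_vec A c i p =
    (\<lambda>d. if d \<in> A \<and> p \<in> fst d then transition_deriv c d p (axis i 1) else 0)"

type_synonym ('a, 'n) tensor2 = "'a \<Rightarrow> ('a, 'n) tangent \<Rightarrow> ('a, 'n) tangent \<Rightarrow> real"

definition components ::
    "('a, 'n::finite) chart set \<Rightarrow> ('a, 'n) tensor2 \<Rightarrow> ('a, 'n) chart \<Rightarrow> 'a \<Rightarrow> real ^ 'n ^ 'n"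
  where "components A h c p = (\<chi> i j. h p (coord_vec A c i p) (coord_vec A c j p))"

text \<open>The space \<open>\<Gamma>(S\<^sup>2T\<^sup>*M)\<close>. Values at arguments that are not tangent vectors are set to \<open>0\<close>,
  so that equality of sections is equality of functions.\<close>

definition sym_tensors :: "'a topology \<Rightarrow> ('a, 'n::finite) chart set \<Rightarrow> ('a, 'n) tensor2 set"
  where "sym_tensors X A = {h.
    (\<forall>p\<in>topspace X. \<forall>u\<in>tangent_space A p. \<forall>v\<in>tangent_space A p. h p u v = h p v u) \<and>
    (\<forall>p\<in>topspace X. \<forall>u\<in>tangent_space A p. \<forall>v\<in>tangent_space A p. \<forall>w\<in>tangent_space A p.
      \<forall>a b. h p (a *\<^sub>R u + b *\<^sub>R v) w = a * h p u w + b * h p v w) \<and>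
    (\<forall>p u v. \<not> (p \<in> topspace X \<and> u \<in> tangent_space A p \<and> v \<in> tangent_space A p)
      \<longrightarrow> h p u v = 0) \<and>
    (\<forall>c\<in>A. smooth_on (snd c ` fst c) (\<lambda>x. components A h c (chart_inv c x)))}"

definition metrics :: "'a topology \<Rightarrow> ('a, 'n::finite) chart set \<Rightarrow> ('a, 'n) tensor2 set"
  where "metrics X A = {g \<in> sym_tensors X A.
    \<forall>p\<in>topspace X. \<forall>v\<in>tangent_space A p. v \<noteq> 0 \<longrightarrow> g p v v > 0}"

text \<open>The Frechet topology on \<open>\<Gamma>(S\<^sup>2T\<^sup>*M)\<close>: uniform convergence of all partial derivatives of the
  components on compact subsets of chart domains. The sets below are the open balls of the
  corresponding seminorms (a supremum over a compact set).\<close>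

definition smooth_topology ::
    "'a topology \<Rightarrow> ('a, 'n::finite) chart set \<Rightarrow> ('a, 'n) tensor2 topology"
  where "smooth_topology X A = topology_generated_by
    {{h \<in> sym_tensors X A. \<forall>p\<in>K.
        norm (iter_partial is (\<lambda>x. components A (h - g) c (chart_inv c x)) (snd c p)) < e}
      | g c K is e. g \<in> sym_tensors X A \<and> c \<in> A \<and> compactin X K \<and> K \<subseteq> fst c \<and> 0 < e}"


section \<open>Volume form, integration and the Ebin metric\<close>

text \<open>A form of top degree is represented by its coefficient with respect to
  \<open>dx\<^sup>1 \<and> \<dots> \<and> dx\<^sup>n\<close> in every chart of the oriented atlas.\<close>

type_synonym ('a, 'n) top_form = "('a, 'n) chart \<Rightarrow> 'a \<Rightarrow> real"

definition vol_form :: "('a, 'n::finite) chart set \<Rightarrow> ('a, 'n) tensor2 \<Rightarrow> ('a, 'n) top_form"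
  where "vol_form A g c p = sqrt (det (components A g c p))"

definition charts_used :: "'a topology \<Rightarrow> ('a, 'n::finite) chart set \<Rightarrow>
    (('a, 'n) chart \<Rightarrow> 'a \<Rightarrow> real) \<Rightarrow> ('a, 'n) chart set"
  where "charts_used X A \<rho> = {c \<in> A. \<exists>p\<in>topspace X. \<rho> c p \<noteq> 0}"

definition partition_of_unity :: "'a topology \<Rightarrow> ('a, 'n::finite) chart set \<Rightarrow>
    (('a, 'n) chart \<Rightarrow> 'a \<Rightarrow> real) \<Rightarrow> bool"
  where "partition_of_unity X A \<rho> \<longleftrightarrow>
    (\<forall>c\<in>A. continuous_map X euclideanreal (\<rho> c) \<and>
      (\<forall>p\<in>topspace X. 0 \<le> \<rho> c p) \<and>
      X closure_of {p \<in> topspace X. \<rho> c p \<noteq> 0} \<subseteq> fst c) \<and>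
    finite (charts_used X A \<rho>) \<and>
    (\<forall>p\<in>topspace X. (\<Sum>c\<in>charts_used X A \<rho>. \<rho> c p) = 1)"

text \<open>The integral of a continuous top form over a compact oriented manifold. It does not depend on
  the chosen partition of unity, which need only be continuous for this purpose.\<close>

definition integral_form ::
    "'a topology \<Rightarrow> ('a, 'n::finite) chart set \<Rightarrow> ('a, 'n) top_form \<Rightarrow> real"
  where "integral_form X A \<omega> =
    (let \<rho> = (SOME \<rho>. partition_of_unity X A \<rho>) in
      \<Sum>c\<in>charts_used X A \<rho>.
        LINT x : snd c ` fst c | lborel. \<rho> c (chart_inv c x) * \<omega> c (chart_inv c x))"

definition volume :: "'a topology \<Rightarrow> ('a, 'n::finite) chart set \<Rightarrow> ('a, 'n) tensor2 \<Rightarrow> real"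
  where "volume X A g = integral_form X A (vol_form A g)"

text \<open>The contraction \<open>g\<^sup>-\<^sup>1h\<close> of the dual metric of \<open>g\<close> with \<open>h\<close>, as the matrix of an endomorphism of
  the tangent space in the coordinate basis: the components of the dual metric are the inverse
  matrix of those of \<open>g\<close>.\<close>

definition metric_contract :: "('a, 'n::finite) chart set \<Rightarrow> ('a, 'n) tensor2 \<Rightarrow> ('a, 'n) tensor2 \<Rightarrow>
    ('a, 'n) chart \<Rightarrow> 'a \<Rightarrow> real ^ 'n ^ 'n"
  where "metric_contract A g h c p = matrix_inv (components A g c p) ** components A h c p"

definition ebin_metric :: "'a topology \<Rightarrow> ('a, 'n::finite) chart set \<Rightarrow>
    ('a, 'n) tensor2 \<Rightarrow> ('a, 'n) tensor2 \<Rightarrow> ('a, 'n) tensor2 \<Rightarrow> real"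
  where "ebin_metric X A g h\<^sub>1 h\<^sub>2 = integral_form X A
    (\<lambda>c p. trace (metric_contract A g h\<^sub>1 c p ** metric_contract A g h\<^sub>2 c p) * vol_form A g c p)"


section \<open>Calculus on open subsets of Frechet spaces\<close>

text \<open>A topological vector space is given by a topology \<open>T\<close> whose underlying set is a linear subspace
  of a real vector space. Limits are taken in the topology \<open>T\<close> of the codomain.\<close>

definition dir_deriv ::
    "'f::real_vector topology \<Rightarrow> ('e::real_vector \<Rightarrow> 'f) \<Rightarrow> 'e \<Rightarrow> 'e \<Rightarrow> 'f"
  where "dir_deriv T f x v =
    (THE w. limitin T (\<lambda>t. (1 / t) *\<^sub>R (f (x + t *\<^sub>R v) - f x)) w (at (0::real)))"

text \<open>Smoothness of a map on an open set \<open>U\<close> (Michal-Bastiani, Hamilton): all iterated directional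
  derivatives \<open>D\<^sup>kf(x)(v\<^sub>0,\<dots>,v\<^sub>k\<^sub>-\<^sub>1)\<close> exist and are jointly continuous in the point and
  the \<open>k\<close> directions.\<close>

definition frechet_smooth :: "'e::real_vector topology \<Rightarrow> 'e set \<Rightarrow>
    'f::real_vector topology \<Rightarrow> ('e \<Rightarrow> 'f) \<Rightarrow> bool"
  where "frechet_smooth T U T' f \<longleftrightarrow>
    (\<exists>D :: nat \<Rightarrow> 'e \<Rightarrow> (nat \<Rightarrow> 'e) \<Rightarrow> 'f.
      (\<forall>x\<in>U. \<forall>v. D 0 x v = f x) \<and>
      (\<forall>k. continuous_map
        (prod_topology (subtopology T U) (product_topology (\<lambda>_. T) {..<k})) T' (\<lambda>(x, v). D k x v)) \<and>
      (\<forall>k. \<forall>x\<in>U. \<forall>v \<in> {..<Suc k} \<rightarrow>\<^sub>E topspace T.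
        limitin T'
          (\<lambda>t. (1 / t) *\<^sub>R (D k (x + t *\<^sub>R v k) (restrict v {..<k}) - D k x (restrict v {..<k})))
          (D (Suc k) x v) (at (0::real))))"


section \<open>Homogeneous pairs\<close>

text \<open>In this section \<open>N\<close> is an open subset of the topological vector space \<open>T\<close>, so that every
  tangent space of \<open>N\<close> is \<open>topspace T\<close>.\<close>

definition smooth_pos_action :: "'e::real_vector topology \<Rightarrow> 'e set \<Rightarrow> (real \<Rightarrow> 'e \<Rightarrow> 'e) \<Rightarrow> bool"
  where "smooth_pos_action T N m \<longleftrightarrow>
    (\<forall>l>0. \<forall>x\<in>N. m l x \<in> N) \<and>
    (\<forall>x\<in>N. m 1 x = x) \<and>
    (\<forall>k>0. \<forall>l>0. \<forall>x\<in>N. m k (m l x) = m (k * l) x) \<and>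
    frechet_smooth (prod_topology euclideanreal T) ({0<..} \<times> N) T (\<lambda>(l, x). m l x)"

definition free_pos_action :: "'e set \<Rightarrow> (real \<Rightarrow> 'e \<Rightarrow> 'e) \<Rightarrow> bool"
  where "free_pos_action N m \<longleftrightarrow> (\<forall>l>0. \<forall>x\<in>N. m l x = x \<longrightarrow> l = 1)"

definition generator :: "'e::real_vector topology \<Rightarrow> (real \<Rightarrow> 'e \<Rightarrow> 'e) \<Rightarrow> 'e \<Rightarrow> 'e"
  where "generator T m x = dir_deriv T (\<lambda>t. m (exp t) x) 0 1"

text \<open>Nondegeneracy is meant in the weak sense: \<open>u \<mapsto> G\<^sub>x(u, \<cdot>)\<close> is injective.\<close>

definition weak_pseudo_riemannian ::
    "'e::real_vector topology \<Rightarrow> 'e set \<Rightarrow> ('e \<Rightarrow> 'e \<Rightarrow> 'e \<Rightarrow> real) \<Rightarrow> bool"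
  where "weak_pseudo_riemannian T N G \<longleftrightarrow>
    (\<forall>x\<in>N. \<forall>u\<in>topspace T. \<forall>v\<in>topspace T. G x u v = G x v u) \<and>
    (\<forall>x\<in>N. \<forall>u\<in>topspace T. \<forall>v\<in>topspace T. \<forall>w\<in>topspace T. \<forall>a b.
      G x (a *\<^sub>R u + b *\<^sub>R v) w = a * G x u w + b * G x v w) \<and>
    (\<forall>x\<in>N. \<forall>u\<in>topspace T. (\<forall>v\<in>topspace T. G x u v = 0) \<longrightarrow> u = 0) \<and>
    frechet_smooth (prod_topology T (prod_topology T T)) (N \<times> topspace T \<times> topspace T)
      euclideanreal (\<lambda>(x, u, v). G x u v)"

definition homogeneous_pair :: "'e::real_vector topology \<Rightarrow> 'e set \<Rightarrow> (real \<Rightarrow> 'e \<Rightarrow> 'e) \<Rightarrow>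
    ('e \<Rightarrow> 'e \<Rightarrow> 'e \<Rightarrow> real) \<Rightarrow> ('e \<Rightarrow> real) \<Rightarrow> real \<Rightarrow> bool"
  where "homogeneous_pair T N m G f \<alpha> \<longleftrightarrow>
    openin T N \<and>
    smooth_pos_action T N m \<and> free_pos_action N m \<and>
    weak_pseudo_riemannian T N G \<and>
    frechet_smooth T N euclideanreal f \<and> (\<forall>x\<in>N. f x > 0) \<and>
    \<alpha> \<noteq> 0 \<and>
    (\<forall>l>0. \<forall>x\<in>N. \<forall>u\<in>topspace T. \<forall>v\<in>topspace T.
      G (m l x) (dir_deriv T (m l) x u) (dir_deriv T (m l) x v) = l powr \<alpha> * G x u v) \<and>
    (\<forall>l>0. \<forall>x\<in>N. f (m l x) = l powr \<alpha> * f x) \<and>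
    (\<forall>x\<in>N. \<forall>v\<in>topspace T. G x (generator T m x) v = dir_deriv euclideanreal f x v)"

end

theory Submission
  imports Defs
begin

text \<open>The volume and the Ebin metric are integrals of densities that depend pointwise on the tensors
  \<open>g\<close>, \<open>u\<close>, \<open>v\<close>, and the main clauses of the theorem come from properties of these densities.

  \<^emph>\<open>Algebra.\<close> The matrices \<open>g\<^sup>-\<^sup>1u\<close> do not change when \<open>g\<close> and \<open>u\<close> are multiplied by the same \<open>\<lambda>\<close>, while the
  volume density \<open>sqrt (det g)\<close> is multiplied by \<open>\<lambda>\<^sup>n\<^sup>/\<^sup>2\<close>; this gives both homogeneity statements. The
  infinitesimal generator of the action at \<open>g\<close> is \<open>g\<close>, and \<open>tr (g\<^sup>-\<^sup>1g g\<^sup>-\<^sup>1v) = tr (g\<^sup>-\<^sup>1v)\<close> is, by Jacobi's formula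
  (\<open>sqrt_det_has_derivative\<close>), twice the logarithmic derivative of the volume density in the direction
  \<open>v\<close>; this gives \<open>G(P, \<cdot>) = df\<close>. Nondegeneracy holds because \<open>tr (g\<^sup>-\<^sup>1u g\<^sup>-\<^sup>1u)\<close> is positive unless \<open>u = 0\<close>
  (\<open>trace_square_contract_eq_0\<close>).

  \<^emph>\<open>Smoothness.\<close> A partition of unity writes both functionals as finite sums of integrals
  \<open>\<integral> r(y) \<phi>(L h y) dy\<close> over compact subsets of Euclidean space, where \<open>L h y\<close> is the matrix, or the triple of
  matrices, of components at \<open>y\<close>. As \<open>L\<close> is linear in \<open>h\<close> and jointly continuous
  (\<open>joint_continuity_local_rep\<close>), differentiation under the integral sign reduces smoothness of the
  functional to smoothness of \<open>\<phi>\<close> on matrices (\<open>derivative_tower_weighted_integral\<close>). The latter holds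
  because the functions \<open>\<phi>\<close> lie in an algebra that is closed under differentiation
  (\<open>frechet_smooth_gen_algebra_det\<close>).

  \<^emph>\<open>Topology.\<close> The remaining clauses need only that the space of symmetric tensor fields is a Hausdorff
  topological vector space (\<open>limitin_smooth_iff\<close> and its consequences) and that the metrics form an open
  subset (\<open>openin_metrics\<close>), which follows from compactness of the manifold.\<close>

section \<open>Integrals depending on a parameter\<close>

lemma continuous_map_fst_app:
  "continuous_map Z (prod_topology X Y) f \<Longrightarrow> continuous_map Z X (\<lambda>z. fst (f z))"
  and continuous_map_snd_app:
  "continuous_map Z (prod_topology X Y) f \<Longrightarrow> continuous_map Z Y (\<lambda>z. snd (f z))"
  by (simp_all add: continuous_map_pairwise o_def)

lemma continuous_map_scaleR:
  fixes g :: "'z \<Rightarrow> 'b::real_normed_vector"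
  assumes "continuous_map Z euclideanreal f" "continuous_map Z euclidean g"
  shows "continuous_map Z euclidean (\<lambda>z. f z *\<^sub>R g z)"
  using assms unfolding continuous_map_atin limitin_canonical_iff by (auto intro: tendsto_scaleR)

text \<open>Continuity is uniform near a compact slice. This takes the place of dominated convergence below:
  over a compact domain of integration it makes the integral depend continuously on a parameter from an
  arbitrary topological space.\<close>

lemma tube_uniform:
  fixes H :: "'z \<Rightarrow> 'p::topological_space \<Rightarrow> real"
  assumes H: "continuous_map (prod_topology Z (top_of_set K)) euclideanreal (\<lambda>(z, y). H z y)"
    and K: "compact K" and z0: "z0 \<in> topspace Z" and e: "0 < e"
  obtains W where "openin Z W" "z0 \<in> W" "\<And>z y. z \<in> W \<Longrightarrow> y \<in> K \<Longrightarrow> \<bar>H z y - H z0 y\<bar> < e"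
proof -
  let ?P = "prod_topology Z (top_of_set K)"
  have "continuous_map ?P ?P (\<lambda>w. (z0, snd w))"
    using z0 by (auto intro!: continuous_map_pairedI continuous_map_snd)
  from continuous_map_compose[OF this H]
  have H0: "continuous_map ?P euclideanreal (\<lambda>w. H z0 (snd w))"
    by (simp add: o_def)
  have "continuous_map ?P euclideanreal (\<lambda>w. H (fst w) (snd w))"
    using H by (simp add: case_prod_unfold)
  then have "continuous_map ?P euclideanreal (\<lambda>w. \<bar>H (fst w) (snd w) - H z0 (snd w)\<bar>)"
    by (intro continuous_map_real_abs continuous_map_diff H0)
  then have "openin ?P {w \<in> topspace ?P. \<bar>H (fst w) (snd w) - H z0 (snd w)\<bar> \<in> {..<e}}"
    by (rule openin_continuous_map_preimage) (simp flip: open_openin)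
  then have "\<exists>U V. openin Z U \<and> openin (top_of_set K) V \<and> z0 \<in> U \<and> K \<subseteq> V \<and>
      U \<times> V \<subseteq> {w \<in> topspace ?P. \<bar>H (fst w) (snd w) - H z0 (snd w)\<bar> \<in> {..<e}}"
    by (rule tube_lemma_right) (use K z0 e in \<open>auto simp: compactin_subtopology\<close>)
  then obtain U V where "openin Z U" "z0 \<in> U" "K \<subseteq> V"
      "U \<times> V \<subseteq> {w \<in> topspace ?P. \<bar>H (fst w) (snd w) - H z0 (snd w)\<bar> \<in> {..<e}}"
    by blast
  then show thesis
    by (intro that[of U]) (auto simp: subset_iff)
qed

lemma continuous_on_section:
  assumes H: "continuous_map (prod_topology Z (top_of_set K)) euclidean (\<lambda>(z, y). H z y)"
    and z: "z \<in> topspace Z"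
  shows "continuous_on K (H z)"
proof -
  have "continuous_map (top_of_set K) (prod_topology Z (top_of_set K)) (\<lambda>y. (z, y))"
    using z by (auto intro!: continuous_map_pairedI)
  from continuous_map_compose[OF this H] show ?thesis
    by (simp add: o_def continuous_map_iff_continuous)
qed

lemma set_integrable_compact:
  fixes F :: "'p::euclidean_space \<Rightarrow> real"
  assumes "compact K" "continuous_on K F"
  shows "set_integrable lborel K F"
  using borel_integrable_compact[OF assms] by (simp add: set_integrable_def)

text \<open>Integration against a fixed weight is Lipschitz for the supremum norm, with the integral of the
  absolute value of the weight as Lipschitz constant.\<close>

lemma weighted_integral_close:
  fixes r F G :: "'p::euclidean_space \<Rightarrow> real"
  assumes K: "compact K" and r: "continuous_on K r"
    and F: "continuous_on K F" and G: "continuous_on K G"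
    and e: "\<And>y. y \<in> K \<Longrightarrow> \<bar>F y - G y\<bar> \<le> e"
  shows "\<bar>(LINT y:K|lborel. r y * F y) - (LINT y:K|lborel. r y * G y)\<bar>
    \<le> (LINT y:K|lborel. \<bar>r y\<bar>) * e"
proof -
  note [intro!] = set_integrable_compact[OF K] continuous_intros r F G
  have "(LINT y:K|lborel. r y * F y) - (LINT y:K|lborel. r y * G y)
      = (LINT y:K|lborel. r y * F y - r y * G y)"
    by (rule set_integral_diff(2)[symmetric]) auto
  also have "\<bar>\<dots>\<bar> \<le> (LINT y:K|lborel. \<bar>r y * F y - r y * G y\<bar>)"
    using set_integral_norm_bound[of lborel K "\<lambda>y. r y * F y - r y * G y"] by force
  also have "\<dots> \<le> (LINT y:K|lborel. \<bar>r y\<bar> * e)"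
  proof (rule set_integral_mono)
    fix y assume "y \<in> K"
    have "\<bar>r y * F y - r y * G y\<bar> = \<bar>r y\<bar> * \<bar>F y - G y\<bar>"
      by (simp add: abs_mult flip: right_diff_distrib)
    also have "\<dots> \<le> \<bar>r y\<bar> * e"
      using e[OF \<open>y \<in> K\<close>] by (rule mult_left_mono) simp
    finally show "\<bar>r y * F y - r y * G y\<bar> \<le> \<bar>r y\<bar> * e" .
  qed auto
  finally show ?thesis by simp
qed

lemma weighted_integral_continuous_map:
  fixes r :: "'p::euclidean_space \<Rightarrow> real"
  assumes K: "compact K" and r: "continuous_on K r"
    and H: "continuous_map (prod_topology Z (top_of_set K)) euclideanreal (\<lambda>(z, y). H z y)"
  shows "continuous_map Z euclideanreal (\<lambda>z. LINT y:K|lborel. r y * H z y)"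
  unfolding continuous_map_atin limitin_canonical_iff
proof (intro ballI tendstoI)
  fix z0 and e :: real assume z0: "z0 \<in> topspace Z" and e: "0 < e"
  define C where "C = (LINT y:K|lborel. \<bar>r y\<bar>)"
  have "0 \<le> C" unfolding C_def set_lebesgue_integral_def by (rule Bochner_Integration.integral_nonneg) simp
  (* C may vanish; dividing by C + 1 avoids that case. *)
  then have "0 < e / (C + 1)" using e by simp
  from tube_uniform[OF H K z0 this] obtain W where W: "openin Z W" "z0 \<in> W"
    and close: "\<And>z y. z \<in> W \<Longrightarrow> y \<in> K \<Longrightarrow> \<bar>H z y - H z0 y\<bar> < e / (C + 1)" by blast
  have "dist (LINT y:K|lborel. r y * H z y) (LINT y:K|lborel. r y * H z0 y) < e" if "z \<in> W" for z
  proof -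
    have "z \<in> topspace Z" using W(1) that openin_subset by blast
    then have "\<bar>(LINT y:K|lborel. r y * H z y) - (LINT y:K|lborel. r y * H z0 y)\<bar> \<le> C * (e / (C + 1))"
      using close[OF that] z0 unfolding C_def
      by (intro weighted_integral_close[OF K r] continuous_on_section[OF H] less_imp_le) (auto simp: C_def)
    also have "\<dots> < e" using \<open>0 \<le> C\<close> e by (simp add: field_simps)
    finally show ?thesis by (simp add: dist_real_def)
  qed
  then show "\<forall>\<^sub>F z in atin Z z0. dist (LINT y:K|lborel. r y * H z y) (LINT y:K|lborel. r y * H z0 y) < e"
    using W unfolding eventually_atin by blast
qed

text \<open>Differentiation under the integral sign. By the mean value theorem the difference quotient of
  the integrand is a value of its derivative at a nearby time, so it converges uniformly on the compact
  domain by the tube argument.\<close>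

lemma weighted_integral_has_derivative:
  fixes r :: "'p::euclidean_space \<Rightarrow> real"
  assumes K: "compact K" and r: "continuous_on K r" and \<delta>: "0 < \<delta>"
    and H: "\<And>t. \<bar>t\<bar> < \<delta> \<Longrightarrow> continuous_on K (H t)"
    and H': "continuous_map (prod_topology (top_of_set {-\<delta><..<\<delta>}) (top_of_set K)) euclideanreal (\<lambda>(t, y). H' t y)"
    and deriv: "\<And>t y. \<bar>t\<bar> < \<delta> \<Longrightarrow> y \<in> K \<Longrightarrow> ((\<lambda>s. H s y) has_real_derivative H' t y) (at t)"
  shows "((\<lambda>t. (1 / t) *\<^sub>R ((LINT y:K|lborel. r y * H t y) - (LINT y:K|lborel. r y * H 0 y)))
    \<longlongrightarrow> (LINT y:K|lborel. r y * H' 0 y)) (at 0)"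
proof (rule tendstoI)
  fix e :: real assume e: "0 < e"
  define C where "C = (LINT y:K|lborel. \<bar>r y\<bar>)"
  have C: "0 \<le> C" unfolding C_def set_lebesgue_integral_def by (rule Bochner_Integration.integral_nonneg) simp
  then have "0 < e / (C + 1)" using e by simp
  from tube_uniform[OF H' K _ this, of 0] \<delta> obtain W where W: "openin (top_of_set {-\<delta><..<\<delta>}) W" "0 \<in> W"
    and close: "\<And>t y. t \<in> W \<Longrightarrow> y \<in> K \<Longrightarrow> \<bar>H' t y - H' 0 y\<bar> < e / (C + 1)" by auto
  have "open W" using W(1) by (simp add: openin_open_eq)
  then obtain \<eta> where \<eta>: "0 < \<eta>" "ball 0 \<eta> \<subseteq> W" using W(2) openE by blast
  have "W \<subseteq> {-\<delta><..<\<delta>}" using openin_subset[OF W(1)] by simp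
  have sub: "\<bar>t\<bar> < \<delta>" "t \<in> W" if "\<bar>t\<bar> < \<eta>" for t
  proof -
    show "t \<in> W" using that \<eta> by (auto simp: dist_real_def)
    then have "t \<in> {-\<delta><..<\<delta>}" using \<open>W \<subseteq> _\<close> by blast
    then show "\<bar>t\<bar> < \<delta>" by auto
  qed
  have main: "dist ((1 / t) *\<^sub>R ((LINT y:K|lborel. r y * H t y) - (LINT y:K|lborel. r y * H 0 y)))
    (LINT y:K|lborel. r y * H' 0 y) < e" if t: "\<bar>t\<bar> < \<eta>" "t \<noteq> 0" for t
  proof -
    note [intro!] = set_integrable_compact[OF K] continuous_intros r
    have cH: "continuous_on K (H t)" "continuous_on K (H 0)" using H sub t \<delta> by auto
    have cH': "continuous_on K (H' 0)" using continuous_on_section[OF H', of 0] \<delta> by simp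
    have est: "\<bar>(H t y - H 0 y) / t - H' 0 y\<bar> \<le> e / (C + 1)" if y: "y \<in> K" for y
    proof -
      have deriv': "((\<lambda>s. H s y) has_real_derivative H' s y) (at s)" if "\<bar>s\<bar> < \<eta>" for s
        by (rule deriv[OF sub(1)[OF that] y])
      have mvt: "\<exists>\<xi>. \<bar>\<xi>\<bar> < \<eta> \<and> H t y - H 0 y = t * H' \<xi> y"
      proof (cases "0 < t")
        case True
        have "\<exists>z>0. z < t \<and> H t y - H 0 y = (t - 0) * H' z y"
          by (rule MVT2[OF True], rule deriv') (use t in auto)
        then obtain z where "z > 0" "z < t" "H t y - H 0 y = (t - 0) * H' z y" by blast
        then show ?thesis using t by (intro exI[of _ z]) auto
      next
        case False
        then have "t < 0" using t by simp
        then have "\<exists>z>t. z < 0 \<and> H 0 y - H t y = (0 - t) * H' z y"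
          by (rule MVT2, intro deriv') (use t in auto)
        then obtain z where "z > t" "z < 0" "H 0 y - H t y = (0 - t) * H' z y" by blast
        then show ?thesis using t by (intro exI[of _ z]) (auto simp: algebra_simps)
      qed
      then obtain \<xi> where "\<bar>\<xi>\<bar> < \<eta>" "(H t y - H 0 y) / t = H' \<xi> y" using t by auto
      then show ?thesis using close[OF sub(2) y] by fastforce
    qed
    have "(1 / t) *\<^sub>R ((LINT y:K|lborel. r y * H t y) - (LINT y:K|lborel. r y * H 0 y))
      = (1 / t) * (LINT y:K|lborel. r y * H t y - r y * H 0 y)"
      by (subst set_integral_diff(2)) (auto intro!: cH)
    also have "\<dots> = (LINT y:K|lborel. (1 / t) * (r y * H t y - r y * H 0 y))"
      by simp
    also have "\<dots> = (LINT y:K|lborel. r y * ((H t y - H 0 y) / t))"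
      by (simp add: field_simps)
    finally have eq: "(1 / t) *\<^sub>R ((LINT y:K|lborel. r y * H t y) - (LINT y:K|lborel. r y * H 0 y))
      = (LINT y:K|lborel. r y * ((H t y - H 0 y) / t))" .
    have "\<bar>(LINT y:K|lborel. r y * ((H t y - H 0 y) / t)) - (LINT y:K|lborel. r y * H' 0 y)\<bar> \<le> C * (e / (C + 1))"
      unfolding C_def by (rule weighted_integral_close[OF K r])
        (use est t in \<open>auto intro!: cH cH' simp: C_def\<close>)
    also have "\<dots> < e" using C e by (simp add: field_simps)
    finally show ?thesis unfolding eq by (simp add: dist_real_def)
  qed
  show "\<forall>\<^sub>F t in at 0. dist ((1 / t) *\<^sub>R ((LINT y:K|lborel. r y * H t y) - (LINT y:K|lborel. r y * H 0 y)))
    (LINT y:K|lborel. r y * H' 0 y) < e"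
    unfolding eventually_at using \<eta>(1) main by (auto simp: dist_real_def intro!: exI[of _ \<eta>])
qed

section \<open>Smooth functionals given by integrals\<close>

text \<open>The witness \<open>D\<close> in the definition of smoothness of a real function: \<open>D k\<close> is the \<open>k\<close>-th iterated
  directional derivative. Naming it makes the derivatives of an integral functional available, and not
  only their existence.\<close>

definition derivative_tower :: "'e::real_vector topology \<Rightarrow> 'e set \<Rightarrow> ('e \<Rightarrow> real) \<Rightarrow>
    (nat \<Rightarrow> 'e \<Rightarrow> (nat \<Rightarrow> 'e) \<Rightarrow> real) \<Rightarrow> bool"
  where "derivative_tower T U f D \<longleftrightarrow> (\<forall>x\<in>U. \<forall>v. D 0 x v = f x) \<and>
      (\<forall>k. continuous_map
        (prod_topology (subtopology T U) (product_topology (\<lambda>_. T) {..<k})) euclideanreal (\<lambda>(x, v). D k x v)) \<and>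
      (\<forall>k. \<forall>x\<in>U. \<forall>v \<in> {..<Suc k} \<rightarrow>\<^sub>E topspace T.
        ((\<lambda>t. (1 / t) *\<^sub>R (D k (x + t *\<^sub>R v k) (restrict v {..<k}) - D k x (restrict v {..<k})))
          \<longlongrightarrow> D (Suc k) x v) (at (0::real)))"

lemma frechet_smooth_iff_tower:
  "frechet_smooth T U euclideanreal f \<longleftrightarrow> (\<exists>D. derivative_tower T U f D)"
  by (simp only: frechet_smooth_def derivative_tower_def limitin_canonical_iff)

lemma derivative_towerD:
  assumes "derivative_tower T U f D"
  shows "x \<in> U \<Longrightarrow> D 0 x v = f x"
    and "continuous_map (prod_topology (subtopology T U) (product_topology (\<lambda>_. T) {..<k}))
      euclideanreal (\<lambda>(x, v). D k x v)"
    and "x \<in> U \<Longrightarrow> v \<in> {..<Suc k} \<rightarrow>\<^sub>E topspace T \<Longrightarrow>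
      ((\<lambda>t. (1 / t) *\<^sub>R (D k (x + t *\<^sub>R v k) (restrict v {..<k}) - D k x (restrict v {..<k})))
        \<longlongrightarrow> D (Suc k) x v) (at (0::real))"
  using assms by (simp_all only: derivative_tower_def)

text \<open>The heart of the smoothness proofs. A functional of the form \<open>x \<mapsto> \<integral> r(y) \<phi>(L x y) dy\<close>, where
  \<open>x \<mapsto> L x y\<close> is linear, is differentiated by differentiating \<open>\<phi>\<close> and inserting \<open>L v y\<close> for the
  directions. Hence smoothness of the finite-dimensional function \<open>\<phi>\<close> passes to the functional, on any
  space whose topology makes \<open>(x, y) \<mapsto> L x y\<close> jointly continuous.\<close>

lemma derivative_tower_weighted_integral:
  fixes T :: "'e::real_vector topology"
    and L :: "'e \<Rightarrow> 'p::euclidean_space \<Rightarrow> 'm::euclidean_space"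
  assumes K: "compact K" and r: "continuous_on K r"
    and L_lin: "\<And>x v t y. L (x + t *\<^sub>R v) y = L x y + t *\<^sub>R L v y"
    and L_cont: "continuous_map (prod_topology T (top_of_set K)) euclidean (\<lambda>(x, y). L x y)"
    and U: "U \<subseteq> topspace T" and L_in: "\<And>x y. x \<in> U \<Longrightarrow> y \<in> K \<Longrightarrow> L x y \<in> \<Omega>"
    and \<Omega>: "open \<Omega>"
    and \<Phi>: "derivative_tower euclidean \<Omega> \<phi> \<Phi>"
  shows "derivative_tower T U (\<lambda>x. LINT y:K|lborel. r y * \<phi> (L x y))
    (\<lambda>k x v. LINT y:K|lborel. r y * \<Phi> k (L x y) (\<lambda>i\<in>{..<k}. L (v i) y))"
proof -
  note \<Phi>0 = derivative_towerD(1)[OF \<Phi>] and \<Phi>_cont = derivative_towerD(2)[OF \<Phi>]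
    and \<Phi>_deriv = derivative_towerD(3)[OF \<Phi>, unfolded topspace_euclidean]
  have \<Phi>_comp: "continuous_map Y euclideanreal (\<lambda>q. \<Phi> k (\<xi> q) (\<lambda>i\<in>{..<k}. \<omega> i q))"
    if "continuous_map Y euclidean \<xi>" "\<And>q. q \<in> topspace Y \<Longrightarrow> \<xi> q \<in> \<Omega>"
      "\<And>i. i < k \<Longrightarrow> continuous_map Y euclidean (\<omega> i)"
    for Y :: "'q topology" and k \<xi> \<omega>
  proof -
    have "continuous_map Y (prod_topology (top_of_set \<Omega>) (product_topology (\<lambda>_. euclidean) {..<k}))
        (\<lambda>q. (\<xi> q, \<lambda>i\<in>{..<k}. \<omega> i q))"
    proof (rule continuous_map_pairedI)
      show "continuous_map Y (top_of_set \<Omega>) \<xi>"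
        using that(1,2) by (simp add: continuous_map_in_subtopology image_subset_iff)
      show "continuous_map Y (product_topology (\<lambda>_. euclidean) {..<k}) (\<lambda>q. \<lambda>i\<in>{..<k}. \<omega> i q)"
        by (rule continuous_map_coordinatewise_then_product) (simp_all add: that(3))
    qed
    from continuous_map_compose[OF this \<Phi>_cont[of k]] show ?thesis by (simp add: o_def)
  qed
  have L_comp: "continuous_map Y euclidean (\<lambda>q. L (\<xi> q) (\<eta> q))"
    if "continuous_map Y T \<xi>" "continuous_map Y (top_of_set K) \<eta>" for Y :: "'q topology" and \<xi> \<eta>
    using continuous_map_compose[OF continuous_map_pairedI[OF that] L_cont] by (simp add: o_def)
  define D where "D k x v = (LINT y:K|lborel. r y * \<Phi> k (L x y) (\<lambda>i\<in>{..<k}. L (v i) y))"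
    for k :: nat and x and v :: "nat \<Rightarrow> 'e"
  have D0: "D 0 x v = (LINT y:K|lborel. r y * \<phi> (L x y))" if "x \<in> U" for x v
    unfolding D_def set_lebesgue_integral_def
    by (intro Bochner_Integration.integral_cong refl) (auto simp: indicator_def \<Phi>0 L_in[OF that])
  have D_cont: "continuous_map (prod_topology (subtopology T U) (product_topology (\<lambda>_. T) {..<k}))
      euclideanreal (\<lambda>(x, v). D k x v)" for k
  proof -
    let ?Z = "prod_topology (subtopology T U) (product_topology (\<lambda>_. T) {..<k})"
    let ?Y = "prod_topology ?Z (top_of_set K)"
    have fst_fst: "continuous_map ?Y T (\<lambda>q. fst (fst q))"
      by (rule continuous_map_into_fulltopology[OF continuous_map_fst_app[OF continuous_map_fst]])
    have snd_fst: "continuous_map ?Y T (\<lambda>q. snd (fst q) i)" if "i < k" for i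
    proof -
      have "continuous_map ?Y (product_topology (\<lambda>_. T) {..<k}) (\<lambda>q. snd (fst q))"
        by (rule continuous_map_snd_app[OF continuous_map_fst])
      then show ?thesis using that by (auto dest: continuous_map_product_then_coordinatewise(1))
    qed
    have "continuous_map ?Y euclideanreal
      (\<lambda>q. \<Phi> k (L (fst (fst q)) (snd q)) (\<lambda>i\<in>{..<k}. L (snd (fst q) i) (snd q)))"
      using L_in by (intro \<Phi>_comp L_comp fst_fst snd_fst continuous_map_snd) auto
    then have "continuous_map ?Z euclideanreal
      (\<lambda>z. LINT y:K|lborel. r y * \<Phi> k (L (fst z) y) (\<lambda>i\<in>{..<k}. L (snd z i) y))"
      by (intro weighted_integral_continuous_map[OF K r]) (simp add: case_prod_unfold)
    then show ?thesis by (simp add: D_def case_prod_unfold)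
  qed
  have D_deriv: "((\<lambda>t. (1 / t) *\<^sub>R (D k (x + t *\<^sub>R v k) (restrict v {..<k}) - D k x (restrict v {..<k})))
      \<longlongrightarrow> D (Suc k) x v) (at 0)" if x: "x \<in> U" and v: "v \<in> {..<Suc k} \<rightarrow>\<^sub>E topspace T" for k x v
  proof -
    have xT: "x \<in> topspace T" and vT: "\<And>i. i \<le> k \<Longrightarrow> v i \<in> topspace T" using x U v by auto
    have const: "continuous_map Y euclidean (\<lambda>q. L u (\<eta> q))"
      if "u \<in> topspace T" "continuous_map Y (top_of_set K) \<eta>" for Y :: "'q topology" and u \<eta>
      using that by (intro L_comp) auto
    define z where "z t y = L x y + t *\<^sub>R L (v k) y" for t y
    have z_cont: "continuous_map Y euclidean (\<lambda>q. z (\<tau> q) (\<eta> q))"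
      if "continuous_map Y euclideanreal \<tau>" "continuous_map Y (top_of_set K) \<eta>" for Y :: "'q topology" and \<tau> \<eta>
      unfolding z_def using that xT vT by (intro continuous_map_add continuous_map_scaleR const) auto
    (* Compactness of K keeps the whole segment inside the open set for all y at once. *)
    obtain \<delta> where \<delta>: "0 < \<delta>" and z_in: "\<And>t y. \<bar>t\<bar> < \<delta> \<Longrightarrow> y \<in> K \<Longrightarrow> z t y \<in> \<Omega>"
    proof -
      let ?P = "prod_topology euclideanreal (top_of_set K)"
      have "openin ?P {q \<in> topspace ?P. z (fst q) (snd q) \<in> \<Omega>}"
        by (rule openin_continuous_map_preimage[OF z_cont])
          (use \<Omega> in \<open>auto simp: continuous_map_fst continuous_map_snd simp flip: open_openin\<close>)
      then have "\<exists>V W. openin euclideanreal V \<and> openin (top_of_set K) W \<and> 0 \<in> V \<and> K \<subseteq> W \<and>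
          V \<times> W \<subseteq> {q \<in> topspace ?P. z (fst q) (snd q) \<in> \<Omega>}"
        by (rule tube_lemma_right) (use K L_in[OF x] in \<open>auto simp: compactin_subtopology z_def\<close>)
      then obtain V W where "openin euclideanreal V" and VW: "0 \<in> V" "K \<subseteq> W"
          "V \<times> W \<subseteq> {q \<in> topspace ?P. z (fst q) (snd q) \<in> \<Omega>}"
        by blast
      then have "open V" by (simp flip: open_openin)
      then obtain \<delta> where "0 < \<delta>" "ball 0 \<delta> \<subseteq> V" using VW(1) openE by blast
      then show thesis using VW by (intro that[of \<delta>]) (auto simp: subset_iff dist_real_def)
    qed
    define w where "w y = (\<lambda>i\<in>{..<Suc k}. L (v i) y)" for y
    have w_res: "restrict (w y) {..<k} = (\<lambda>i\<in>{..<k}. L (v i) y)" and w_k: "w y k = L (v k) y" for y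
      by (auto simp: w_def restrict_def)
    have "((\<lambda>t. (1 / t) *\<^sub>R ((LINT y:K|lborel. r y * \<Phi> k (z t y) (restrict (w y) {..<k}))
          - (LINT y:K|lborel. r y * \<Phi> k (z 0 y) (restrict (w y) {..<k}))))
        \<longlongrightarrow> (LINT y:K|lborel. r y * \<Phi> (Suc k) (z 0 y) (w y))) (at 0)"
    proof (rule weighted_integral_has_derivative[OF K r \<delta>])
      fix t assume t: "\<bar>t\<bar> < \<delta>"
      have "continuous_map (top_of_set K) euclideanreal (\<lambda>y. \<Phi> k (z t y) (\<lambda>i\<in>{..<k}. L (v i) y))"
        using vT z_in[OF t] by (intro \<Phi>_comp z_cont const) auto
      then show "continuous_on K (\<lambda>y. \<Phi> k (z t y) (restrict (w y) {..<k}))"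
        by (simp add: w_res continuous_map_iff_continuous)
    next
      have "continuous_map (prod_topology (top_of_set {-\<delta><..<\<delta>}) (top_of_set K)) euclideanreal
        (\<lambda>q. \<Phi> (Suc k) (z (fst q) (snd q)) (\<lambda>i\<in>{..<Suc k}. L (v i) (snd q)))"
      proof (intro \<Phi>_comp z_cont const continuous_map_snd)
        show "continuous_map (prod_topology (top_of_set {-\<delta><..<\<delta>}) (top_of_set K)) euclideanreal fst"
          using continuous_map_fst[of "top_of_set {-\<delta><..<\<delta>}" "top_of_set K"]
          by (simp add: continuous_map_in_subtopology)
      qed (use vT z_in in auto)
      then show "continuous_map (prod_topology (top_of_set {-\<delta><..<\<delta>}) (top_of_set K)) euclideanreal
        (\<lambda>(t, y). \<Phi> (Suc k) (z t y) (w y))"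
        by (simp add: w_def case_prod_unfold)
    next
      fix t y assume t: "\<bar>t\<bar> < \<delta>" and y: "y \<in> K"
      have "((\<lambda>h. (1 / h) *\<^sub>R (\<Phi> k (z t y + h *\<^sub>R w y k) (restrict (w y) {..<k})
          - \<Phi> k (z t y) (restrict (w y) {..<k}))) \<longlongrightarrow> \<Phi> (Suc k) (z t y) (w y)) (at 0)"
        by (rule \<Phi>_deriv[OF z_in[OF t y]]) (simp add: w_def PiE_def extensional_def)
      then show "((\<lambda>s. \<Phi> k (z s y) (restrict (w y) {..<k})) has_real_derivative
          \<Phi> (Suc k) (z t y) (w y)) (at t)"
        by (simp add: DERIV_def w_k z_def algebra_simps divide_inverse_commute)
    qed
    moreover have "D k (x + t *\<^sub>R v k) (restrict v {..<k})
        = (LINT y:K|lborel. r y * \<Phi> k (z t y) (restrict (w y) {..<k}))" for t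
      unfolding D_def L_lin z_def w_res by (simp cong: restrict_cong)
    moreover have "D k x (restrict v {..<k})
        = (LINT y:K|lborel. r y * \<Phi> k (z 0 y) (restrict (w y) {..<k}))"
      unfolding D_def z_def w_res by (simp cong: restrict_cong)
    moreover have "D (Suc k) x v = (LINT y:K|lborel. r y * \<Phi> (Suc k) (z 0 y) (w y))"
      by (simp add: D_def z_def w_def)
    ultimately show ?thesis by simp
  qed
  have "derivative_tower T U (\<lambda>x. LINT y:K|lborel. r y * \<phi> (L x y)) D"
    using D0 D_cont D_deriv by (simp only: derivative_tower_def) blast
  then show ?thesis unfolding D_def .
qed

lemma frechet_smooth_weighted_integral:
  fixes T :: "'e::real_vector topology"
    and L :: "'e \<Rightarrow> 'p::euclidean_space \<Rightarrow> 'm::euclidean_space"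
  assumes "compact K" "continuous_on K r"
    and "\<And>x v t y. L (x + t *\<^sub>R v) y = L x y + t *\<^sub>R L v y"
    and "continuous_map (prod_topology T (top_of_set K)) euclidean (\<lambda>(x, y). L x y)"
    and "U \<subseteq> topspace T" "\<And>x y. x \<in> U \<Longrightarrow> y \<in> K \<Longrightarrow> L x y \<in> \<Omega>" "open \<Omega>"
    and \<phi>: "frechet_smooth euclidean \<Omega> euclideanreal \<phi>"
  shows "frechet_smooth T U euclideanreal (\<lambda>x. LINT y:K|lborel. r y * \<phi> (L x y))"
proof -
  from \<phi> obtain \<Phi> where "derivative_tower euclidean \<Omega> \<phi> \<Phi>"
    unfolding frechet_smooth_iff_tower by blast
  from derivative_tower_weighted_integral[OF assms(1-7) this]
  show ?thesis unfolding frechet_smooth_iff_tower by blast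
qed

text \<open>The first derivative of an integral functional, computed from any pointwise derivative of the
  integrand: the first stage of a derivative tower is determined by uniqueness of limits.\<close>

lemma weighted_integral_directional_derivative:
  fixes T :: "'e::real_vector topology"
    and L :: "'e \<Rightarrow> 'p::euclidean_space \<Rightarrow> 'm::euclidean_space"
  assumes "compact K" "continuous_on K r"
    and "\<And>x v t y. L (x + t *\<^sub>R v) y = L x y + t *\<^sub>R L v y"
    and "continuous_map (prod_topology T (top_of_set K)) euclidean (\<lambda>(x, y). L x y)"
    and "U \<subseteq> topspace T" and L_in: "\<And>x y. x \<in> U \<Longrightarrow> y \<in> K \<Longrightarrow> L x y \<in> \<Omega>" and "open \<Omega>"
    and \<phi>: "frechet_smooth euclidean \<Omega> euclideanreal \<phi>"
    and \<phi>': "\<And>z w. z \<in> \<Omega> \<Longrightarrow> ((\<lambda>t. \<phi> (z + t *\<^sub>R w)) has_real_derivative \<phi>' z w) (at 0)"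
    and x: "x \<in> U" and v: "v \<in> topspace T" and line: "\<forall>\<^sub>F t in at 0. x + t *\<^sub>R v \<in> U"
  shows "((\<lambda>t. (1 / t) *\<^sub>R ((LINT y:K|lborel. r y * \<phi> (L (x + t *\<^sub>R v) y))
      - (LINT y:K|lborel. r y * \<phi> (L x y)))) \<longlongrightarrow> (LINT y:K|lborel. r y * \<phi>' (L x y) (L v y))) (at 0)"
proof -
  from \<phi> obtain \<Phi> where \<Phi>: "derivative_tower euclidean \<Omega> \<phi> \<Phi>"
    unfolding frechet_smooth_iff_tower by blast
  let ?F = "\<lambda>x. LINT y:K|lborel. r y * \<phi> (L x y)"
  define D where "D k x v = (LINT y:K|lborel. r y * \<Phi> k (L x y) (\<lambda>i\<in>{..<k}. L (v i) y))"
    for k :: nat and x and v :: "nat \<Rightarrow> 'e"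
  have tower: "derivative_tower T U ?F D"
    unfolding D_def by (rule derivative_tower_weighted_integral[OF assms(1-7) \<Phi>])
  have \<Phi>1: "\<Phi> 1 z (\<lambda>i\<in>{..<1}. w) = \<phi>' z w" if z: "z \<in> \<Omega>" for z w
  proof (rule tendsto_unique)
    let ?w = "\<lambda>i\<in>{..<Suc 0}. w"
    have "\<forall>\<^sub>F t in at 0. z + t *\<^sub>R w \<in> \<Omega>"
      using z \<open>open \<Omega>\<close> by (intro topological_tendstoD[where l = z]) (auto intro!: tendsto_eq_intros)
    then have "\<forall>\<^sub>F t in at 0. (1 / t) *\<^sub>R (\<Phi> 0 (z + t *\<^sub>R ?w 0) (restrict ?w {..<0}) - \<Phi> 0 z (restrict ?w {..<0}))
        = (1 / t) *\<^sub>R (\<phi> (z + t *\<^sub>R w) - \<phi> z)"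
      by (rule eventually_mono) (simp add: derivative_towerD(1)[OF \<Phi>] z)
    moreover have "((\<lambda>t. (1 / t) *\<^sub>R (\<Phi> 0 (z + t *\<^sub>R ?w 0) (restrict ?w {..<0}) - \<Phi> 0 z (restrict ?w {..<0})))
        \<longlongrightarrow> \<Phi> (Suc 0) z ?w) (at 0)"
      by (rule derivative_towerD(3)[OF \<Phi> z]) (auto simp: PiE_def extensional_def)
    ultimately show "((\<lambda>t. (1 / t) *\<^sub>R (\<phi> (z + t *\<^sub>R w) - \<phi> z)) \<longlongrightarrow> \<Phi> 1 z (\<lambda>i\<in>{..<1}. w)) (at 0)"
      unfolding One_nat_def by (rule Lim_transform_eventually[rotated])
    show "((\<lambda>t. (1 / t) *\<^sub>R (\<phi> (z + t *\<^sub>R w) - \<phi> z)) \<longlongrightarrow> \<phi>' z w) (at 0)"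
      using \<phi>'[OF z, of w] by (simp add: DERIV_def divide_inverse_commute)
  qed simp
  let ?v = "\<lambda>i\<in>{..<Suc 0}. v"
  have D1: "D 1 x ?v = (LINT y:K|lborel. r y * \<phi>' (L x y) (L v y))"
    unfolding D_def set_lebesgue_integral_def
  proof (intro Bochner_Integration.integral_cong refl)
    fix y
    have "(\<lambda>i\<in>{..<1}. L (?v i) y) = (\<lambda>i\<in>{..<1}. L v y)" by (rule restrict_ext) simp
    then show "indicator K y *\<^sub>R (r y * \<Phi> 1 (L x y) (\<lambda>i\<in>{..<1}. L (?v i) y))
        = indicator K y *\<^sub>R (r y * \<phi>' (L x y) (L v y))"
      using \<Phi>1[OF L_in[OF x]] by (cases "y \<in> K") simp_all
  qed
  have lim: "((\<lambda>t. (1 / t) *\<^sub>R (D 0 (x + t *\<^sub>R ?v 0) (restrict ?v {..<0}) - D 0 x (restrict ?v {..<0})))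
        \<longlongrightarrow> D (Suc 0) x ?v) (at 0)"
    by (rule derivative_towerD(3)[OF tower x]) (use v in \<open>auto simp: PiE_def extensional_def\<close>)
  have "\<forall>\<^sub>F t in at 0. (1 / t) *\<^sub>R (D 0 (x + t *\<^sub>R ?v 0) (restrict ?v {..<0}) - D 0 x (restrict ?v {..<0}))
        = (1 / t) *\<^sub>R (?F (x + t *\<^sub>R v) - ?F x)"
    using line by (rule eventually_mono) (simp add: derivative_towerD(1)[OF tower] x)
  from Lim_transform_eventually[OF lim this] show ?thesis
    unfolding D1[unfolded One_nat_def] .
qed

lemma frechet_smooth_cong:
  assumes "\<And>x. x \<in> U \<Longrightarrow> f x = g x"
  shows "frechet_smooth T U T' f \<longleftrightarrow> frechet_smooth T U T' g"
  using assms unfolding frechet_smooth_def by (simp cong: ball_cong)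

lemma frechet_smooth_sum:
  fixes T :: "'a::real_vector topology"
  assumes "finite I" and f: "\<And>i. i \<in> I \<Longrightarrow> frechet_smooth T U euclideanreal (f i)"
  shows "frechet_smooth T U euclideanreal (\<lambda>x. \<Sum>i\<in>I. f i x)"
proof -
  have "\<forall>i\<in>I. \<exists>D. derivative_tower T U (f i) D"
    using f unfolding frechet_smooth_iff_tower by blast
  from bchoice[OF this] obtain D where "\<And>i. i \<in> I \<Longrightarrow> derivative_tower T U (f i) (D i)" by blast
  note D = derivative_towerD[OF this]
  have "((\<lambda>t. (1 / t) *\<^sub>R ((\<Sum>i\<in>I. D i k (x + t *\<^sub>R v k) (restrict v {..<k})) - (\<Sum>i\<in>I. D i k x (restrict v {..<k}))))
          \<longlongrightarrow> (\<Sum>i\<in>I. D i (Suc k) x v)) (at (0::real))"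
    if "x \<in> U" "v \<in> {..<Suc k} \<rightarrow>\<^sub>E topspace T" for k x v
    using tendsto_sum[OF D(3)[OF _ that], of I "\<lambda>i. i"]
    by (simp only: flip: scaleR_sum_right sum_subtractf)
  moreover have "continuous_map (prod_topology (subtopology T U) (product_topology (\<lambda>_. T) {..<k}))
      euclideanreal (\<lambda>(x, v). \<Sum>i\<in>I. D i k x v)" for k
    using D(2)[of _ k] \<open>finite I\<close> by (simp add: case_prod_unfold continuous_map_sum)
  ultimately have "derivative_tower T U (\<lambda>x. \<Sum>i\<in>I. f i x) (\<lambda>k x v. \<Sum>i\<in>I. D i k x v)"
    unfolding derivative_tower_def using D(1) by simp
  then show ?thesis unfolding frechet_smooth_iff_tower by blast
qed

section \<open>Smooth functions in finite dimensions\<close>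

text \<open>The iterated directional derivative, written through partial derivatives \<open>d b f\<close> in the
  directions of the standard basis so that it is visibly continuous in the directions. The first direction is
  consumed first, so that differentiating in a further direction only extends the recursion at its end.\<close>

primrec iter_dir ::
    "('m \<Rightarrow> ('m \<Rightarrow> real) \<Rightarrow> 'm \<Rightarrow> real) \<Rightarrow> nat \<Rightarrow> ('m::euclidean_space \<Rightarrow> real) \<Rightarrow> 'm \<Rightarrow> (nat \<Rightarrow> 'm) \<Rightarrow> real"
  where
    "iter_dir d 0 f x v = f x"
  | "iter_dir d (Suc k) f x v = (\<Sum>b\<in>Basis. (v 0 \<bullet> b) * iter_dir d k (d b f) x (\<lambda>i. v (Suc i)))"

lemma iter_dir_cong:
  "(\<And>i. i < k \<Longrightarrow> v i = w i) \<Longrightarrow> iter_dir d k f x v = iter_dir d k f x w"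
proof (induction k arbitrary: f v w)
  case (Suc k)
  have "iter_dir d k (d b f) x (\<lambda>i. v (Suc i)) = iter_dir d k (d b f) x (\<lambda>i. w (Suc i))" for b
    by (rule Suc.IH) (simp add: Suc.prems)
  then show ?case using Suc.prems[of 0] by simp
qed simp

text \<open>To show that a function is smooth it suffices to place it in a class of functions each of which is
  differentiable with all directional derivatives again in the class. Differentiability then yields both
  continuity and existence of every iterated derivative.\<close>

lemma frechet_smooth_if_closed_under_derivatives:
  fixes C :: "('m::euclidean_space \<Rightarrow> real) set"
  assumes closed: "\<And>f. f \<in> C \<Longrightarrow>
      \<exists>d. (\<forall>w. d w \<in> C) \<and> (\<forall>x\<in>\<Omega>. (f has_derivative (\<lambda>w. d w x)) (at x))"
    and f: "f \<in> C"
  shows "frechet_smooth euclidean \<Omega> euclideanreal f"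
proof -
  obtain d where d: "\<And>f w. f \<in> C \<Longrightarrow> d w f \<in> C"
    "\<And>f x. f \<in> C \<Longrightarrow> x \<in> \<Omega> \<Longrightarrow> (f has_derivative (\<lambda>w. d w f x)) (at x)"
  proof -
    have "\<forall>f\<in>C. \<exists>d. (\<forall>w. d w \<in> C) \<and> (\<forall>x\<in>\<Omega>. (f has_derivative (\<lambda>w. d w x)) (at x))"
      using closed by blast
    from bchoice[OF this] obtain e where
      "\<forall>f\<in>C. (\<forall>w. e f w \<in> C) \<and> (\<forall>x\<in>\<Omega>. (f has_derivative (\<lambda>w. e f w x)) (at x))" by blast
    then show thesis by (intro that[of "\<lambda>w f. e f w"]) auto
  qed
  have cont: "continuous_map Y euclideanreal (\<lambda>q. iter_dir d k g (\<xi> q) (\<lambda>i. \<omega> i q))"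
    if "g \<in> C" "continuous_map Y (top_of_set \<Omega>) \<xi>" "\<And>i. i < k \<Longrightarrow> continuous_map Y euclidean (\<omega> i)"
    for Y :: "'q topology" and k g \<xi> \<omega>
    using that
  proof (induction k arbitrary: g \<omega>)
    case 0
    have "continuous_on \<Omega> g"
      by (meson d(2)[OF \<open>g \<in> C\<close>] continuous_at_imp_continuous_on has_derivative_continuous)
    then have "continuous_map (top_of_set \<Omega>) euclideanreal g" by simp
    from continuous_map_compose[OF 0(2) this] show ?case by (simp add: o_def)
  next
    case (Suc k)
    have "continuous_map Y euclideanreal (\<lambda>q. \<omega> 0 q \<bullet> b)" for b
      using continuous_map_compose[OF Suc.prems(3)[of 0], of euclideanreal "\<lambda>w. w \<bullet> b"]
      by (simp add: o_def continuous_on_inner)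
    moreover have "continuous_map Y euclideanreal (\<lambda>q. iter_dir d k (d b g) (\<xi> q) (\<lambda>i. \<omega> (Suc i) q))" for b
      using Suc.prems d(1) by (intro Suc.IH) auto
    ultimately show ?case
      by (auto intro!: continuous_map_sum continuous_map_real_mult)
  qed
  have deriv: "((\<lambda>t. iter_dir d k g (x + t *\<^sub>R v k) v) has_real_derivative iter_dir d (Suc k) g x v) (at 0)"
    if "g \<in> C" "x \<in> \<Omega>" for k g x v
    using that
  proof (induction k arbitrary: g v)
    case 0
    have lin: "linear (\<lambda>w. d w g x)"
      using d(2)[OF 0] by (rule has_derivative_linear)
    have "d (v 0) g x = (\<Sum>b\<in>Basis. (v 0 \<bullet> b) * d b g x)"
      by (subst euclidean_representation[of "v 0", symmetric])
        (simp add: linear_sum[OF lin] linear_cmul[OF lin] del: euclidean_representation)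
    moreover have "((\<lambda>t. g (x + t *\<^sub>R v 0)) has_derivative (\<lambda>t. d (t *\<^sub>R v 0) g x)) (at 0)"
      by (rule has_derivative_compose[of "\<lambda>t. x + t *\<^sub>R v 0" "\<lambda>t. t *\<^sub>R v 0" 0 UNIV])
        (auto intro!: derivative_eq_intros d(2)[OF 0])
    ultimately show ?case
      by (simp add: has_field_derivative_def linear_cmul[OF lin] mult.commute[of _ "sum _ _"])
  next
    case (Suc k)
    have "((\<lambda>t. iter_dir d k (d b g) (x + t *\<^sub>R v (Suc k)) (\<lambda>i. v (Suc i))) has_real_derivative
        iter_dir d (Suc k) (d b g) x (\<lambda>i. v (Suc i))) (at 0)" for b
      using Suc.IH[of "d b g" "\<lambda>i. v (Suc i)"] Suc.prems d(1) by simp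
    then show ?case
      by (subst iter_dir.simps, subst iter_dir.simps) (intro DERIV_sum DERIV_cmult)
  qed
  have lim: "((\<lambda>t. (1 / t) *\<^sub>R (iter_dir d k f (x + t *\<^sub>R v k) (restrict v {..<k})
      - iter_dir d k f x (restrict v {..<k}))) \<longlongrightarrow> iter_dir d (Suc k) f x v) (at 0)"
    if "x \<in> \<Omega>" for k x v
  proof -
    have "iter_dir d k f y (restrict v {..<k}) = iter_dir d k f y v" for y
      by (rule iter_dir_cong) simp
    then show ?thesis
      using deriv[OF f that, of k v] by (simp add: DERIV_def divide_inverse_commute)
  qed
  have "continuous_map (prod_topology (top_of_set \<Omega>) (product_topology (\<lambda>_. euclidean) {..<k}))
      euclideanreal (\<lambda>(x, v). iter_dir d k f x v)" for k
  proof -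
    let ?V = "product_topology (\<lambda>_. euclidean) {..<k} :: (nat \<Rightarrow> 'm) topology"
    have coord: "continuous_map (prod_topology (top_of_set \<Omega>) ?V) euclidean (\<lambda>q. snd q i)" if "i < k" for i
      using continuous_map_compose[OF continuous_map_snd continuous_map_product_coordinates[of i "{..<k}" "\<lambda>_. euclidean"]] that
      by (simp add: o_def)
    have "continuous_map (prod_topology (top_of_set \<Omega>) ?V) euclideanreal
        (\<lambda>q. iter_dir d k f (fst q) (\<lambda>i. snd q i))"
      by (rule cont[OF f continuous_map_fst coord])
    then show ?thesis by (simp add: case_prod_unfold)
  qed
  then have "derivative_tower euclidean \<Omega> f (\<lambda>k. iter_dir d k f)"
    if "\<And>k x v. x \<in> \<Omega> \<Longrightarrow> ((\<lambda>t. (1 / t) *\<^sub>R (iter_dir d k f (x + t *\<^sub>R v k) (restrict v {..<k})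
      - iter_dir d k f x (restrict v {..<k}))) \<longlongrightarrow> iter_dir d (Suc k) f x v) (at 0)"
    using that unfolding derivative_tower_def by (simp del: iter_dir.simps(2))
  then show ?thesis using lim unfolding frechet_smooth_iff_tower by blast
qed

section \<open>Positive definite matrices\<close>

definition pos_def :: "real ^ 'n ^ 'n \<Rightarrow> bool"
  where "pos_def M \<longleftrightarrow> (\<forall>\<xi>. \<xi> \<noteq> 0 \<longrightarrow> 0 < \<xi> \<bullet> (M *v \<xi>))"

lemma pos_def_iff_sphere:
  fixes M :: "real ^ 'n ^ 'n"
  shows "pos_def M \<longleftrightarrow> (\<forall>\<xi>\<in>sphere 0 1. 0 < \<xi> \<bullet> (M *v \<xi>))"
proof
  assume *: "\<forall>\<xi>\<in>sphere 0 1. 0 < \<xi> \<bullet> (M *v \<xi>)"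
  show "pos_def M"
    unfolding pos_def_def
  proof (intro allI impI)
    fix \<xi> :: "real ^ 'n" assume "\<xi> \<noteq> 0"
    then have "0 < sgn \<xi> \<bullet> (M *v sgn \<xi>)" using * by (auto simp: norm_sgn)
    then show "0 < \<xi> \<bullet> (M *v \<xi>)"
      using \<open>\<xi> \<noteq> 0\<close> by (simp add: sgn_div_norm matrix_vector_mult_scaleR zero_less_mult_iff)
  qed
next
  assume "pos_def M"
  moreover have "\<xi> \<noteq> 0" if "\<xi> \<in> sphere 0 1" for \<xi> :: "real ^ 'n" using that by auto
  ultimately show "\<forall>\<xi>\<in>sphere 0 1. 0 < \<xi> \<bullet> (M *v \<xi>)" by (simp add: pos_def_def)
qed

text \<open>By homogeneity positivity need only be tested on the unit sphere, and compactness of the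
  sphere makes it an open condition.\<close>

lemma open_pos_def: "open (Collect (pos_def :: real ^ 'n ^ 'n \<Rightarrow> bool))"
proof (subst open_subopen, intro ballI)
  fix M :: "real ^ 'n ^ 'n" assume "M \<in> Collect pos_def"
  then have M: "0 < \<xi> \<bullet> (M *v \<xi>)" if "\<xi> \<in> sphere 0 1" for \<xi>
    using that by (simp add: pos_def_iff_sphere)
  have "continuous_on UNIV (\<lambda>q :: (real ^ 'n ^ 'n) \<times> (real ^ 'n). snd q \<bullet> (fst q *v snd q))"
    by (simp add: matrix_vector_mult_def inner_vec_def) (intro continuous_intros)
  then have "open {q :: (real ^ 'n ^ 'n) \<times> (real ^ 'n). 0 < snd q \<bullet> (fst q *v snd q)}"
    by (intro open_Collect_less continuous_on_const)
  moreover have "{M} \<times> sphere 0 1 \<subseteq> {q. 0 < snd q \<bullet> (fst q *v snd q)}" using M by auto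
  ultimately have "\<exists>V. M \<in> V \<and> open V \<and> V \<times> sphere 0 1 \<subseteq> {q. 0 < snd q \<bullet> (fst q *v snd q)}"
    by (intro Elementary_Topology.tube_lemma compact_sphere)
  then obtain V where "M \<in> V" "open V" "V \<times> sphere 0 1 \<subseteq> {q. 0 < snd q \<bullet> (fst q *v snd q)}" by blast
  then show "\<exists>V. open V \<and> M \<in> V \<and> V \<subseteq> Collect pos_def"
    by (intro exI[of _ V]) (auto simp: pos_def_iff_sphere subset_iff)
qed

lemma pos_def_det_nonzero: "pos_def M \<Longrightarrow> det M \<noteq> 0"
  unfolding invertible_det_nz[symmetric] invertible_left_inverse matrix_left_invertible_ker pos_def_def
  by (metis inner_zero_right less_irrefl)

text \<open>The determinant does not vanish along the segment from the identity matrix, where it is 1, so it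
  cannot change sign.\<close>

lemma pos_def_det_pos:
  assumes "pos_def (M :: real ^ 'n ^ 'n)"
  shows "0 < det M"
proof (rule ccontr)
  define N where "N t = (1 - t) *\<^sub>R mat 1 + t *\<^sub>R M" for t
  assume "\<not> 0 < det M"
  moreover have "continuous_on {0..1} (\<lambda>t. det (N t))"
    unfolding det_def N_def by (simp, intro continuous_intros)
  ultimately obtain t where t: "0 \<le> t" "t \<le> 1" "det (N t) = 0"
    using IVT2'[of "\<lambda>t. det (N t)" 1 0 0] by (auto simp: N_def)
  have "0 < \<xi> \<bullet> (N t *v \<xi>)" if "\<xi> \<noteq> 0" for \<xi>
  proof -
    have "\<xi> \<bullet> (N t *v \<xi>) = (1 - t) * (\<xi> \<bullet> \<xi>) + t * (\<xi> \<bullet> (M *v \<xi>))"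
      by (simp add: N_def matrix_vector_mult_add_rdistrib inner_add_right flip: scaleR_matrix_vector_assoc)
    moreover have "0 < \<xi> \<bullet> \<xi>" "0 < \<xi> \<bullet> (M *v \<xi>)"
      using that assms by (auto simp: pos_def_def)
    ultimately show ?thesis using t
      by (cases "t = 0") (auto intro!: add_nonneg_pos mult_nonneg_nonneg)
  qed
  then have "pos_def (N t)" by (simp add: pos_def_def)
  with t(3) show False using pos_def_det_nonzero by blast
qed

lemma matrix_inv_right: "invertible A \<Longrightarrow> A ** matrix_inv A = mat 1"
  and matrix_inv_left: "invertible A \<Longrightarrow> matrix_inv A ** A = mat 1"
  unfolding invertible_def matrix_inv_def by (metis (mono_tags, lifting) someI_ex)+

lemma matrix_inv_unique: "A ** B = mat 1 \<Longrightarrow> B ** A = mat 1 \<Longrightarrow> matrix_inv A = B"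
  by (metis invertible_def matrix_inv_left matrix_mul_assoc matrix_mul_lid matrix_mul_rid)

lemma matrix_mult_add_left: "(A + B) ** C = A ** C + B ** (C :: real ^ 'n ^ 'm)"
  by (simp add: vec_eq_iff matrix_matrix_mult_def distrib_right sum.distrib)

lemma matrix_mult_scaleR_right: "A ** (t *\<^sub>R B) = t *\<^sub>R (A ** (B :: real ^ 'n ^ 'm))"
  and matrix_mult_scaleR_left: "(t *\<^sub>R A) ** B = t *\<^sub>R (A ** (B :: real ^ 'n ^ 'm))"
  by (simp_all add: vec_eq_iff matrix_matrix_mult_def sum_distrib_left mult_ac)

lemma inner_matrix_vector_sym:
  fixes P :: "real ^ 'n ^ 'n"
  assumes "transpose P = P"
  shows "\<xi> \<bullet> (P *v \<eta>) = \<eta> \<bullet> (P *v \<xi>)"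
  by (metis assms dot_lmul_matrix inner_commute vector_transpose_matrix)

text \<open>Completing the square in one coordinate; this drives the elimination step below, both for a
  vanishing and for a positive diagonal entry.\<close>

lemma quadratic_form_shift:
  fixes P :: "real ^ 'n ^ 'n"
  assumes "transpose P = P"
  shows "(\<xi> - s *\<^sub>R axis i 1) \<bullet> (P *v (\<xi> - s *\<^sub>R axis i 1))
    = \<xi> \<bullet> (P *v \<xi>) - 2 * s * (P *v \<xi>) $ i + s\<^sup>2 * P $ i $ i"
proof -
  have "\<xi> \<bullet> (P *v axis i 1) = (P *v \<xi>) $ i"
    by (subst inner_matrix_vector_sym[OF assms]) (simp add: inner_axis')
  moreover have "axis i 1 \<bullet> (P *v axis i 1) = P $ i $ i"
    by (simp add: inner_axis' matrix_vector_mult_basis column_def)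
  ultimately show ?thesis
    by (simp add: matrix_vector_mult_diff_distrib matrix_vector_mult_scaleR inner_diff_left
        inner_diff_right inner_axis' power2_eq_square algebra_simps)
qed

definition outer :: "real ^ 'n \<Rightarrow> real ^ 'n \<Rightarrow> real ^ 'n ^ 'n"
  where "outer y z = (\<chi> i j. y $ i * z $ j)"

lemma outer_vector: "outer y z *v \<xi> = (z \<bullet> \<xi>) *\<^sub>R y"
  by (simp add: vec_eq_iff outer_def matrix_vector_mult_def inner_vec_def sum_distrib_right
      sum_distrib_left mult_ac)

text \<open>A Cholesky type elimination. If the diagonal entry at \<open>i\<close> vanishes, then so does the whole row;
  otherwise subtracting a multiple of the outer square of the \<open>i\<close>-th column clears the row and leaves a
  positive semidefinite matrix. The set \<open>S\<close> contains the rows not yet cleared.\<close>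

lemma pos_semidef_sum_outer_supported:
  fixes P :: "real ^ 'n ^ 'n"
  assumes "finite S" "transpose P = P" "\<And>\<xi>. 0 \<le> \<xi> \<bullet> (P *v \<xi>)"
    and "\<And>i j. i \<notin> S \<Longrightarrow> P $ i $ j = 0"
  shows "\<exists>ys. P = (\<Sum>y\<leftarrow>ys. outer y y)"
  using assms
proof (induction S arbitrary: P rule: finite_induct)
  case empty
  then have "P = 0" by (simp add: vec_eq_iff)
  then show ?case by (intro exI[of _ "[]"]) simp
next
  case (insert i S)
  have sym: "P $ k $ j = P $ j $ k" for j k
    using insert.prems(1) by (simp add: transpose_def vec_eq_iff)
  note shift = quadratic_form_shift[OF insert.prems(1)]
  have diag: "0 \<le> P $ i $ i"
    using insert.prems(2)[of "axis i 1"] by (simp add: inner_axis' matrix_vector_mult_basis column_def)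
  show ?case
  proof (cases "P $ i $ i = 0")
    case True
    have "P $ i $ j = 0" for j
    proof (rule ccontr)
      assume nz: "P $ i $ j \<noteq> 0"
      have "0 \<le> P $ j $ j - 2 * s * P $ i $ j" for s
        using insert.prems(2)[of "axis j 1 - s *\<^sub>R axis i 1"] unfolding shift
        by (simp add: True inner_axis' matrix_vector_mult_basis column_def)
      (* An affine function of s that is bounded below is constant; this s makes it equal to -1. *)
      from this[of "(P $ j $ j + 1) / (2 * P $ i $ j)"] show False using nz by simp
    qed
    then show ?thesis using insert.prems by (intro insert.IH) (auto, metis)
  next
    case False
    define a where "a = P $ i $ i"
    have a: "0 < a" using False diag by (simp add: a_def)
    define y where "y = (1 / sqrt a) *\<^sub>R column i P"
    have y_inner: "y \<bullet> \<xi> = (P *v \<xi>) $ i / sqrt a" for \<xi>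
      by (simp add: y_def column_def inner_vec_def matrix_vector_mult_def sym[of _ i] sum_divide_distrib)
    define P' where "P' = P - outer y y"
    have "0 \<le> \<xi> \<bullet> (P' *v \<xi>)" for \<xi>
    proof -
      (* The shift minimises the quadratic form along the i-th axis. *)
      have "0 \<le> \<xi> \<bullet> (P *v \<xi>) - 2 * ((P *v \<xi>) $ i / a) * (P *v \<xi>) $ i + ((P *v \<xi>) $ i / a)\<^sup>2 * a"
        using insert.prems(2)[of "\<xi> - ((P *v \<xi>) $ i / a) *\<^sub>R axis i 1"] unfolding shift a_def .
      also have "\<dots> = \<xi> \<bullet> (P *v \<xi>) - ((P *v \<xi>) $ i)\<^sup>2 / a"
        using a by (simp add: power2_eq_square field_simps)
      also have "\<dots> = \<xi> \<bullet> (P' *v \<xi>)"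
        using a by (simp add: P'_def matrix_vector_mult_diff_rdistrib outer_vector inner_diff_right
            y_inner inner_commute[of \<xi> y] power2_eq_square)
      finally show ?thesis .
    qed
    moreover have "P' $ k $ j = 0" if "k \<notin> S" for k j
    proof (cases "k = i")
      case True
      then have "P' $ k $ j = P $ i $ j - (a / sqrt a) * (P $ j $ i / sqrt a)"
        by (simp add: P'_def outer_def y_def column_def a_def)
      also have "\<dots> = P $ i $ j - P $ j $ i" using a by (simp add: field_simps)
      finally show ?thesis using sym[of i j] by simp
    next
      case False
      then have "P $ k $ j = 0" "P $ k $ i = 0" using that insert.prems(3) by auto
      then show ?thesis by (simp add: P'_def outer_def y_def column_def)
    qed
    moreover have "transpose P' = P'"
      by (simp add: P'_def outer_def transpose_def vec_eq_iff sym mult.commute)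
    ultimately obtain ys where "P' = (\<Sum>y\<leftarrow>ys. outer y y)"
      using insert.IH by blast
    then have "P = (\<Sum>y\<leftarrow>y # ys. outer y y)" by (simp add: P'_def diff_eq_eq add.commute)
    then show ?thesis by blast
  qed
qed

lemma pos_semidef_sum_outer:
  fixes P :: "real ^ 'n ^ 'n"
  assumes "transpose P = P" "\<And>\<xi>. 0 \<le> \<xi> \<bullet> (P *v \<xi>)"
  obtains ys where "P = (\<Sum>y\<leftarrow>ys. outer y y)"
  using pos_semidef_sum_outer_supported[of UNIV P] assms by auto

lemma outer_mult: "outer y z ** u = outer y (transpose u *v z)"
  by (simp add: vec_eq_iff outer_def matrix_matrix_mult_def matrix_vector_mult_def transpose_def
      sum_distrib_left mult_ac)

lemma trace_outer_mult_outer: "trace (outer a b ** outer c d) = (a \<bullet> d) * (b \<bullet> c)"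
  by (simp add: trace_def outer_def matrix_matrix_mult_def inner_vec_def sum_product mult_ac)

lemma trace_sandwich_sum_outer:
  fixes u :: "real ^ 'n ^ 'n"
  assumes u: "transpose u = u"
  shows "trace (((\<Sum>y\<leftarrow>ys. outer y y) ** u) ** ((\<Sum>z\<leftarrow>zs. outer z z) ** u))
    = (\<Sum>y\<leftarrow>ys. \<Sum>z\<leftarrow>zs. (y \<bullet> (u *v z))\<^sup>2)"
proof -
  have pair: "trace ((outer y y ** u) ** (outer z z ** u)) = (y \<bullet> (u *v z))\<^sup>2" for y z
    by (simp only: outer_mult[of _ _ u] u trace_outer_mult_outer power2_eq_square inner_commute[of "u *v y"]
        inner_matrix_vector_sym[OF u, of z y])
  have tr0: "trace (0 :: real ^ 'n ^ 'n) = 0" by (simp add: trace_def)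
  have "trace ((outer y y ** u) ** ((\<Sum>z\<leftarrow>zs. outer z z) ** u)) = (\<Sum>z\<leftarrow>zs. (y \<bullet> (u *v z))\<^sup>2)" for y
    by (induction zs) (simp_all add: pair matrix_mult_add_left matrix_add_ldistrib trace_add tr0)
  then show ?thesis
    by (induction ys) (simp_all add: matrix_mult_add_left matrix_add_ldistrib trace_add tr0)
qed

lemma subspace_contains_range_sum_outer:
  assumes "subspace V" "set ys \<subseteq> V"
  shows "(\<Sum>y\<leftarrow>ys. outer y y) *v \<xi> \<in> V"
  using assms(2)
  by (induction ys) (auto simp: matrix_vector_mult_add_rdistrib outer_vector
      intro!: subspace_add[OF assms(1)] subspace_scale[OF assms(1)] subspace_0[OF assms(1)])

text \<open>This is what makes the Ebin metric nondegenerate. Writing the inverse of \<open>g\<close> as \<open>\<Sum> y y\<^sup>T\<close> turns the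
  trace into a sum of squares \<open>(y \<bullet> u z)\<^sup>2\<close>. If all of them vanish, then so does
  \<open>u\<close>, because the vectors \<open>y\<close> span the space, the inverse of \<open>g\<close> being surjective.\<close>

lemma trace_square_contract_eq_0:
  fixes g u :: "real ^ 'n ^ 'n"
  assumes g: "transpose g = g" "pos_def g" and u: "transpose u = u"
  shows "0 \<le> trace ((matrix_inv g ** u) ** (matrix_inv g ** u))"
    and "trace ((matrix_inv g ** u) ** (matrix_inv g ** u)) = 0 \<Longrightarrow> u = 0"
proof -
  define P where "P = matrix_inv g"
  have inv: "invertible g" using g(2) by (simp add: invertible_det_nz pos_def_det_nonzero)
  have gP: "g *v (P *v \<xi>) = \<xi>" and Pg: "P *v (g *v \<xi>) = \<xi>" for \<xi>
    by (simp_all add: matrix_vector_mul_assoc P_def matrix_inv_left[OF inv] matrix_inv_right[OF inv])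
  have "transpose P = matrix_inv g"
    unfolding P_def
    by (rule matrix_inv_unique[symmetric])
      (metis g(1) inv matrix_inv_left matrix_inv_right matrix_transpose_mul transpose_mat)+
  then have "transpose P = P" by (simp add: P_def)
  moreover have "0 \<le> \<xi> \<bullet> (P *v \<xi>)" for \<xi>
  proof -
    have "0 \<le> (P *v \<xi>) \<bullet> (g *v (P *v \<xi>))" using g(2) unfolding pos_def_def by (cases "P *v \<xi> = 0") (auto intro: less_imp_le)
    then show ?thesis by (simp add: gP inner_commute)
  qed
  ultimately obtain ys where ys: "P = (\<Sum>y\<leftarrow>ys. outer y y)" by (rule pos_semidef_sum_outer)
  have tr: "trace ((matrix_inv g ** u) ** (matrix_inv g ** u)) = (\<Sum>y\<leftarrow>ys. \<Sum>z\<leftarrow>ys. (y \<bullet> (u *v z))\<^sup>2)"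
    unfolding P_def[symmetric] unfolding ys by (rule trace_sandwich_sum_outer[OF u])
  show "0 \<le> trace ((matrix_inv g ** u) ** (matrix_inv g ** u))"
    unfolding tr by (intro sum_list_nonneg) (auto intro!: sum_list_nonneg)
  assume "trace ((matrix_inv g ** u) ** (matrix_inv g ** u)) = 0"
  then have outer_zero: "\<forall>x\<in>set (map (\<lambda>y. \<Sum>z\<leftarrow>ys. (y \<bullet> (u *v z))\<^sup>2) ys). x = 0"
    unfolding tr by (subst (asm) sum_list_nonneg_eq_0_iff) (auto intro!: sum_list_nonneg)
  have zero: "y \<bullet> (u *v z) = 0" if "y \<in> set ys" "z \<in> set ys" for y z
  proof -
    have "(\<Sum>z\<leftarrow>ys. (y \<bullet> (u *v z))\<^sup>2) = 0" using outer_zero that(1) by simp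
    then have "\<forall>x\<in>set (map (\<lambda>z. (y \<bullet> (u *v z))\<^sup>2) ys). x = 0"
      by (subst (asm) sum_list_nonneg_eq_0_iff) auto
    then show ?thesis using that(2) by simp
  qed
  have everything: "V = UNIV" if "subspace V" "set ys \<subseteq> V" for V
    using subspace_contains_range_sum_outer[OF that] unfolding ys[symmetric] by (metis Pg UNIV_eq_I)
  have "{\<xi>. \<forall>z\<in>set ys. \<xi> \<bullet> (u *v z) = 0} = UNIV"
    using zero by (intro everything) (auto simp: subspace_def inner_add_left)
  then have "{\<eta>. \<xi> \<bullet> (u *v \<eta>) = 0} = UNIV" for \<xi>
    by (intro everything) (auto simp: subspace_def inner_add_right matrix_vector_right_distrib matrix_vector_mult_scaleR)
  then have "u *v \<eta> = 0" for \<eta>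
    by (metis (mono_tags) UNIV_I inner_eq_zero_iff mem_Collect_eq)
  then show "u = 0" by (metis matrix_eq matrix_vector_mult_0)
qed

section \<open>Derivatives of determinants and inverses\<close>

text \<open>The algebra of functions generated by the linear functionals and one further function \<open>W\<close>. With
  \<open>W = 1 / sqrt (det g)\<close> it contains the square root of the determinant and the entries of the inverse matrix, and
  it is closed under differentiation because \<open>W' = - W\<^sup>3 (det g)' / 2\<close>.\<close>

inductive_set gen_algebra :: "('m::euclidean_space \<Rightarrow> real) \<Rightarrow> ('m \<Rightarrow> real) set" for W
  where
    const: "(\<lambda>x. c) \<in> gen_algebra W"
  | inner: "(\<lambda>x. x \<bullet> a) \<in> gen_algebra W"
  | gen: "W \<in> gen_algebra W"
  | add: "f \<in> gen_algebra W \<Longrightarrow> g \<in> gen_algebra W \<Longrightarrow> (\<lambda>x. f x + g x) \<in> gen_algebra W"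
  | mult: "f \<in> gen_algebra W \<Longrightarrow> g \<in> gen_algebra W \<Longrightarrow> (\<lambda>x. f x * g x) \<in> gen_algebra W"

lemma gen_algebra_linear:
  assumes "linear f"
  shows "f \<in> gen_algebra W"
proof -
  have "f x = x \<bullet> (\<Sum>b\<in>Basis. f b *\<^sub>R b)" for x
    by (subst euclidean_representation[of x, symmetric])
      (simp add: linear_sum[OF assms] linear_cmul[OF assms] inner_sum_right mult.commute del: euclidean_representation)
  then have "f = (\<lambda>x. x \<bullet> (\<Sum>b\<in>Basis. f b *\<^sub>R b))" by blast
  then show ?thesis using gen_algebra.inner by metis
qed

lemma gen_algebra_sum:
  "(\<And>i. i \<in> I \<Longrightarrow> f i \<in> gen_algebra W) \<Longrightarrow> (\<lambda>x. \<Sum>i\<in>I. f i x) \<in> gen_algebra W"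
  by (induction I rule: infinite_finite_induct) (auto intro: gen_algebra.intros)

lemma gen_algebra_prod:
  "(\<And>i. i \<in> I \<Longrightarrow> f i \<in> gen_algebra W) \<Longrightarrow> (\<lambda>x. \<Prod>i\<in>I. f i x) \<in> gen_algebra W"
  by (induction I rule: infinite_finite_induct) (auto intro: gen_algebra.intros)

lemma gen_algebra_det:
  assumes "\<And>i j. (\<lambda>x. M x $ i $ j) \<in> gen_algebra W"
  shows "(\<lambda>x. det (M x)) \<in> gen_algebra W"
  unfolding det_def
  by (intro gen_algebra_sum gen_algebra.mult gen_algebra_prod gen_algebra.const assms)

lemma gen_algebra_mono: "f \<in> gen_algebra (\<lambda>_. 0) \<Longrightarrow> f \<in> gen_algebra W"
  by (induction rule: gen_algebra.induct) (auto intro: gen_algebra.intros)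

text \<open>By the sum and product rules only the generator \<open>W\<close> has to be examined.\<close>

lemma gen_algebra_closed_under_derivatives:
  assumes W: "\<exists>d. (\<forall>w. d w \<in> gen_algebra W) \<and> (\<forall>x\<in>\<Omega>. (W has_derivative (\<lambda>w. d w x)) (at x))"
    and f: "f \<in> gen_algebra W"
  shows "\<exists>d. (\<forall>w. d w \<in> gen_algebra W) \<and> (\<forall>x\<in>\<Omega>. (f has_derivative (\<lambda>w. d w x)) (at x))"
  using f
proof (induction rule: gen_algebra.induct)
  case (const c)
  show ?case by (intro exI[of _ "\<lambda>w x. 0"]) (auto intro: gen_algebra.const)
next
  case (inner a)
  show ?case
    by (intro exI[of _ "\<lambda>w x. w \<bullet> a"]) (auto intro: gen_algebra.const intro!: derivative_eq_intros)
next
  case gen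
  show ?case by (rule W)
next
  case (add f g)
  from add.IH(1) obtain df where df: "(\<forall>w. df w \<in> gen_algebra W) \<and> (\<forall>x\<in>\<Omega>. (f has_derivative (\<lambda>w. df w x)) (at x))"
    by (rule exE)
  from add.IH(2) obtain dg where dg: "(\<forall>w. dg w \<in> gen_algebra W) \<and> (\<forall>x\<in>\<Omega>. (g has_derivative (\<lambda>w. dg w x)) (at x))"
    by (rule exE)
  show ?case
    by (intro exI[of _ "\<lambda>w x. df w x + dg w x"]) (simp add: df dg gen_algebra.add has_derivative_add)
next
  case (mult f g)
  from mult.IH(1) obtain df where df: "(\<forall>w. df w \<in> gen_algebra W) \<and> (\<forall>x\<in>\<Omega>. (f has_derivative (\<lambda>w. df w x)) (at x))"
    by (rule exE)
  from mult.IH(2) obtain dg where dg: "(\<forall>w. dg w \<in> gen_algebra W) \<and> (\<forall>x\<in>\<Omega>. (g has_derivative (\<lambda>w. dg w x)) (at x))"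
    by (rule exE)
  show ?case
    by (intro exI[of _ "\<lambda>w x. f x * dg w x + df w x * g x"])
      (use df dg in \<open>auto intro!: gen_algebra.add gen_algebra.mult mult.hyps has_derivative_mult\<close>)
qed

text \<open>The determinant itself lies in the algebra generated by the linear functionals alone (generator
  \<open>0\<close>), so its derivatives are polynomials; this breaks the apparent circularity between the derivatives of
  the determinant and those of \<open>W\<close>.\<close>

lemma frechet_smooth_gen_algebra_det:
  fixes B :: "'m::euclidean_space \<Rightarrow> real ^ 'n ^ 'n"
  assumes B: "linear B" and f: "f \<in> gen_algebra (\<lambda>x. inverse (sqrt (det (B x))))"
  shows "frechet_smooth euclidean {x. 0 < det (B x)} euclideanreal f"
proof -
  let ?W = "\<lambda>x. inverse (sqrt (det (B x)))"
  let ?\<Omega> = "{x. 0 < det (B x)}"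
  have "(\<lambda>x. B x $ i $ j) \<in> gen_algebra (\<lambda>_. 0)" for i j
    by (intro gen_algebra_linear linearI) (simp_all add: linear_add[OF B] linear_cmul[OF B])
  then have "(\<lambda>x. det (B x)) \<in> gen_algebra (\<lambda>_. 0)" by (rule gen_algebra_det)
  moreover have "\<exists>d. (\<forall>w. d w \<in> gen_algebra (\<lambda>_. 0)) \<and> (\<forall>x\<in>UNIV. ((\<lambda>_. 0::real) has_derivative (\<lambda>w. d w x)) (at (x::'m)))"
    by (intro exI[of _ "\<lambda>w x. 0"]) (auto intro: gen_algebra.const)
  ultimately have "\<exists>d. (\<forall>w. d w \<in> gen_algebra (\<lambda>_. 0)) \<and>
      (\<forall>x\<in>UNIV. ((\<lambda>x. det (B x)) has_derivative (\<lambda>w. d w x)) (at x))"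
    by (rule gen_algebra_closed_under_derivatives[rotated])
  then obtain d where "(\<forall>w. d w \<in> gen_algebra (\<lambda>_. 0)) \<and>
      (\<forall>x\<in>UNIV. ((\<lambda>x. det (B x)) has_derivative (\<lambda>w. d w x)) (at x))" by (rule exE)
  then have d: "d w \<in> gen_algebra (\<lambda>_. 0)" "((\<lambda>x. det (B x)) has_derivative (\<lambda>w. d w x)) (at x)" for w x
    by blast+
  have "(?W has_derivative (\<lambda>w. (- 1 / 2) * (?W x * (?W x * (?W x * d w x))))) (at x)" if "x \<in> ?\<Omega>" for x
    using that by (auto intro!: derivative_eq_intros d(2) simp: field_simps)
  moreover have "(\<lambda>x. (- 1 / 2) * (?W x * (?W x * (?W x * d w x)))) \<in> gen_algebra ?W" for w
    by (rule gen_algebra.mult[OF gen_algebra.const]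
        gen_algebra.mult[OF gen_algebra.gen] gen_algebra_mono[OF d(1)])+
  ultimately have "\<exists>d. (\<forall>w. d w \<in> gen_algebra ?W) \<and> (\<forall>x\<in>?\<Omega>. (?W has_derivative (\<lambda>w. d w x)) (at x))"
    by (intro exI[of _ "\<lambda>w x. (- 1 / 2) * (?W x * (?W x * (?W x * d w x)))"]) blast
  from frechet_smooth_if_closed_under_derivatives[OF gen_algebra_closed_under_derivatives[OF this] f]
  show ?thesis .
qed

text \<open>Cramer's rule applied to the columns of the identity matrix.\<close>

lemma matrix_inv_component:
  fixes A :: "real ^ 'n ^ 'n"
  assumes "det A \<noteq> 0"
  shows "matrix_inv A $ k $ l = det (\<chi> i j. if j = k then mat 1 $ i $ l else A $ i $ j) / det A"
proof -
  have inv: "invertible A" using assms by (simp add: invertible_det_nz)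
  have "(A *v column l (matrix_inv A)) $ i = mat 1 $ i $ l" for i
    by (subst matrix_inv_right[OF inv, symmetric])
      (simp add: matrix_vector_mult_def matrix_matrix_mult_def column_def)
  then have "det (\<chi> i j. if j = k then mat 1 $ i $ l else A $ i $ j) = column l (matrix_inv A) $ k * det A"
    using cramer_lemma[of k A "column l (matrix_inv A)"] by (simp only:)
  then show ?thesis using assms by (simp add: column_def)
qed

lemma frechet_smooth_vol_density:
  "frechet_smooth euclidean {M :: real ^ 'n ^ 'n. 0 < det M} euclideanreal (\<lambda>M. sqrt (det M))"
proof -
  let ?W = "\<lambda>M :: real ^ 'n ^ 'n. inverse (sqrt (det M))"
  have "(\<lambda>M. det M * ?W M) \<in> gen_algebra ?W"
    by (intro gen_algebra.mult gen_algebra_det gen_algebra_linear gen_algebra.gen linearI) auto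
  from frechet_smooth_gen_algebra_det[of "\<lambda>M. M", OF linear_id[unfolded id_def] this]
  show ?thesis
    by (rule iffD1[OF frechet_smooth_cong, rotated]) (auto simp: field_simps)
qed

text \<open>By Cramer's rule every entry of the inverse is a polynomial divided by \<open>det g\<close>, that is, a
  polynomial times \<open>W\<^sup>2\<close>.\<close>

lemma frechet_smooth_ebin_density:
  "frechet_smooth euclidean {x :: (real ^ 'n ^ 'n) \<times> (real ^ 'n ^ 'n) \<times> (real ^ 'n ^ 'n). 0 < det (fst x)} euclideanreal
    (\<lambda>(g, u, v). trace ((matrix_inv g ** u) ** (matrix_inv g ** v)) * sqrt (det g))"
proof -
  let ?W = "\<lambda>x :: (real ^ 'n ^ 'n) \<times> (real ^ 'n ^ 'n) \<times> (real ^ 'n ^ 'n). inverse (sqrt (det (fst x)))"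
  define c where "c k l x = det (\<chi> i j. if j = k then mat 1 $ i $ l else fst x $ i $ j) * (?W x * ?W x)"
    for k l :: 'n and x :: "(real ^ 'n ^ 'n) \<times> (real ^ 'n ^ 'n) \<times> (real ^ 'n ^ 'n)"
  have g: "(\<lambda>x. fst x $ i $ j) \<in> gen_algebra ?W" for i j
    by (intro gen_algebra_linear linearI) auto
  have uv: "(\<lambda>x. fst (snd x) $ i $ j) \<in> gen_algebra ?W" "(\<lambda>x. snd (snd x) $ i $ j) \<in> gen_algebra ?W" for i j
    by (intro gen_algebra_linear linearI; simp)+
  have c: "c k l \<in> gen_algebra ?W" for k l
  proof -
    have "(\<lambda>x. (\<chi> i j. if j = k then mat 1 $ i $ l else fst x $ i $ j) $ i $ j) \<in> gen_algebra ?W" for i j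
      using g by (cases "j = k") (auto intro: gen_algebra.const)
    then show ?thesis
      unfolding c_def by (intro gen_algebra.mult gen_algebra_det gen_algebra.gen)
  qed
  have c_eq: "matrix_inv (fst x) $ k $ l = c k l x" if "0 < det (fst x)" for k l x
    using that by (simp add: c_def matrix_inv_component field_simps)
  have "(\<lambda>x. (\<Sum>i\<in>UNIV. \<Sum>k\<in>UNIV. (\<Sum>l\<in>UNIV. c i l x * fst (snd x) $ l $ k) *
      (\<Sum>l\<in>UNIV. c k l x * snd (snd x) $ l $ i)) * (det (fst x) * ?W x)) \<in> gen_algebra ?W"
    by (intro gen_algebra.mult gen_algebra_sum gen_algebra_det gen_algebra.gen g uv c)
  from frechet_smooth_gen_algebra_det[of fst, OF linear_fst this]
  moreover have "det (fst x) * ?W x = sqrt (det (fst x))" if "0 < det (fst x)" for x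
    using that by (simp add: real_div_sqrt flip: divide_inverse)
  ultimately show ?thesis
    by (elim iffD1[OF frechet_smooth_cong, rotated])
      (simp add: trace_def matrix_matrix_mult_def c_eq[symmetric] case_prod_unfold del: mult_cancel_left mult_cancel_right)
qed

text \<open>In the Leibniz expansion a permutation other than the identity moves at least two indices, so
  its product vanishes at \<open>t = 0\<close> to second order; only the product of the diagonal entries contributes.\<close>

lemma det_one_plus_has_derivative:
  fixes A :: "real ^ 'n ^ 'n"
  shows "((\<lambda>t. det (mat 1 + t *\<^sub>R A)) has_real_derivative trace A) (at 0)"
proof -
  let ?U = "UNIV :: 'n set"
  have entry: "((\<lambda>t. (mat 1 + t *\<^sub>R A) $ i $ j) has_real_derivative A $ i $ j) (at 0)" for i j
    by (auto intro!: derivative_eq_intros)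
  have "((\<lambda>t. det (mat 1 + t *\<^sub>R A)) has_real_derivative
      (\<Sum>p | p permutes ?U. of_int (sign p) * (\<Sum>i\<in>?U. A $ i $ p i * (\<Prod>j\<in>?U - {i}. mat 1 $ j $ p j)))) (at 0)"
    unfolding det_def
    by (intro DERIV_sum DERIV_cmult)
      (use has_field_derivative_prod[OF entry] in \<open>auto\<close>)
  also have "(\<Sum>p | p permutes ?U. of_int (sign p) * (\<Sum>i\<in>?U. A $ i $ p i * (\<Prod>j\<in>?U - {i}. mat 1 $ j $ p j)))
    = (\<Sum>p\<in>{id}. of_int (sign p) * (\<Sum>i\<in>?U. A $ i $ p i * (\<Prod>j\<in>?U - {i}. mat 1 $ j $ p j)))"
  proof (rule sum.mono_neutral_right)
    show "\<forall>p\<in>{p. p permutes ?U} - {id}. of_int (sign p) * (\<Sum>i\<in>?U. A $ i $ p i * (\<Prod>j\<in>?U - {i}. mat 1 $ j $ p j)) = 0"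
    proof
      fix p assume "p \<in> {p. p permutes ?U} - {id}"
      then have p: "p permutes ?U" "p \<noteq> id" by auto
      have "(\<Prod>j\<in>?U - {i}. mat 1 $ j $ p j :: real) = 0" for i
      proof -
        obtain j where j: "j \<noteq> i" "p j \<noteq> j"
        proof -
          obtain k where k: "p k \<noteq> k" using p(2) by (auto simp: fun_eq_iff)
          have "p (p k) \<noteq> p k" using k permutes_inj[OF p(1)] by (auto dest: injD)
          with k show thesis by (cases "k = i") (auto intro: that)
        qed
        then have "mat 1 $ j $ p j = (0 :: real)" "j \<in> ?U - {i}" by (auto simp: mat_def)
        then show ?thesis by (intro prod_zero) auto
      qed
      then show "of_int (sign p) * (\<Sum>i\<in>?U. A $ i $ p i * (\<Prod>j\<in>?U - {i}. mat 1 $ j $ p j)) = 0"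
        by (simp only: mult_zero_right sum.neutral_const)
    qed
  qed (auto intro: permutes_id finite_permutations)
  also have "\<dots> = trace A" by (simp add: trace_def mat_def)
  finally show ?thesis .
qed

text \<open>Jacobi's formula for the volume density, by factoring out \<open>g\<close>.\<close>

lemma sqrt_det_has_derivative:
  fixes g v :: "real ^ 'n ^ 'n"
  assumes "0 < det g"
  shows "((\<lambda>t. sqrt (det (g + t *\<^sub>R v))) has_real_derivative
    1 / 2 * trace (matrix_inv g ** v) * sqrt (det g)) (at 0)"
proof -
  have inv: "invertible g" using assms by (simp add: invertible_det_nz)
  have "det (g + t *\<^sub>R v) = det g * det (mat 1 + t *\<^sub>R (matrix_inv g ** v))" for t
  proof -
    have "g ** (mat 1 + t *\<^sub>R (matrix_inv g ** v)) = g + t *\<^sub>R v"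
      by (simp add: matrix_add_ldistrib matrix_mult_scaleR_right matrix_mul_assoc matrix_inv_right[OF inv])
    then show ?thesis by (metis det_mul)
  qed
  moreover have "((\<lambda>t. sqrt (det g * det (mat 1 + t *\<^sub>R (matrix_inv g ** v)))) has_real_derivative
      1 / 2 * trace (matrix_inv g ** v) * sqrt (det g)) (at 0)"
    using assms
    by (auto intro!: derivative_eq_intros det_one_plus_has_derivative simp: field_simps)
  ultimately show ?thesis by simp
qed

section \<open>Iterated partial derivatives\<close>

text \<open>Functions that agree near \<open>x\<close> have the same candidate derivatives, so the choice made in the
  definition is the same, even at points where there is no derivative.\<close>

lemma frechet_derivative_cong_open:
  assumes "open S" "x \<in> S" "\<And>y. y \<in> S \<Longrightarrow> f y = g y"
  shows "frechet_derivative f (at x) = frechet_derivative g (at x)"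
proof -
  have "(f has_derivative D) (at x) \<longleftrightarrow> (g has_derivative D) (at x)" for D
    using has_derivative_transform_within_open[of f D x UNIV S g]
      has_derivative_transform_within_open[of g D x UNIV S f] assms by auto
  then show ?thesis by (simp add: frechet_derivative_def)
qed

lemma iter_partial_Nil [simp]: "iter_partial [] f = f"
  and iter_partial_Cons: "iter_partial (i # is) f = partial_deriv i (iter_partial is f)"
  by (simp_all add: iter_partial_def)

lemma smooth_on_differentiable: "smooth_on S f \<Longrightarrow> x \<in> S \<Longrightarrow> iter_partial is f differentiable (at x)"
  by (simp add: smooth_on_def)

lemma smooth_on_continuous_on: "smooth_on S f \<Longrightarrow> continuous_on S (iter_partial is f)"
  by (intro continuous_at_imp_continuous_on ballI differentiable_imp_continuous_within smooth_on_differentiable)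

lemma iter_partial_add_scaleR:
  assumes S: "open S" "x \<in> S" and f: "smooth_on S f" and g: "smooth_on S g"
  shows "iter_partial is (\<lambda>y. f y + t *\<^sub>R g y) x = iter_partial is f x + t *\<^sub>R iter_partial is g x"
  using S(2)
proof (induction "is" arbitrary: x)
  case (Cons i "is")
  let ?D = "\<lambda>h. frechet_derivative (iter_partial is h) (at x)"
  have "((\<lambda>y. iter_partial is f y + t *\<^sub>R iter_partial is g y) has_derivative (\<lambda>w. ?D f w + t *\<^sub>R ?D g w)) (at x)"
    using smooth_on_differentiable[OF f Cons.prems, of "is"] smooth_on_differentiable[OF g Cons.prems, of "is"]
    by (intro has_derivative_add has_derivative_scaleR_right) (simp_all flip: frechet_derivative_works)
  then have "frechet_derivative (\<lambda>y. iter_partial is f y + t *\<^sub>R iter_partial is g y) (at x) = (\<lambda>w. ?D f w + t *\<^sub>R ?D g w)"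
    by (rule frechet_derivative_at[symmetric])
  moreover have "?D (\<lambda>y. f y + t *\<^sub>R g y) = frechet_derivative (\<lambda>y. iter_partial is f y + t *\<^sub>R iter_partial is g y) (at x)"
    by (rule frechet_derivative_cong_open[OF S(1) Cons.prems Cons.IH])
  ultimately show ?case by (simp add: iter_partial_Cons partial_deriv_def)
qed simp

lemma smooth_on_add_scaleR:
  assumes S: "open S" and f: "smooth_on S f" and g: "smooth_on S g"
  shows "smooth_on S (\<lambda>y. f y + t *\<^sub>R g y)"
  unfolding smooth_on_def
proof (intro allI ballI)
  fix "is" x assume x: "x \<in> S"
  have "(\<lambda>y. iter_partial is f y + t *\<^sub>R iter_partial is g y) differentiable (at x)"
    using smooth_on_differentiable[OF f x, of "is"] smooth_on_differentiable[OF g x, of "is"] by simp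
  then show "iter_partial is (\<lambda>y. f y + t *\<^sub>R g y) differentiable (at x)"
    unfolding differentiable_def
    by (elim exE, intro exI) (erule has_derivative_transform_within_open[OF _ S x],
        rule iter_partial_add_scaleR[OF S _ f g, symmetric])
qed

lemma smooth_on_0: "smooth_on S (\<lambda>_ :: real ^ 'n::finite. 0 :: 'b::real_normed_vector)"
proof -
  have "iter_partial is (\<lambda>_. 0 :: 'b) = (\<lambda>_. 0)" for "is" :: "'n list"
  proof (induction "is")
    case (Cons i "is")
    then show ?case by (simp add: iter_partial_Cons partial_deriv_def)
  qed simp
  then show ?thesis by (simp add: smooth_on_def)
qed

section \<open>Charts and tangent spaces\<close>

lemma components_add_scaleR:
  "components A (h + t *\<^sub>R k) c p = components A h c p + t *\<^sub>R components A k c p"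
  by (simp add: components_def vec_eq_iff plus_fun_def scaleR_fun_def)

locale compact_oriented_mfd =
  fixes X :: "'a topology" and A :: "('a, 'n::finite) chart set"
  assumes mfd: "compact_oriented_manifold X A"
begin

abbreviation dom where "dom c \<equiv> snd c ` fst c"

lemma atlas: "smooth_atlas X A"
  and X_nonempty: "topspace X \<noteq> {}" and X_Hausdorff: "Hausdorff_space X" and X_compact: "compact_space X"
  using mfd by (simp_all add: compact_oriented_manifold_def oriented_atlas_def)

lemma covered: "p \<in> topspace X \<Longrightarrow> \<exists>c\<in>A. p \<in> fst c"
  using atlas by (auto simp: smooth_atlas_def)

lemma
  assumes "c \<in> A"
  shows openin_chart: "openin X (fst c)" and open_dom: "open (dom c)"
    and homeo_chart: "homeomorphic_map (subtopology X (fst c)) (top_of_set (dom c)) (snd c)"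
  using atlas assms by (auto simp: smooth_atlas_def is_chart_def)

lemma chart_subset: "c \<in> A \<Longrightarrow> fst c \<subseteq> topspace X"
  using openin_chart openin_subset by blast

lemma chart_in_X: "c \<in> A \<Longrightarrow> p \<in> fst c \<Longrightarrow> p \<in> topspace X"
  using chart_subset by blast

lemma topspace_chart: "c \<in> A \<Longrightarrow> topspace (subtopology X (fst c)) = fst c"
  using chart_subset by (simp add: Int_absorb1)

lemma inj_chart: "c \<in> A \<Longrightarrow> inj_on (snd c) (fst c)"
  using homeomorphic_imp_injective_map[OF homeo_chart] by (simp only: topspace_chart)

lemma chart_inv_chart: "c \<in> A \<Longrightarrow> p \<in> fst c \<Longrightarrow> chart_inv c (snd c p) = p"
  using inj_chart by (simp add: chart_inv_def inv_into_f_f)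

lemma chart_chart_inv: "x \<in> dom c \<Longrightarrow> snd c (chart_inv c x) = x"
  and chart_inv_in: "x \<in> dom c \<Longrightarrow> chart_inv c x \<in> fst c"
  by (simp_all add: chart_inv_def f_inv_into_f inv_into_into)

lemma chart_continuous: "c \<in> A \<Longrightarrow> continuous_map (subtopology X (fst c)) euclidean (snd c)"
  using homeomorphic_imp_continuous_map[OF homeo_chart] by (simp add: continuous_map_in_subtopology)

lemma chart_inv_continuous:
  assumes c: "c \<in> A"
  shows "continuous_map (top_of_set (dom c)) X (chart_inv c)"
proof -
  obtain g where g: "homeomorphic_maps (subtopology X (fst c)) (top_of_set (dom c)) (snd c) g"
    using homeo_chart[OF c] unfolding homeomorphic_map_maps by blast
  then have "continuous_map (top_of_set (dom c)) (subtopology X (fst c)) g"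
    by (simp add: homeomorphic_maps_def)
  moreover have "g x = chart_inv c x" if "x \<in> dom c" for x
    using g c that unfolding homeomorphic_maps_def topspace_chart[OF c] by (auto simp: chart_inv_chart)
  ultimately have "continuous_map (top_of_set (dom c)) (subtopology X (fst c)) (chart_inv c)"
    by (rule continuous_map_eq) simp
  then show ?thesis by (rule continuous_map_into_fulltopology)
qed

lemma compact_chart_image:
  assumes "c \<in> A" "compactin X K" "K \<subseteq> fst c"
  shows "compact (snd c ` K)"
  using image_compactin[OF _ chart_continuous[OF assms(1)], of K] assms
  by (simp add: compactin_subtopology)

lemma compactin_chart_inv_image:
  assumes "c \<in> A" "compact K" "K \<subseteq> dom c"
  shows "compactin X (chart_inv c ` K)"
  using image_compactin[OF _ chart_inv_continuous[OF assms(1)], of K] assms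
  by (simp add: compactin_subtopology)

lemma open_chart_preimage:
  assumes "c \<in> A" "openin X V"
  shows "open {x \<in> dom c. chart_inv c x \<in> V}"
  using openin_continuous_map_preimage[OF chart_inv_continuous[OF assms(1)] assms(2)] open_dom[OF assms(1)]
  by (simp add: openin_open_eq)

lemma transition_has_derivative:
  assumes "c \<in> A" "d \<in> A" "p \<in> fst c" "p \<in> fst d"
  shows "(transition c d has_derivative transition_deriv c d p) (at (snd c p))"
proof -
  have "smooth_on (snd c ` (fst c \<inter> fst d)) (transition c d)"
    using atlas assms by (auto simp: smooth_atlas_def)
  from smooth_on_differentiable[OF this, of "snd c p" "[]"] assms
  show ?thesis by (simp add: transition_deriv_def flip: frechet_derivative_works)
qed

lemma transition_deriv_linear:
  "c \<in> A \<Longrightarrow> d \<in> A \<Longrightarrow> p \<in> fst c \<Longrightarrow> p \<in> fst d \<Longrightarrow> linear (transition_deriv c d p)"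
  by (rule has_derivative_linear[OF transition_has_derivative])

text \<open>The cocycle condition, which is the chain rule. It makes a vector in one chart extend consistently to
  all charts, so that every chart identifies the tangent space with Euclidean space.\<close>

lemma transition_deriv_compose:
  assumes c: "c \<in> A" "p \<in> fst c" and d: "d \<in> A" "p \<in> fst d" and e: "e \<in> A" "p \<in> fst e"
  shows "transition_deriv d e p (transition_deriv c d p \<xi>) = transition_deriv c e p \<xi>"
proof -
  have at_p: "transition c d (snd c p) = snd d p"
    using c by (simp add: transition_def chart_inv_chart)
  have "((\<lambda>x. transition d e (transition c d x)) has_derivative (\<lambda>\<xi>. transition_deriv d e p (transition_deriv c d p \<xi>))) (at (snd c p))"
    by (rule has_derivative_compose[OF transition_has_derivative[OF c(1) d(1) c(2) d(2)]])
      (simp add: at_p transition_has_derivative d e)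
  then have "(transition c e has_derivative (\<lambda>\<xi>. transition_deriv d e p (transition_deriv c d p \<xi>))) (at (snd c p))"
    by (rule has_derivative_transform_within_open[OF _ open_chart_preimage[OF c(1) openin_chart[OF d(1)]]])
      (use c d in \<open>auto simp: transition_def chart_inv_chart\<close>)
  from has_derivative_unique[OF this transition_has_derivative[OF c(1) e(1) c(2) e(2)]]
  show ?thesis by (metis)
qed

lemma transition_deriv_self:
  assumes c: "c \<in> A" "p \<in> fst c"
  shows "transition_deriv c c p \<xi> = \<xi>"
proof -
  have "(transition c c has_derivative (\<lambda>\<xi>. \<xi>)) (at (snd c p))"
    by (rule has_derivative_transform_within_open[OF has_derivative_ident open_dom[OF c(1)]])
      (use c in \<open>auto simp: transition_def chart_inv_chart\<close>)
  from has_derivative_unique[OF this transition_has_derivative[OF c(1) c(1) c(2) c(2)]]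
  show ?thesis by metis
qed

text \<open>The inverse of the coordinate map \<open>v \<mapsto> v c\<close> on the tangent space at \<open>p\<close>.\<close>

definition tangent_of :: "('a, 'n) chart \<Rightarrow> 'a \<Rightarrow> real ^ 'n \<Rightarrow> ('a, 'n) tangent"
  where "tangent_of c p \<xi> = (\<lambda>d. if d \<in> A \<and> p \<in> fst d then transition_deriv c d p \<xi> else 0)"

lemma coord_vec_eq: "coord_vec A c i p = tangent_of c p (axis i 1)"
  by (simp add: coord_vec_def tangent_of_def)

lemma tangent_of_in:
  assumes "c \<in> A" "p \<in> fst c"
  shows "tangent_of c p \<xi> \<in> tangent_space A p"
  unfolding tangent_space_def mem_Collect_eq
proof (intro conjI allI ballI impI)
  fix d e assume "d \<in> A" "e \<in> A" "p \<in> fst d \<inter> fst e"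
  then show "tangent_of c p \<xi> e = transition_deriv d e p (tangent_of c p \<xi> d)"
    using transition_deriv_compose[OF assms, of d e] by (simp add: tangent_of_def)
next
  fix d assume "\<not> (d \<in> A \<and> p \<in> fst d)"
  then show "tangent_of c p \<xi> d = 0" unfolding tangent_of_def by (rule if_not_P)
qed

lemma tangent_of_self: "c \<in> A \<Longrightarrow> p \<in> fst c \<Longrightarrow> tangent_of c p \<xi> c = \<xi>"
  by (simp add: tangent_of_def transition_deriv_self)

lemma tangent_eq_tangent_of:
  assumes "c \<in> A" "p \<in> fst c" "v \<in> tangent_space A p"
  shows "v = tangent_of c p (v c)"
proof
  fix d
  have "(\<forall>c\<in>A. \<forall>d\<in>A. p \<in> fst c \<inter> fst d \<longrightarrow> v d = transition_deriv c d p (v c)) \<and>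
      (\<forall>c. \<not> (c \<in> A \<and> p \<in> fst c) \<longrightarrow> v c = 0)"
    using assms(3) by (simp only: tangent_space_def mem_Collect_eq)
  then show "v d = tangent_of c p (v c) d"
    using assms(1,2) unfolding tangent_of_def by (metis IntI)
qed

lemma tangent_of_linear: "c \<in> A \<Longrightarrow> p \<in> fst c \<Longrightarrow> linear (tangent_of c p)"
  by (rule linearI) (auto simp: tangent_of_def fun_eq_iff plus_fun_def scaleR_fun_def
      linear_add[OF transition_deriv_linear] linear_cmul[OF transition_deriv_linear])

lemma sym_tensorsD:
  assumes "h \<in> sym_tensors X A"
  shows "p \<in> topspace X \<Longrightarrow> u \<in> tangent_space A p \<Longrightarrow> v \<in> tangent_space A p \<Longrightarrow> h p u v = h p v u"
    and "p \<in> topspace X \<Longrightarrow> u \<in> tangent_space A p \<Longrightarrow> v \<in> tangent_space A p \<Longrightarrow> w \<in> tangent_space A p \<Longrightarrow>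
      h p (a *\<^sub>R u + b *\<^sub>R v) w = a * h p u w + b * h p v w"
    and "\<not> (p \<in> topspace X \<and> u \<in> tangent_space A p \<and> v \<in> tangent_space A p) \<Longrightarrow> h p u v = 0"
    and "c \<in> A \<Longrightarrow> smooth_on (dom c) (\<lambda>x. components A h c (chart_inv c x))"
  using assms unfolding sym_tensors_def mem_Collect_eq by blast+

lemma transpose_components:
  assumes "h \<in> sym_tensors X A" "c \<in> A" "p \<in> fst c"
  shows "transpose (components A h c p) = components A h c p"
proof -
  have "h p (tangent_of c p (axis j 1)) (tangent_of c p (axis i 1)) = h p (tangent_of c p (axis i 1)) (tangent_of c p (axis j 1))" for i j
    using assms by (intro sym_tensorsD(1) chart_in_X tangent_of_in)
  then show ?thesis
    by (simp add: transpose_def components_def vec_eq_iff coord_vec_eq)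
qed

text \<open>Since tensors are handled below only through their component matrices, this is the bridge back
  to the invariant definitions.\<close>

lemma tensor_eq_components:
  assumes h: "h \<in> sym_tensors X A" and c: "c \<in> A" "p \<in> fst c"
    and u: "u \<in> tangent_space A p" and v: "v \<in> tangent_space A p"
  shows "h p u v = u c \<bullet> (components A h c p *v v c)"
proof -
  let ?t = "tangent_of c p"
  have p: "p \<in> topspace X" using chart_subset c by blast
  note lin = tangent_of_linear[OF c]
  have linear_first: "linear (\<lambda>\<xi>. h p (?t \<xi>) (?t \<eta>))" for \<eta>
  proof (rule linearI)
    show "h p (?t (x + y)) (?t \<eta>) = h p (?t x) (?t \<eta>) + h p (?t y) (?t \<eta>)" for x y
      using sym_tensorsD(2)[OF h p tangent_of_in[OF c, of x] tangent_of_in[OF c, of y] tangent_of_in[OF c, of \<eta>], of 1 1]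
      by (simp add: linear_add[OF lin])
    show "h p (?t (r *\<^sub>R x)) (?t \<eta>) = r *\<^sub>R h p (?t x) (?t \<eta>)" for r x
      using sym_tensorsD(2)[OF h p tangent_of_in[OF c, of x] tangent_of_in[OF c, of x] tangent_of_in[OF c, of \<eta>], of r 0]
      by (simp add: linear_cmul[OF lin])
  qed
  have expand: "h p (?t \<xi>) (?t \<eta>) = (\<Sum>i\<in>UNIV. \<xi> $ i * h p (?t (axis i 1)) (?t \<eta>))" for \<xi> \<eta>
  proof -
    have "\<xi> = (\<Sum>i\<in>UNIV. \<xi> $ i *\<^sub>R axis i 1)"
      using basis_expansion[of \<xi>] by (simp add: scalar_mult_eq_scaleR)
    then have "h p (?t \<xi>) (?t \<eta>) = h p (?t (\<Sum>i\<in>UNIV. \<xi> $ i *\<^sub>R axis i 1)) (?t \<eta>)" by simp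
    also have "\<dots> = (\<Sum>i\<in>UNIV. \<xi> $ i * h p (?t (axis i 1)) (?t \<eta>))"
      by (simp only: linear_sum[OF linear_first] linear_cmul[OF linear_first] real_scaleR_def)
    finally show ?thesis .
  qed
  have symm: "h p (?t \<xi>) (?t \<eta>) = h p (?t \<eta>) (?t \<xi>)" for \<xi> \<eta>
    by (intro sym_tensorsD(1)[OF h p] tangent_of_in[OF c])
  have "h p (?t \<xi>) (?t \<eta>) = \<xi> \<bullet> (components A h c p *v \<eta>)" for \<xi> \<eta>
  proof -
    have "h p (?t (axis i 1)) (?t \<eta>) = (components A h c p *v \<eta>) $ i" for i
      by (subst symm, subst expand, subst symm)
        (simp add: components_def matrix_vector_mult_def coord_vec_eq mult.commute)
    then show ?thesis by (subst expand) (simp add: inner_vec_def)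
  qed
  then show ?thesis
    using tangent_eq_tangent_of[OF c u] tangent_eq_tangent_of[OF c v] by metis
qed

lemma sym_tensor_eqI:
  assumes "h \<in> sym_tensors X A" "k \<in> sym_tensors X A"
    and "\<And>p. p \<in> topspace X \<Longrightarrow> \<exists>c\<in>A. p \<in> fst c \<and> components A h c p = components A k c p"
  shows "h = k"
proof (intro ext)
  fix p u v show "h p u v = k p u v"
  proof (cases "p \<in> topspace X \<and> u \<in> tangent_space A p \<and> v \<in> tangent_space A p")
    case True
    with assms(3) obtain c where "c \<in> A" "p \<in> fst c" "components A h c p = components A k c p" by blast
    then show ?thesis using True assms(1,2) by (simp add: tensor_eq_components)
  next
    case False
    then show ?thesis using assms(1,2) by (simp add: sym_tensorsD(3))
  qed
qed

lemma tangent_nonzero_iff: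
  assumes c: "c \<in> A" "p \<in> fst c" and v: "v \<in> tangent_space A p"
  shows "v \<noteq> 0 \<longleftrightarrow> v c \<noteq> 0"
  using tangent_eq_tangent_of[OF c v] linear_0[OF tangent_of_linear[OF c]] by (metis zero_fun_apply)

lemma metrics_pos_def:
  assumes g: "g \<in> metrics X A" and c: "c \<in> A" "p \<in> fst c"
  shows "pos_def (components A g c p)"
  unfolding pos_def_def
proof (intro allI impI)
  fix \<xi> :: "real ^ 'n" assume "\<xi> \<noteq> 0"
  let ?v = "tangent_of c p \<xi>"
  have v: "?v \<in> tangent_space A p" by (rule tangent_of_in[OF c])
  have "?v \<noteq> 0" using \<open>\<xi> \<noteq> 0\<close> by (simp add: tangent_nonzero_iff[OF c v] tangent_of_self[OF c])
  then have "0 < g p ?v ?v" using g v chart_in_X[OF c] by (simp add: metrics_def)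
  then show "0 < \<xi> \<bullet> (components A g c p *v \<xi>)"
    using g by (simp add: tensor_eq_components[OF _ c v v] tangent_of_self[OF c] metrics_def)
qed

text \<open>Positivity may be tested in a single chart around each point, since a chart sees all
  tangent vectors.\<close>

lemma metricsI:
  assumes g: "g \<in> sym_tensors X A"
    and pos: "\<And>p. p \<in> topspace X \<Longrightarrow> \<exists>c\<in>A. p \<in> fst c \<and> pos_def (components A g c p)"
  shows "g \<in> metrics X A"
  unfolding metrics_def
proof (intro CollectI conjI g ballI impI)
  fix p v assume p: "p \<in> topspace X" and v: "v \<in> tangent_space A p" "v \<noteq> 0"
  from pos[OF p] obtain c where c: "c \<in> A" "p \<in> fst c" "pos_def (components A g c p)" by blast
  then show "0 < g p v v"
    using v by (simp add: tensor_eq_components[OF g c(1,2) v(1) v(1)] pos_def_def tangent_nonzero_iff[OF c(1,2) v(1)])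
qed

lemma sym_tensors_add_scaleR:
  assumes h: "h \<in> sym_tensors X A" and k: "k \<in> sym_tensors X A"
  shows "h + t *\<^sub>R k \<in> sym_tensors X A"
  unfolding sym_tensors_def mem_Collect_eq
proof (intro conjI allI ballI impI)
  fix c assume c: "c \<in> A"
  show "smooth_on (dom c) (\<lambda>x. components A (h + t *\<^sub>R k) c (chart_inv c x))"
    unfolding components_add_scaleR
    by (intro smooth_on_add_scaleR open_dom sym_tensorsD(4) c h k)
next
  fix p u v w and a b :: real
  assume "p \<in> topspace X" "u \<in> tangent_space A p" "v \<in> tangent_space A p" "w \<in> tangent_space A p"
  then show "(h + t *\<^sub>R k) p (a *\<^sub>R u + b *\<^sub>R v) w = a * (h + t *\<^sub>R k) p u w + b * (h + t *\<^sub>R k) p v w"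
    by (simp add: plus_fun_def scaleR_fun_def sym_tensorsD(2)[OF h, unfolded plus_fun_def scaleR_fun_def]
        sym_tensorsD(2)[OF k, unfolded plus_fun_def scaleR_fun_def] algebra_simps)
next
  fix p u v
  assume "p \<in> topspace X" "u \<in> tangent_space A p" "v \<in> tangent_space A p"
  then show "(h + t *\<^sub>R k) p u v = (h + t *\<^sub>R k) p v u"
    by (simp add: plus_fun_def scaleR_fun_def sym_tensorsD(1)[OF h, of p u v] sym_tensorsD(1)[OF k, of p u v])
qed (simp add: plus_fun_def scaleR_fun_def sym_tensorsD(3)[OF h] sym_tensorsD(3)[OF k])

lemma sym_tensors_0: "0 \<in> sym_tensors X A"
proof -
  have "components A 0 c p = 0" for c p by (simp add: components_def vec_eq_iff)
  then show ?thesis unfolding sym_tensors_def by (simp add: smooth_on_0)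
qed

lemma sym_tensors_add: "h \<in> sym_tensors X A \<Longrightarrow> k \<in> sym_tensors X A \<Longrightarrow> h + k \<in> sym_tensors X A"
  and sym_tensors_diff: "h \<in> sym_tensors X A \<Longrightarrow> k \<in> sym_tensors X A \<Longrightarrow> h - k \<in> sym_tensors X A"
  and sym_tensors_scaleR: "h \<in> sym_tensors X A \<Longrightarrow> t *\<^sub>R h \<in> sym_tensors X A"
  using sym_tensors_add_scaleR[of h k 1] sym_tensors_add_scaleR[of h k "- 1"]
    sym_tensors_add_scaleR[OF sym_tensors_0, of h t] by simp_all

lemma metrics_scaleR:
  assumes "g \<in> metrics X A" "0 < l"
  shows "l *\<^sub>R g \<in> metrics X A"
  using assms unfolding metrics_def by (simp add: sym_tensors_scaleR) (simp add: scaleR_fun_def)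

section \<open>The space of symmetric tensor fields as a topological vector space\<close>

abbreviation T where "T \<equiv> smooth_topology X A"

definition local_rep :: "('a, 'n) tensor2 \<Rightarrow> ('a, 'n) chart \<Rightarrow> real ^ 'n \<Rightarrow> real ^ 'n ^ 'n"
  where "local_rep h c x = components A h c (chart_inv c x)"

text \<open>The open ball of radius \<open>e\<close> around \<open>0\<close> for the seminorm given by \<open>c\<close>, \<open>K\<close> and \<open>is\<close>. Working with balls
  rather than with the supremum itself avoids a special case for empty \<open>K\<close>.\<close>

definition small :: "('a, 'n) chart \<Rightarrow> 'a set \<Rightarrow> 'n list \<Rightarrow> real \<Rightarrow> ('a, 'n) tensor2 \<Rightarrow> bool"
  where "small c K is e h \<longleftrightarrow> (\<forall>p\<in>K. norm (iter_partial is (local_rep h c) (snd c p)) < e)"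

definition admissible :: "('a, 'n) chart \<Rightarrow> 'a set \<Rightarrow> bool"
  where "admissible c K \<longleftrightarrow> c \<in> A \<and> compactin X K \<and> K \<subseteq> fst c"

lemma smooth_topology_alt:
  "T = topology_generated_by {{h \<in> sym_tensors X A. small c K is e (h - g)} | g c K is e.
    g \<in> sym_tensors X A \<and> admissible c K \<and> 0 < e}"
  unfolding smooth_topology_def small_def local_rep_def[abs_def] admissible_def by (simp add: conj_assoc)

lemma local_rep_add_scaleR: "local_rep (h + t *\<^sub>R k) c x = local_rep h c x + t *\<^sub>R local_rep k c x"
  by (simp add: local_rep_def components_add_scaleR)

lemma local_rep_chart: "c \<in> A \<Longrightarrow> p \<in> fst c \<Longrightarrow> local_rep h c (snd c p) = components A h c p"
  by (simp add: local_rep_def chart_inv_chart)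

lemma smooth_local_rep: "h \<in> sym_tensors X A \<Longrightarrow> c \<in> A \<Longrightarrow> smooth_on (dom c) (local_rep h c)"
  using sym_tensorsD(4) unfolding local_rep_def[abs_def] by blast

lemma continuous_local_rep: "h \<in> sym_tensors X A \<Longrightarrow> c \<in> A \<Longrightarrow> continuous_on (dom c) (local_rep h c)"
  using smooth_on_continuous_on[OF smooth_local_rep, of h c "[]"] by simp

lemma iter_partial_local_rep:
  assumes "h \<in> sym_tensors X A" "k \<in> sym_tensors X A" "c \<in> A" "x \<in> dom c"
  shows "iter_partial is (local_rep (h + t *\<^sub>R k) c) x
    = iter_partial is (local_rep h c) x + t *\<^sub>R iter_partial is (local_rep k c) x"
  unfolding local_rep_add_scaleR[abs_def]
  by (rule iter_partial_add_scaleR[OF open_dom[OF assms(3)] assms(4)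
      smooth_local_rep[OF assms(1,3)] smooth_local_rep[OF assms(2,3)]])

lemma small_add_scaleR:
  assumes K: "admissible c K" and h: "h \<in> sym_tensors X A" "small c K is d h"
    and k: "k \<in> sym_tensors X A" "small c K is e k" and le: "d + \<bar>t\<bar> * e \<le> e'"
  shows "small c K is e' (h + t *\<^sub>R k)"
  unfolding small_def
proof
  fix p assume p: "p \<in> K"
  have "norm (iter_partial is (local_rep (h + t *\<^sub>R k) c) (snd c p))
      \<le> norm (iter_partial is (local_rep h c) (snd c p)) + \<bar>t\<bar> * norm (iter_partial is (local_rep k c) (snd c p))"
    using norm_triangle_ineq p K h(1) k(1)
    by (subst iter_partial_local_rep) (auto simp: admissible_def intro: order_trans[OF norm_triangle_ineq])
  also have "\<dots> < d + \<bar>t\<bar> * e"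
    using h(2) k(2) p unfolding small_def by (intro add_less_le_mono mult_left_mono) (auto intro: less_imp_le)
  finally show "norm (iter_partial is (local_rep (h + t *\<^sub>R k) c) (snd c p)) < e'" using le by simp
qed

lemma iter_partial_local_rep_scaleR:
  assumes "k \<in> sym_tensors X A" "c \<in> A" "x \<in> dom c"
  shows "iter_partial is (local_rep (t *\<^sub>R k) c) x = t *\<^sub>R iter_partial is (local_rep k c) x"
  using iter_partial_local_rep[OF assms(1) assms, of "is" "t - 1"] by (simp add: algebra_simps)

lemma small_scaleR:
  assumes K: "admissible c K" and k: "k \<in> sym_tensors X A" "small c K is e k" and less: "\<bar>t\<bar> * e < e'"
  shows "small c K is e' (t *\<^sub>R k)"
  unfolding small_def
proof
  fix p assume p: "p \<in> K"
  have "norm (iter_partial is (local_rep (t *\<^sub>R k) c) (snd c p)) = \<bar>t\<bar> * norm (iter_partial is (local_rep k c) (snd c p))"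
    using p K k(1) by (subst iter_partial_local_rep_scaleR) (auto simp: admissible_def)
  also have "\<dots> \<le> \<bar>t\<bar> * e"
    using k(2) p unfolding small_def by (intro mult_left_mono) (auto intro: less_imp_le)
  finally show "norm (iter_partial is (local_rep (t *\<^sub>R k) c) (snd c p)) < e'" using less by simp
qed

lemma small_0: "admissible c K \<Longrightarrow> 0 < e \<Longrightarrow> small c K is e 0"
  unfolding small_def using iter_partial_local_rep_scaleR[OF sym_tensors_0, of c _ "is" 0]
  by (auto simp: admissible_def subset_iff)

text \<open>The seminorm is attained on the compact set, so a strict bound leaves room: a ball is a
  neighbourhood of each of its points.\<close>

lemma seminorm_attained:
  assumes K: "admissible c K" and h: "h \<in> sym_tensors X A"
  obtains m where "0 \<le> m" "\<And>e. m < e \<Longrightarrow> small c K is e h" "\<And>e. 0 < e \<Longrightarrow> small c K is e h \<Longrightarrow> m < e"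
proof (cases "K = {}")
  case True
  then show thesis by (intro that[of 0]) (auto simp: small_def)
next
  case False
  have "continuous_on (snd c ` K) (\<lambda>x. norm (iter_partial is (local_rep h c) x))"
    using K continuous_on_subset[OF smooth_on_continuous_on[OF smooth_local_rep[OF h]], of c "snd c ` K"]
    by (intro continuous_on_norm) (simp add: admissible_def image_mono)
  moreover have "compact (snd c ` K)" using K compact_chart_image by (simp add: admissible_def)
  ultimately obtain x where x: "x \<in> snd c ` K"
      "\<forall>y\<in>snd c ` K. norm (iter_partial is (local_rep h c) y) \<le> norm (iter_partial is (local_rep h c) x)"
    using continuous_attains_sup[of "snd c ` K"] False by blast
  show thesis
    by (rule that[of "norm (iter_partial is (local_rep h c) x)"]) (use x in \<open>auto simp: small_def intro: le_less_trans\<close>)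
qed

lemma openin_small:
  assumes "admissible c K" "g \<in> sym_tensors X A" "0 < e"
  shows "openin T {h \<in> sym_tensors X A. small c K is e (h - g)}"
  unfolding smooth_topology_alt using assms by (intro topology_generated_by_Basis) blast

lemma topspace_smooth [simp]: "topspace T = sym_tensors X A"
proof -
  obtain c where "c \<in> A" using covered X_nonempty by blast
  then have c: "admissible c {}" by (simp add: admissible_def)
  have "sym_tensors X A \<subseteq> topspace T"
    using openin_subset[OF openin_small[OF c sym_tensors_0 zero_less_one, of "[]"]] by (simp add: small_def)
  moreover have "topspace T \<subseteq> sym_tensors X A"
    unfolding smooth_topology_alt topology_generated_by_topspace by blast
  ultimately show ?thesis by blast
qed

text \<open>Convergence in the topology generated by balls around arbitrary centres is convergence in every
  seminorm. All continuity statements about this topology are derived from this description.\<close>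

lemma limitin_smooth_iff:
  "limitin T f l F \<longleftrightarrow> l \<in> sym_tensors X A \<and> (\<forall>\<^sub>F z in F. f z \<in> sym_tensors X A) \<and>
    (\<forall>c K is e. admissible c K \<longrightarrow> 0 < e \<longrightarrow> (\<forall>\<^sub>F z in F. small c K is e (f z - l)))"
    (is "_ \<longleftrightarrow> ?R")
proof
  assume lim: "limitin T f l F"
  then have l: "l \<in> sym_tensors X A" by (simp add: limitin_def flip: topspace_smooth)
  moreover have "\<forall>\<^sub>F z in F. f z \<in> sym_tensors X A"
    using limitinD[OF lim openin_topspace] l by simp
  moreover have "\<forall>\<^sub>F z in F. small c K is e (f z - l)" if "admissible c K" "0 < e" for c K "is" e
  proof -
    have "small c K is e (l - l)" using small_0 that by simp
    with limitinD[OF lim openin_small[OF that(1) l that(2)], of "is"] l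
    have "\<forall>\<^sub>F z in F. f z \<in> sym_tensors X A \<and> small c K is e (f z - l)" by simp
    then show ?thesis by (rule eventually_mono) simp
  qed
  ultimately show ?R by blast
next
  assume R: ?R
  have "\<forall>\<^sub>F z in F. f z \<in> U" if "generate_topology_on {{h \<in> sym_tensors X A. small c K is e (h - g)} | g c K is e.
    g \<in> sym_tensors X A \<and> admissible c K \<and> 0 < e} U" "l \<in> U" for U
    using that
  proof (induction rule: generate_topology_on.induct)
    case (Int a b)
    then show ?case by (simp add: eventually_conj_iff)
  next
    case (UN Ks)
    then obtain k where "k \<in> Ks" "\<forall>\<^sub>F z in F. f z \<in> k" by blast
    then show ?case by (auto elim: eventually_mono)
  next
    case (Basis s)
    then obtain g c K "is" e where s: "s = {h \<in> sym_tensors X A. small c K is e (h - g)}"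
      and g: "g \<in> sym_tensors X A" and K: "admissible c K" and e: "0 < e" by blast
    have l: "l \<in> sym_tensors X A" "small c K is e (l - g)" using Basis(2) s by auto
    obtain m where m: "\<And>e. m < e \<Longrightarrow> small c K is e (l - g)" "\<And>e. 0 < e \<Longrightarrow> small c K is e (l - g) \<Longrightarrow> m < e"
      using seminorm_attained[OF K sym_tensors_diff[OF l(1) g]] by metis
    have "m < e" using m(2)[OF e l(2)] .
    define d where "d = (e - m) / 2"
    have "0 < d" using \<open>m < e\<close> by (simp add: d_def)
    have l': "small c K is (m + d) (l - g)" using \<open>0 < d\<close> by (intro m(1)) simp
    have "\<forall>\<^sub>F z in F. f z \<in> sym_tensors X A \<and> small c K is d (f z - l)"
      using R K \<open>0 < d\<close> by (intro eventually_conj) blast+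
    then show ?case
    proof (rule eventually_mono)
      fix z assume z: "f z \<in> sym_tensors X A \<and> small c K is d (f z - l)"
      have "small c K is e ((f z - l) + 1 *\<^sub>R (l - g))"
        using z l' g l(1) by (intro small_add_scaleR[OF K _ _ _ l'] sym_tensors_diff) (auto simp: d_def field_simps)
      then show "f z \<in> s" using z by (simp add: s)
    qed
  qed simp
  then show "limitin T f l F"
    using R unfolding limitin_def topspace_smooth unfolding smooth_topology_alt openin_topology_generated_by_iff by blast
qed

lemma limitin_smooth_small:
  "limitin T f l F \<Longrightarrow> admissible c K \<Longrightarrow> 0 < e \<Longrightarrow> \<forall>\<^sub>F z in F. small c K is e (f z - l)"
  unfolding limitin_smooth_iff by blast

lemma limitin_smooth_add:
  assumes f: "limitin T f l F" and g: "limitin T g m F"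
  shows "limitin T (\<lambda>z. f z + g z) (l + m) F"
proof -
  have lm: "l \<in> sym_tensors X A" "m \<in> sym_tensors X A" using f g by (simp_all add: limitin_smooth_iff)
  have ev: "\<forall>\<^sub>F z in F. f z \<in> sym_tensors X A \<and> g z \<in> sym_tensors X A"
    using f g by (auto simp: limitin_smooth_iff intro: eventually_conj)
  show ?thesis
    unfolding limitin_smooth_iff
  proof (intro conjI allI impI)
    show "l + m \<in> sym_tensors X A" using lm by (rule sym_tensors_add)
    show "\<forall>\<^sub>F z in F. f z + g z \<in> sym_tensors X A"
      using ev by (rule eventually_mono) (simp add: sym_tensors_add)
    fix c K "is" and e :: real assume K: "admissible c K" and e: "0 < e"
    then have "0 < e / 2" by simp
    then have "\<forall>\<^sub>F z in F. (f z \<in> sym_tensors X A \<and> g z \<in> sym_tensors X A) \<and>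
        small c K is (e / 2) (f z - l) \<and> small c K is (e / 2) (g z - m)"
      by (intro eventually_conj ev limitin_smooth_small[OF f K] limitin_smooth_small[OF g K])
    then show "\<forall>\<^sub>F z in F. small c K is e (f z + g z - (l + m))"
    proof (rule eventually_mono)
      fix z assume "(f z \<in> sym_tensors X A \<and> g z \<in> sym_tensors X A) \<and>
        small c K is (e / 2) (f z - l) \<and> small c K is (e / 2) (g z - m)"
      then have "small c K is e ((f z - l) + 1 *\<^sub>R (g z - m))"
        using lm by (intro small_add_scaleR[OF K, where d = "e / 2" and e = "e / 2"] sym_tensors_diff) auto
      moreover have "(f z - l) + 1 *\<^sub>R (g z - m) = f z + g z - (l + m)" by simp
      ultimately show "small c K is e (f z + g z - (l + m))" by (simp only:)
    qed
  qed
qed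

text \<open>The usual splitting \<open>a f - \<alpha> l = a (f - l) + (a - \<alpha>) l\<close>.\<close>

lemma limitin_smooth_scaleR:
  assumes a: "(a \<longlongrightarrow> \<alpha>) F" and f: "limitin T f l F"
  shows "limitin T (\<lambda>z. a z *\<^sub>R f z) (\<alpha> *\<^sub>R l) F"
proof -
  have l: "l \<in> sym_tensors X A" using f by (simp add: limitin_smooth_iff)
  have ev: "\<forall>\<^sub>F z in F. f z \<in> sym_tensors X A"
    using f by (simp add: limitin_smooth_iff)
  show ?thesis
    unfolding limitin_smooth_iff
  proof (intro conjI allI impI)
    show "\<alpha> *\<^sub>R l \<in> sym_tensors X A" using l by (rule sym_tensors_scaleR)
    show "\<forall>\<^sub>F z in F. a z *\<^sub>R f z \<in> sym_tensors X A"
      using ev by (rule eventually_mono) (rule sym_tensors_scaleR)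
    fix c K "is" and e :: real assume K: "admissible c K" and e: "0 < e"
    obtain m where m: "0 \<le> m" "small c K is (m + 1) l"
      using seminorm_attained[OF K l] by (metis less_add_one)
    define \<epsilon> where "\<epsilon> = e / 2 / (\<bar>\<alpha>\<bar> + 1)"
    have "0 < \<epsilon>" using e by (simp add: \<epsilon>_def)
    define \<delta> where "\<delta> = min 1 (e / 2 / (m + 1))"
    have "0 < \<delta>" using e m by (simp add: \<delta>_def)
    have "\<forall>\<^sub>F z in F. (f z \<in> sym_tensors X A \<and> small c K is \<epsilon> (f z - l)) \<and> dist (a z) \<alpha> < \<delta>"
      by (intro eventually_conj ev limitin_smooth_small[OF f K \<open>0 < \<epsilon>\<close>] tendstoD[OF a \<open>0 < \<delta>\<close>])
    then show "\<forall>\<^sub>F z in F. small c K is e (a z *\<^sub>R f z - \<alpha> *\<^sub>R l)"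
    proof (rule eventually_mono)
      fix z assume z: "(f z \<in> sym_tensors X A \<and> small c K is \<epsilon> (f z - l)) \<and> dist (a z) \<alpha> < \<delta>"
      then have a\<alpha>: "\<bar>a z - \<alpha>\<bar> < e / 2 / (m + 1)" "\<bar>a z\<bar> < \<bar>\<alpha>\<bar> + 1"
        by (auto simp: dist_real_def \<delta>_def)
      have "\<bar>a z\<bar> * \<epsilon> < (\<bar>\<alpha>\<bar> + 1) * \<epsilon>"
        using a\<alpha> \<open>0 < \<epsilon>\<close> by (intro mult_strict_right_mono) auto
      also have "\<dots> = e / 2"
        unfolding \<epsilon>_def by (subst mult.commute, rule iffD1[OF nonzero_eq_divide_eq refl]) linarith
      finally have b1: "small c K is (e / 2) (a z *\<^sub>R (f z - l))"
        using z l by (intro small_scaleR[OF K, where e = \<epsilon>] sym_tensors_diff) auto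
      have "\<bar>a z - \<alpha>\<bar> * (m + 1) < e / 2 / (m + 1) * (m + 1)"
        using a\<alpha> m by (intro mult_strict_right_mono) auto
      also have "\<dots> = e / 2" by (rule iffD1[OF nonzero_eq_divide_eq refl]) (use m in linarith)
      finally have b2: "small c K is (e / 2) ((a z - \<alpha>) *\<^sub>R l)"
        using m l by (intro small_scaleR[OF K, where e = "m + 1"]) auto
      have "small c K is e (a z *\<^sub>R (f z - l) + 1 *\<^sub>R ((a z - \<alpha>) *\<^sub>R l))"
        using z l by (intro small_add_scaleR[OF K _ b1 _ b2] sym_tensors_diff sym_tensors_scaleR) auto
      moreover have "a z *\<^sub>R (f z - l) + 1 *\<^sub>R ((a z - \<alpha>) *\<^sub>R l) = a z *\<^sub>R f z - \<alpha> *\<^sub>R l"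
        by (simp add: algebra_simps)
      ultimately show "small c K is e (a z *\<^sub>R f z - \<alpha> *\<^sub>R l)" by (simp only:)
    qed
  qed
qed

lemma limitin_smooth_const: "l \<in> sym_tensors X A \<Longrightarrow> limitin T (\<lambda>_. l) l F"
  by (simp add: limitin_def)

text \<open>Evaluation of the components at a point is continuous, and components separate tensors.\<close>

lemma limitin_smooth_unique:
  assumes "limitin T f l F" "limitin T f m F" "F \<noteq> bot"
  shows "l = m"
proof (rule sym_tensor_eqI)
  show l: "l \<in> sym_tensors X A" and m: "m \<in> sym_tensors X A" using assms by (simp_all add: limitin_smooth_iff)
  fix p assume "p \<in> topspace X"
  then obtain c where c: "c \<in> A" "p \<in> fst c" using covered by blast
  then have K: "admissible c {p}" using chart_in_X by (simp add: admissible_def)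
  have conv: "((\<lambda>z. components A (f z) c p) \<longlongrightarrow> components A l c p) F" if "limitin T f l F" for l
  proof (rule tendstoI)
    fix e :: real assume "0 < e"
    then have "\<forall>\<^sub>F z in F. small c {p} [] e (f z - l)" by (rule limitin_smooth_small[OF that K])
    then show "\<forall>\<^sub>F z in F. dist (components A (f z) c p) (components A l c p) < e"
    proof (rule eventually_mono)
      fix z assume "small c {p} [] e (f z - l)"
      moreover have "components A (f z - l) c p = components A (f z) c p - components A l c p"
        using components_add_scaleR[of A "f z" "- 1" l c p] by simp
      ultimately show "dist (components A (f z) c p) (components A l c p) < e"
        using c by (simp add: small_def local_rep_chart dist_norm)
    qed
  qed
  have "components A l c p = components A m c p"
    by (rule tendsto_unique[OF assms(3) conv[OF assms(1)] conv[OF assms(2)]])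
  with c show "\<exists>c\<in>A. p \<in> fst c \<and> components A l c p = components A m c p" by blast
qed

lemma continuous_map_smooth_add:
  "continuous_map Z T f \<Longrightarrow> continuous_map Z T g \<Longrightarrow> continuous_map Z T (\<lambda>z. f z + g z)"
  unfolding continuous_map_atin by (auto intro: limitin_smooth_add)

lemma continuous_map_smooth_scaleR:
  "continuous_map Z euclideanreal a \<Longrightarrow> continuous_map Z T f \<Longrightarrow> continuous_map Z T (\<lambda>z. a z *\<^sub>R f z)"
  unfolding continuous_map_atin limitin_canonical_iff by (auto intro: limitin_smooth_scaleR)

lemma dir_deriv_smooth_eqI:
  "limitin T (\<lambda>t. (1 / t) *\<^sub>R (f (x + t *\<^sub>R v) - f x)) w (at (0::real)) \<Longrightarrow> dir_deriv T f x v = w"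
  unfolding dir_deriv_def by (rule the_equality) (auto intro: limitin_smooth_unique)

text \<open>The only contact between the topology of tensor fields and integration: a tensor field and a
  point determine the component matrix continuously.\<close>

lemma joint_continuity_local_rep:
  assumes c: "c \<in> A" and K: "compact K" "K \<subseteq> dom c"
  shows "continuous_map (prod_topology T (top_of_set K)) euclidean (\<lambda>(h, y). local_rep h c y)"
  unfolding continuous_map_atin limitin_canonical_iff
proof (intro ballI tendstoI)
  fix q0 and e :: real assume q0: "q0 \<in> topspace (prod_topology T (top_of_set K))" and e: "0 < e"
  obtain h0 y0 where q0_eq: "q0 = (h0, y0)" by (cases q0)
  with q0 have h0: "h0 \<in> sym_tensors X A" and y0: "y0 \<in> K" by simp_all
  define K' where "K' = chart_inv c ` K"
  have K': "admissible c K'"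
    using c compactin_chart_inv_image[OF c K] chart_inv_in[of _ c] K(2) by (auto simp: admissible_def K'_def)
  define B where "B = {h \<in> sym_tensors X A. small c K' [] (e / 2) (h - h0)}"
  have B: "openin T B" "h0 \<in> B"
    using openin_small[OF K' h0, of "e / 2"] small_0[OF K', of "e / 2"] h0 e by (simp_all add: B_def)
  define V where "V = {y \<in> K. dist (local_rep h0 c y) (local_rep h0 c y0) < e / 2}"
  have cont: "continuous_on K (local_rep h0 c)"
    using continuous_on_subset[OF continuous_local_rep[OF h0 c] K(2)] .
  have "openin (top_of_set K) (K \<inter> local_rep h0 c -` ball (local_rep h0 c y0) (e / 2))"
    by (rule continuous_openin_preimage_gen[OF cont open_ball])
  moreover have "K \<inter> local_rep h0 c -` ball (local_rep h0 c y0) (e / 2) = V"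
    by (auto simp: V_def dist_commute)
  ultimately have V: "openin (top_of_set K) V" "y0 \<in> V" using y0 e by (simp_all add: V_def)
  have "dist (local_rep h c y) (local_rep h0 c y0) < e" if "h \<in> B" "y \<in> V" for h y
  proof -
    have y: "y \<in> K" "y \<in> dom c" using that(2) K by (auto simp: V_def)
    have "local_rep (h - h0) c y = local_rep h c y - local_rep h0 c y"
      using local_rep_add_scaleR[of h "- 1" h0 c y] by simp
    moreover have "norm (local_rep (h - h0) c y) < e / 2"
    proof -
      have "norm (local_rep (h - h0) c (snd c (chart_inv c y))) < e / 2"
        using that(1) y(1) by (simp add: B_def small_def K'_def)
      then show ?thesis by (simp only: chart_chart_inv[OF y(2)])
    qed
    ultimately have "dist (local_rep h c y) (local_rep h0 c y) < e / 2" by (simp add: dist_norm)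
    moreover have "dist (local_rep h0 c y) (local_rep h0 c y0) < e / 2" using that(2) by (simp add: V_def)
    ultimately show ?thesis
      using dist_triangle[of "local_rep h c y" "local_rep h0 c y0" "local_rep h0 c y"] by linarith
  qed
  moreover have "openin (prod_topology T (top_of_set K)) (B \<times> V)" "q0 \<in> B \<times> V"
    using B V by (simp_all add: openin_prod_Times_iff q0_eq)
  ultimately show "\<forall>\<^sub>F q in atin (prod_topology T (top_of_set K)) q0.
      dist (case q of (h, y) \<Rightarrow> local_rep h c y) (case q0 of (h, y) \<Rightarrow> local_rep h c y) < e"
    unfolding eventually_atin q0_eq by (intro disjI2 exI[of _ "B \<times> V"]) auto
qed

section \<open>Partitions of unity and integration\<close>

text \<open>Around each point there is a Urysohn function that is 1 there and supported in a chart. By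
  compactness finitely many of them have a positive sum; they are normalised and grouped by chart.\<close>

lemma exists_partition_of_unity: "\<exists>\<rho>. partition_of_unity X A \<rho>"
proof -
  have normal: "normal_space X"
    using X_compact X_Hausdorff compact_Hausdorff_or_regular_imp_normal_space by blast
  (* The chart and the function are chosen together as a pair. *)
  define bump where "bump p w \<longleftrightarrow> fst w \<in> A \<and> continuous_map X euclideanreal (snd w) \<and>
      (\<forall>q\<in>topspace X. 0 \<le> snd w q) \<and> X closure_of {q \<in> topspace X. snd w q \<noteq> 0} \<subseteq> fst (fst w) \<and>
      snd w p = 1" for p and w :: "('a, 'n) chart \<times> ('a \<Rightarrow> real)"
  have "\<exists>w. bump p w" if p: "p \<in> topspace X" for p
  proof -
    obtain c where c: "c \<in> A" "p \<in> fst c" using covered p by blast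
    have "closedin X {p}" using X_Hausdorff p by (simp add: closedin_Hausdorff_singleton)
    then obtain V where V: "openin X V" "{p} \<subseteq> V" "X closure_of V \<subseteq> fst c"
      using normal[unfolded normal_space_alt, rule_format, of "{p}" "fst c"] openin_chart[OF c(1)] c(2) by auto
    obtain f where f: "continuous_map X (top_of_set {0..1::real}) f" "f ` (topspace X - V) \<subseteq> {0}" "f ` {p} \<subseteq> {1}"
      by (rule Urysohn_lemma[of X "topspace X - V" "{p}" 0 1])
        (use normal V \<open>closedin X {p}\<close> in \<open>auto simp: disjnt_def openin_closedin_eq\<close>)
    have "X closure_of {q \<in> topspace X. f q \<noteq> 0} \<subseteq> X closure_of V"
      using f(2) by (intro closure_of_mono) auto
    then have "X closure_of {q \<in> topspace X. f q \<noteq> 0} \<subseteq> fst c" using V(3) by simp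
    then have "bump p (c, f)"
      using c f by (auto simp: bump_def continuous_map_in_subtopology Pi_iff image_subset_iff)
    then show ?thesis by blast
  qed
  then obtain w where w: "\<And>p. p \<in> topspace X \<Longrightarrow> bump p (w p)" by metis
  define chart where "chart p = fst (w p)" for p
  define f where "f p = snd (w p)" for p
  have cf: "chart p \<in> A" "continuous_map X euclideanreal (f p)" "\<And>q. q \<in> topspace X \<Longrightarrow> 0 \<le> f p q"
      "X closure_of {q \<in> topspace X. f p q \<noteq> 0} \<subseteq> fst (chart p)" "f p p = 1"
    if "p \<in> topspace X" for p
    using w[OF that] by (simp_all add: bump_def chart_def f_def)
  define U where "U p = {q \<in> topspace X. f p q \<in> {0<..}}" for p
  have U: "openin X (U p)" "p \<in> U p" if "p \<in> topspace X" for p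
  proof -
    show "openin X (U p)" unfolding U_def
      by (rule openin_continuous_map_preimage[OF cf(2)[OF that]]) (simp flip: open_openin)
    show "p \<in> U p" using cf(5)[OF that] that by (simp add: U_def)
  qed
  then have "\<exists>\<F>. finite \<F> \<and> \<F> \<subseteq> U ` topspace X \<and> topspace X \<subseteq> \<Union>\<F>"
    using X_compact unfolding compact_space_alt
    by (elim allE[of _ "U ` topspace X"] impE) auto
  then obtain \<F> where \<F>: "finite \<F>" "\<F> \<subseteq> U ` topspace X" "topspace X \<subseteq> \<Union>\<F>" by blast
  from finite_subset_image[OF \<F>(1,2)] obtain P where "P \<subseteq> topspace X" "finite P" "\<F> = U ` P" by blast
  with \<F>(3) have P: "finite P" "P \<subseteq> topspace X" "topspace X \<subseteq> (\<Union>p\<in>P. U p)" by simp_all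
  define total where "total q = (\<Sum>p\<in>P. f p q)" for q
  have total_pos: "0 < total q" if q: "q \<in> topspace X" for q
  proof -
    obtain p where "p \<in> P" "0 < f p q" using P(3) q by (auto simp: U_def)
    then show ?thesis unfolding total_def using P cf q by (intro sum_pos2[of _ p]) auto
  qed
  define \<rho> where "\<rho> c q = (\<Sum>p\<in>{p\<in>P. chart p = c}. f p q) / total q" for c q
  have cont_sum: "continuous_map X euclideanreal (\<lambda>q. \<Sum>p\<in>Q. f p q)" if "Q \<subseteq> P" for Q
    using cf P that finite_subset by (intro continuous_map_sum) auto
  have "continuous_map X euclideanreal (\<rho> c)" for c
    unfolding \<rho>_def[abs_def] using total_pos
    by (intro continuous_map_real_divide cont_sum) (auto simp: total_def[abs_def] intro!: cont_sum, force)
  moreover have "0 \<le> \<rho> c q" if "q \<in> topspace X" for c q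
    unfolding \<rho>_def using cf P total_pos[OF that] that by (intro divide_nonneg_pos sum_nonneg) auto
  moreover have "X closure_of {q \<in> topspace X. \<rho> c q \<noteq> 0} \<subseteq> fst c" for c
  proof -
    have "{q \<in> topspace X. \<rho> c q \<noteq> 0} \<subseteq> (\<Union>p\<in>{p\<in>P. chart p = c}. {q \<in> topspace X. f p q \<noteq> 0})"
      by (auto simp: \<rho>_def dest: sum.not_neutral_contains_not_neutral)
    then have "X closure_of {q \<in> topspace X. \<rho> c q \<noteq> 0}
        \<subseteq> X closure_of (\<Union>p\<in>{p\<in>P. chart p = c}. {q \<in> topspace X. f p q \<noteq> 0})"
      by (rule closure_of_mono)
    also have "\<dots> = (\<Union>p\<in>{p\<in>P. chart p = c}. X closure_of {q \<in> topspace X. f p q \<noteq> 0})"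
      using P(1) closure_of_Union[of "(\<lambda>p. {q \<in> topspace X. f p q \<noteq> 0}) ` {p\<in>P. chart p = c}" X] by simp
    also have "\<dots> \<subseteq> fst c"
    proof (rule UN_least)
      fix p assume "p \<in> {p\<in>P. chart p = c}"
      then have "p \<in> topspace X" "chart p = c" using P(2) by blast+
      then show "X closure_of {q \<in> topspace X. f p q \<noteq> 0} \<subseteq> fst c" using cf(4)[of p] by simp
    qed
    finally show ?thesis .
  qed
  moreover have used: "charts_used X A \<rho> \<subseteq> chart ` P"
  proof
    fix c assume "c \<in> charts_used X A \<rho>"
    then obtain q where "\<rho> c q \<noteq> 0" by (auto simp: charts_used_def)
    show "c \<in> chart ` P"
    proof (rule ccontr)
      assume "c \<notin> chart ` P"
      then have "{p\<in>P. chart p = c} = {}" by blast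
      then show False using \<open>\<rho> c q \<noteq> 0\<close> by (simp only: \<rho>_def sum.empty div_0 not_True_eq_False simp_thms)
    qed
  qed
  moreover have "finite (charts_used X A \<rho>)" using used P(1) finite_surj by blast
  moreover have "(\<Sum>c\<in>charts_used X A \<rho>. \<rho> c q) = 1" if q: "q \<in> topspace X" for q
  proof -
    have "(\<Sum>c\<in>charts_used X A \<rho>. \<rho> c q) = (\<Sum>c\<in>chart ` P. \<rho> c q)"
      using P(1) used cf P(2) q by (intro sum.mono_neutral_left) (auto simp: charts_used_def)
    also have "\<dots> = (\<Sum>c\<in>chart ` P. \<Sum>p\<in>{p\<in>P. chart p = c}. f p q) / total q"
      by (simp add: \<rho>_def sum_divide_distrib)
    also have "(\<Sum>c\<in>chart ` P. \<Sum>p\<in>{p\<in>P. chart p = c}. f p q) = total q"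
      unfolding total_def using P(1) by (intro sum.group) auto
    finally show ?thesis using total_pos[OF q] by simp
  qed
  ultimately have "partition_of_unity X A \<rho>" unfolding partition_of_unity_def by blast
  then show ?thesis by blast
qed

text \<open>The very partition of unity chosen in the definition of the integral. All functionals are integrated
  against this same one.\<close>

definition \<rho> where "\<rho> = (SOME \<rho>. partition_of_unity X A \<rho>)"
definition used where "used = charts_used X A \<rho>"
definition supp where "supp c = snd c ` (X closure_of {p \<in> topspace X. \<rho> c p \<noteq> 0})"
definition weight where "weight c x = \<rho> c (chart_inv c x)"

lemma \<rho>_partition: "partition_of_unity X A \<rho>"
  unfolding \<rho>_def using exists_partition_of_unity by (rule someI_ex)

lemma finite_used: "finite used" and used_subset: "used \<subseteq> A"
  using \<rho>_partition by (auto simp: partition_of_unity_def used_def charts_used_def)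

lemma used_in: "c \<in> used \<Longrightarrow> c \<in> A"
  using used_subset by blast

lemma rho_properties:
  assumes "c \<in> used"
  shows "continuous_map X euclideanreal (\<rho> c)" and "p \<in> topspace X \<Longrightarrow> 0 \<le> \<rho> c p"
    and closure_support_subset: "X closure_of {p \<in> topspace X. \<rho> c p \<noteq> 0} \<subseteq> fst c"
  using bspec[OF conjunct1[OF \<rho>_partition[unfolded partition_of_unity_def]] used_in[OF assms]] by simp_all

lemma support_subset_closure: "{p \<in> topspace X. \<rho> c p \<noteq> 0} \<subseteq> X closure_of {p \<in> topspace X. \<rho> c p \<noteq> 0}"
  by (rule closure_of_subset) blast

lemma compact_supp: "c \<in> used \<Longrightarrow> compact (supp c)"
  unfolding supp_def
  by (intro compact_chart_image used_in closure_support_subset closedin_compact_space[OF X_compact]) auto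

lemma supp_subset: "c \<in> used \<Longrightarrow> supp c \<subseteq> dom c"
  unfolding supp_def using closure_support_subset by blast

lemma weight_nonneg: "c \<in> used \<Longrightarrow> x \<in> dom c \<Longrightarrow> 0 \<le> weight c x"
  unfolding weight_def by (blast intro: rho_properties(2) chart_in_X[OF used_in chart_inv_in])

lemma continuous_weight:
  assumes "c \<in> used"
  shows "continuous_on (dom c) (weight c)"
proof -
  from continuous_map_compose[OF chart_inv_continuous[OF used_in[OF assms]] rho_properties(1)[OF assms]]
  show ?thesis by (simp add: o_def weight_def[abs_def])
qed

lemma weight_outside:
  assumes c: "c \<in> used" and x: "x \<in> dom c - supp c"
  shows "weight c x = 0"
proof (rule ccontr)
  assume "weight c x \<noteq> 0"
  moreover have p: "chart_inv c x \<in> topspace X" using chart_in_X[OF used_in[OF c] chart_inv_in[of x c]] x by simp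
  ultimately have "chart_inv c x \<in> {p \<in> topspace X. \<rho> c p \<noteq> 0}" by (simp add: weight_def)
  then have "chart_inv c x \<in> X closure_of {p \<in> topspace X. \<rho> c p \<noteq> 0}"
    by (rule subsetD[OF support_subset_closure])
  then have "snd c (chart_inv c x) \<in> supp c" unfolding supp_def by (rule imageI)
  moreover from x have "x \<in> dom c" "x \<notin> supp c" by blast+
  ultimately show False using chart_chart_inv[of x c] by simp
qed

lemma exists_chart_weight_pos:
  assumes "p \<in> topspace X"
  obtains c where "c \<in> used" "p \<in> fst c" "snd c p \<in> supp c" "0 < weight c (snd c p)"
proof -
  have "(\<Sum>c\<in>used. \<rho> c p) = 1" using \<rho>_partition assms unfolding partition_of_unity_def used_def by blast
  then obtain c where c: "c \<in> used" "\<rho> c p \<noteq> 0" by (metis sum.neutral zero_neq_one)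
  then have "p \<in> {p \<in> topspace X. \<rho> c p \<noteq> 0}" using assms by simp
  then have cl: "p \<in> X closure_of {p \<in> topspace X. \<rho> c p \<noteq> 0}"
    by (rule subsetD[OF support_subset_closure])
  then have p: "p \<in> fst c" using closure_support_subset c(1) by blast
  have "weight c (snd c p) \<noteq> 0" using c(2) by (simp add: weight_def chart_inv_chart[OF used_in[OF c(1)] p])
  then have "0 < weight c (snd c p)" using weight_nonneg[OF c(1), of "snd c p"] p by force
  with c p cl show thesis by (intro that[of c]) (auto simp: supp_def)
qed

text \<open>Restricting to the compact supports of the weights turns the integral into a finite sum of
  integrals of continuous functions over compact sets.\<close>

lemma integral_form_eq:
  "integral_form X A \<omega> = (\<Sum>c\<in>used. LINT x:supp c|lborel. weight c x * \<omega> c (chart_inv c x))"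
proof -
  have "(LINT x:dom c|lborel. \<rho> c (chart_inv c x) * \<omega> c (chart_inv c x))
      = (LINT x:supp c|lborel. weight c x * \<omega> c (chart_inv c x))" if "c \<in> used" for c
    unfolding set_lebesgue_integral_def
    using weight_outside[OF that] supp_subset[OF that]
    by (intro Bochner_Integration.integral_cong refl) (auto simp: indicator_def weight_def)
  then show ?thesis
    unfolding integral_form_def Let_def \<rho>_def[symmetric] used_def[symmetric] by simp
qed

text \<open>Near a given metric the component matrices stay positive definite on each of the finitely many
  compact supports, by joint continuity and the tube lemma, and these supports cover the manifold.\<close>

lemma openin_metrics: "openin T (metrics X A)"
proof (subst openin_subopen, intro ballI)
  fix g assume g: "g \<in> metrics X A"
  then have gT: "g \<in> sym_tensors X A" by (simp add: metrics_def)
  have "\<exists>W. openin T W \<and> g \<in> W \<and> (\<forall>h\<in>W. \<forall>y\<in>supp c. pos_def (local_rep h c y))" if c: "c \<in> used" for c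
  proof -
    let ?P = "prod_topology T (top_of_set (supp c))"
    have "openin ?P {q \<in> topspace ?P. (\<lambda>(h, y). local_rep h c y) q \<in> Collect pos_def}"
      by (rule openin_continuous_map_preimage[OF joint_continuity_local_rep[OF used_in compact_supp supp_subset]])
        (use c open_pos_def in \<open>simp_all flip: open_openin\<close>)
    moreover have "pos_def (local_rep g c y)" if "y \<in> supp c" for y
      using metrics_pos_def[OF g used_in[OF c] chart_inv_in] supp_subset[OF c] that by (auto simp: local_rep_def)
    ultimately have "\<exists>U V. openin T U \<and> openin (top_of_set (supp c)) V \<and> g \<in> U \<and> supp c \<subseteq> V \<and>
        U \<times> V \<subseteq> {q \<in> topspace ?P. (\<lambda>(h, y). local_rep h c y) q \<in> Collect pos_def}"
      by (intro tube_lemma_right) (use compact_supp[OF c] gT in \<open>auto simp: compactin_subtopology\<close>)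
    then obtain U V where UV: "openin T U" "g \<in> U" "supp c \<subseteq> V"
        "U \<times> V \<subseteq> {q \<in> topspace ?P. (\<lambda>(h, y). local_rep h c y) q \<in> Collect pos_def}" by (elim exE conjE)
    have "pos_def (local_rep h c y)" if "h \<in> U" "y \<in> supp c" for h y
      using subsetD[OF UV(4), of "(h, y)"] UV(3) that by auto
    then show ?thesis using UV(1,2) by (intro exI[of _ U]) simp
  qed
  then have "\<forall>c\<in>used. \<exists>W. openin T W \<and> g \<in> W \<and> (\<forall>h\<in>W. \<forall>y\<in>supp c. pos_def (local_rep h c y))" by blast
  from bchoice[OF this] obtain W
    where "\<forall>c\<in>used. openin T (W c) \<and> g \<in> W c \<and> (\<forall>h\<in>W c. \<forall>y\<in>supp c. pos_def (local_rep h c y))" by blast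
  then have W: "openin T (W c)" "g \<in> W c" "h \<in> W c \<Longrightarrow> y \<in> supp c \<Longrightarrow> pos_def (local_rep h c y)"
    if "c \<in> used" for c h y using that by simp_all
  let ?W = "topspace T \<inter> \<Inter>(W ` used)"
  have "openin T ?W"
  proof (cases "used = {}")
    case False
    then have "openin T (\<Inter>(W ` used))" using finite_used W(1) by (intro openin_Inter) blast+
    then show ?thesis by (rule openin_Int[OF openin_topspace])
  qed (simp only: image_empty Inter_empty Int_UNIV_right openin_topspace)
  moreover have "g \<in> ?W" using gT W(2) by simp
  moreover have "?W \<subseteq> metrics X A"
  proof
    fix h assume h: "h \<in> ?W"
    show "h \<in> metrics X A"
    proof (rule metricsI)
      fix p assume "p \<in> topspace X"
      then obtain c where c: "c \<in> used" "p \<in> fst c" "snd c p \<in> supp c" by (rule exists_chart_weight_pos)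
      then have "pos_def (local_rep h c (snd c p))" using h by (intro W(3)[OF c(1)]) auto
      then show "\<exists>c\<in>A. p \<in> fst c \<and> pos_def (components A h c p)"
        using c used_in by (intro bexI[of _ c]) (auto simp: local_rep_chart)
    qed (use h in simp)
  qed
  ultimately show "\<exists>W. openin T W \<and> g \<in> W \<and> W \<subseteq> metrics X A" by blast
qed

end

section \<open>Positivity of integrals\<close>

text \<open>A continuous nonnegative function that is positive at one point exceeds half that value on a
  ball, which has positive measure.\<close>

lemma integral_pos_if_pos_at:
  fixes G :: "'p::euclidean_space \<Rightarrow> real"
  assumes K: "compact K" "K \<subseteq> S" and S: "open S" and G: "continuous_on S G"
    and nonneg: "\<And>x. x \<in> S \<Longrightarrow> 0 \<le> G x" and outside: "\<And>x. x \<in> S - K \<Longrightarrow> G x = 0"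
    and x0: "x0 \<in> S" "0 < G x0"
  shows "0 < (LINT x:K|lborel. G x)"
proof -
  have "open (S \<inter> G -` {G x0 / 2<..})"
    using continuous_open_preimage[OF G S, of "{G x0 / 2<..}"] by simp
  then obtain \<delta> where \<delta>: "0 < \<delta>" "ball x0 \<delta> \<subseteq> S \<inter> G -` {G x0 / 2<..}"
    using x0 openE[of "S \<inter> G -` {G x0 / 2<..}" x0] by auto
  have ball: "x \<in> K" "G x0 / 2 \<le> G x" if "x \<in> ball x0 \<delta>" for x
  proof -
    have "x \<in> S" "G x0 / 2 < G x" using \<delta>(2) that by auto
    moreover have "x \<in> K"
    proof (rule ccontr)
      assume "x \<notin> K"
      then have "G x = 0" using outside \<open>x \<in> S\<close> by simp
      then show False using \<open>G x0 / 2 < G x\<close> x0 by simp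
    qed
    ultimately show "x \<in> K" "G x0 / 2 \<le> G x" by simp_all
  qed
  have "0 < measure lborel (ball x0 \<delta>) * (G x0 / 2)"
    using content_ball_pos[OF \<delta>(1), of x0] x0 by simp
  also have "\<dots> = (\<integral>x. indicator (ball x0 \<delta>) x *\<^sub>R (G x0 / 2) \<partial>lborel)"
    by simp
  also have "\<dots> \<le> (\<integral>x. indicator K x *\<^sub>R G x \<partial>lborel)"
  proof (rule integral_mono)
    show "integrable lborel (\<lambda>x. indicator K x *\<^sub>R G x)"
      by (rule borel_integrable_compact[OF K(1) continuous_on_subset[OF G K(2)]])
    show "integrable lborel (\<lambda>x. indicator (ball x0 \<delta>) x *\<^sub>R (G x0 / 2))"
      using emeasure_lborel_ball_finite[of x0 \<delta>] by simp
    fix x show "indicator (ball x0 \<delta>) x *\<^sub>R (G x0 / 2) \<le> indicator K x *\<^sub>R G x"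
      using ball[of x] nonneg[of x] K(2) by (cases "x \<in> ball x0 \<delta>"; cases "x \<in> K") auto
  qed
  finally show ?thesis by (simp add: set_lebesgue_integral_def)
qed

lemma frechet_smooth_imp_continuous_map:
  assumes "frechet_smooth T U euclideanreal f"
  shows "continuous_map (subtopology T U) euclideanreal f"
proof -
  obtain D where D: "derivative_tower T U f D" using assms unfolding frechet_smooth_iff_tower by blast
  have "continuous_map (subtopology T U) (prod_topology (subtopology T U) (product_topology (\<lambda>_. T) {..<0}))
      (\<lambda>x. (x, \<lambda>_::nat. undefined))"
    by (intro continuous_map_pairedI continuous_map_id[unfolded id_def]
        continuous_map_coordinatewise_then_product) simp_all
  from continuous_map_compose[OF this derivative_towerD(2)[OF D]]
  have "continuous_map (subtopology T U) euclideanreal (\<lambda>x. D 0 x (\<lambda>_. undefined))"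
    by (simp add: o_def)
  then show ?thesis
    by (rule continuous_map_eq) (simp add: derivative_towerD(1)[OF D])
qed

lemma continuous_map_euclidean_Pair:
  "continuous_map Z euclidean f \<Longrightarrow> continuous_map Z euclidean g \<Longrightarrow> continuous_map Z euclidean (\<lambda>z. (f z, g z))"
  unfolding continuous_map_atin limitin_canonical_iff by (auto intro: tendsto_Pair)

section \<open>Scaling of densities\<close>

definition ebin_density :: "real ^ 'n ^ 'n \<Rightarrow> real ^ 'n ^ 'n \<Rightarrow> real ^ 'n ^ 'n \<Rightarrow> real"
  where "ebin_density g u v = trace ((matrix_inv g ** u) ** (matrix_inv g ** v)) * sqrt (det g)"

lemma trace_scaleR: "trace (t *\<^sub>R A) = t * trace (A :: real ^ 'n ^ 'n)"
  by (simp add: trace_def sum_distrib_left)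

lemma ebin_density_sym: "ebin_density g u v = ebin_density g v u"
  by (simp add: ebin_density_def trace_mul_sym[of "matrix_inv g ** u"])

lemma ebin_density_linear:
  "ebin_density g (a *\<^sub>R u + b *\<^sub>R v) w = a * ebin_density g u w + b * ebin_density g v w"
  by (simp add: ebin_density_def matrix_add_ldistrib matrix_mult_add_left matrix_mult_scaleR_left
      matrix_mult_scaleR_right trace_add trace_scaleR algebra_simps)

lemma det_scaleR: "det (t *\<^sub>R M) = t ^ CARD('n) * det (M :: real ^ 'n ^ 'n)"
proof -
  have "t *\<^sub>R M = (\<chi> i. t *s M $ i)" by (simp add: vec_eq_iff)
  then show ?thesis using det_rows_mul[of "\<lambda>_. t" "\<lambda>i. M $ i"] by simp
qed

lemma sqrt_det_scaleR:
  assumes "0 < l" "0 < det (M :: real ^ 'n ^ 'n)"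
  shows "sqrt (det (l *\<^sub>R M)) = l powr (real CARD('n) / 2) * sqrt (det M)"
proof -
  have "sqrt (l ^ CARD('n)) = (l powr real CARD('n)) powr (1 / 2)"
    using assms(1) by (simp add: powr_half_sqrt powr_realpow)
  also have "\<dots> = l powr (real CARD('n) / 2)" by (simp add: powr_powr)
  finally show ?thesis by (simp add: det_scaleR real_sqrt_mult)
qed

text \<open>The contractions \<open>g\<^sup>-\<^sup>1u\<close> are invariant under simultaneous scaling, so the degree comes from
  the volume density alone.\<close>

lemma ebin_density_scaleR:
  assumes l: "0 < l" and g: "0 < det (g :: real ^ 'n ^ 'n)"
  shows "ebin_density (l *\<^sub>R g) (l *\<^sub>R u) (l *\<^sub>R v) = l powr (real CARD('n) / 2) * ebin_density g u v"
proof -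
  have inv: "invertible g" using g by (simp add: invertible_det_nz)
  have "matrix_inv (l *\<^sub>R g) = (1 / l) *\<^sub>R matrix_inv g"
    using l by (intro matrix_inv_unique)
      (simp_all add: matrix_mult_scaleR_left matrix_mult_scaleR_right matrix_inv_left[OF inv] matrix_inv_right[OF inv])
  then show ?thesis
    using l by (simp add: ebin_density_def matrix_mult_scaleR_left matrix_mult_scaleR_right sqrt_det_scaleR[OF l g])
qed

text \<open>Contracting \<open>g\<close> with its own inverse gives the identity; the result is twice the derivative of the volume
  density, which is the pointwise form of \<open>G(P, \<cdot>) = df\<close>.\<close>

lemma ebin_density_self:
  assumes "0 < det g"
  shows "ebin_density g g v = trace (matrix_inv g ** v) * sqrt (det g)"
  using assms by (simp add: ebin_density_def matrix_inv_left invertible_det_nz)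

lemma open_det_pos: "open {M :: real ^ 'n ^ 'n. 0 < det M}"
  unfolding det_def by (intro open_Collect_less continuous_intros)

lemma open_det_fst_pos: "open {x :: (real ^ 'n ^ 'n) \<times> 'b::topological_space. 0 < det (fst x)}"
  unfolding det_def by (intro open_Collect_less continuous_intros)

context compact_oriented_mfd
begin

abbreviation N where "N \<equiv> metrics X A"

lemma metrics_subset: "N \<subseteq> sym_tensors X A"
  by (auto simp: metrics_def)

lemma metrics_in_sym: "g \<in> N \<Longrightarrow> g \<in> sym_tensors X A"
  using metrics_subset by blast

lemma local_rep_scaleR: "local_rep (t *\<^sub>R h) c x = t *\<^sub>R local_rep h c x"
  by (simp add: local_rep_def components_def vec_eq_iff scaleR_fun_def)

lemma metrics_local_rep_pos_def:
  assumes "g \<in> N" "c \<in> used" "x \<in> dom c"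
  shows "pos_def (local_rep g c x)"
  unfolding local_rep_def by (rule metrics_pos_def[OF assms(1) used_in[OF assms(2)] chart_inv_in[OF assms(3)]])

lemma metrics_det_pos: "g \<in> N \<Longrightarrow> c \<in> used \<Longrightarrow> x \<in> dom c \<Longrightarrow> 0 < det (local_rep g c x)"
  by (rule pos_def_det_pos[OF metrics_local_rep_pos_def])

text \<open>Since \<open>v\<close> is arbitrary, the line stays in the cone of metrics only for small \<open>t\<close>.\<close>

lemma metrics_line:
  assumes "g \<in> N" "v \<in> sym_tensors X A"
  shows "\<forall>\<^sub>F t in at (0::real). g + t *\<^sub>R v \<in> N"
proof -
  have "((\<lambda>t. t) \<longlongrightarrow> (0::real)) (at 0)" by (rule tendsto_ident_at)
  then have "limitin T (\<lambda>t. g + t *\<^sub>R v) (g + (0::real) *\<^sub>R v) (at (0::real))"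
    by (intro limitin_smooth_add limitin_smooth_scaleR limitin_smooth_const metrics_in_sym[OF assms(1)] assms(2))
  from limitinD[OF this openin_metrics] show ?thesis using assms(1) by simp
qed

lemma continuous_weight_supp: "c \<in> used \<Longrightarrow> continuous_on (supp c) (weight c)"
  by (rule continuous_on_subset[OF continuous_weight supp_subset])

lemma joint_local_rep:
  "c \<in> used \<Longrightarrow> continuous_map (prod_topology T (top_of_set (supp c))) euclidean (\<lambda>(h, y). local_rep h c y)"
  by (intro joint_continuity_local_rep used_in compact_supp supp_subset)

section \<open>The volume\<close>

lemma volume_eq: "volume X A g = (\<Sum>c\<in>used. LINT x:supp c|lborel. weight c x * sqrt (det (local_rep g c x)))"
  by (simp add: volume_def integral_form_eq vol_form_def local_rep_def)

lemma two_volume_eq: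
  "2 * volume X A g = (\<Sum>c\<in>used. LINT x:supp c|lborel. (2 * weight c x) * sqrt (det (local_rep g c x)))"
  by (simp add: volume_eq sum_distrib_left mult.assoc)

lemma frechet_smooth_two_volume: "frechet_smooth T N euclideanreal (\<lambda>g. 2 * volume X A g)"
  unfolding two_volume_eq
proof (rule frechet_smooth_sum[OF finite_used])
  fix c assume c: "c \<in> used"
  show "frechet_smooth T N euclideanreal (\<lambda>g. LINT x:supp c|lborel. (2 * weight c x) * sqrt (det (local_rep g c x)))"
    using supp_subset[OF c] metrics_subset metrics_det_pos[OF _ c]
    by (intro frechet_smooth_weighted_integral[OF compact_supp[OF c] _ local_rep_add_scaleR joint_local_rep[OF c]
          _ _ open_det_pos frechet_smooth_vol_density] continuous_intros continuous_weight_supp c) auto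
qed

text \<open>The factor 2 in the function \<open>f\<close> cancels the factor 1/2 in the derivative of the square root.\<close>

lemma two_volume_derivative:
  assumes g: "g \<in> N" and v: "v \<in> sym_tensors X A"
  shows "dir_deriv euclideanreal (\<lambda>g. 2 * volume X A g) g v
    = (\<Sum>c\<in>used. LINT x:supp c|lborel. weight c x * (trace (matrix_inv (local_rep g c x) ** local_rep v c x) * sqrt (det (local_rep g c x))))"
proof -
  have "((\<lambda>t. (1 / t) *\<^sub>R ((LINT x:supp c|lborel. (2 * weight c x) * sqrt (det (local_rep (g + t *\<^sub>R v) c x)))
      - (LINT x:supp c|lborel. (2 * weight c x) * sqrt (det (local_rep g c x)))))
    \<longlongrightarrow> (LINT x:supp c|lborel. (2 * weight c x) * (1 / 2 * trace (matrix_inv (local_rep g c x) ** local_rep v c x) * sqrt (det (local_rep g c x))))) (at 0)"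
    if c: "c \<in> used" for c
    by (rule weighted_integral_directional_derivative[OF compact_supp[OF c] _ local_rep_add_scaleR joint_local_rep[OF c]
          _ _ open_det_pos frechet_smooth_vol_density _ g _ metrics_line[OF g v]])
      (use supp_subset[OF c] metrics_subset metrics_det_pos[OF _ c] v in
        \<open>auto intro!: continuous_intros continuous_weight_supp c sqrt_det_has_derivative[simplified]\<close>)
  note lim = tendsto_sum[OF this, of used "\<lambda>c. c"]
  have integrand: "(LINT x:supp c|lborel. (2 * weight c x) * (1 / 2 * trace (matrix_inv (local_rep g c x) ** local_rep v c x) * sqrt (det (local_rep g c x))))
      = (LINT x:supp c|lborel. weight c x * (trace (matrix_inv (local_rep g c x) ** local_rep v c x) * sqrt (det (local_rep g c x))))" for c
    by (simp add: mult.assoc)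
  have "((\<lambda>t. (1 / t) *\<^sub>R (2 * volume X A (g + t *\<^sub>R v) - 2 * volume X A g)) \<longlongrightarrow>
      (\<Sum>c\<in>used. LINT x:supp c|lborel. weight c x * (trace (matrix_inv (local_rep g c x) ** local_rep v c x) * sqrt (det (local_rep g c x))))) (at 0)"
    using lim unfolding two_volume_eq integrand by (simp only: flip: scaleR_sum_right sum_subtractf)
  then show ?thesis
    unfolding dir_deriv_def limitin_canonical_iff
    by (intro the_equality) (auto intro: tendsto_unique[OF trivial_limit_at])
qed

lemma volume_pos:
  assumes g: "g \<in> N"
  shows "0 < 2 * volume X A g"
proof -
  let ?G = "\<lambda>c x. weight c x * sqrt (det (local_rep g c x))"
  have G_cont: "continuous_on (dom c) (?G c)" if "c \<in> used" for c
    unfolding det_def using continuous_weight[OF that] continuous_local_rep[OF metrics_in_sym[OF g] used_in[OF that]]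
    by (intro continuous_intros)
  have G_nonneg: "0 \<le> ?G c x" if "c \<in> used" "x \<in> dom c" for c x
    using weight_nonneg[OF that] metrics_det_pos[OF g that] by simp
  obtain p where p: "p \<in> topspace X" using X_nonempty by blast
  obtain c where c: "c \<in> used" "p \<in> fst c" "snd c p \<in> supp c" "0 < weight c (snd c p)"
    using exists_chart_weight_pos[OF p] .
  have "0 < (LINT x:supp c|lborel. ?G c x)"
    by (rule integral_pos_if_pos_at[OF compact_supp[OF c(1)] supp_subset[OF c(1)] open_dom[OF used_in[OF c(1)]]
          G_cont[OF c(1)] _ _ imageI[OF c(2)]])
      (simp_all add: G_nonneg c weight_outside metrics_det_pos[OF g c(1) imageI[OF c(2)]])
  moreover have "0 \<le> (LINT x:supp c|lborel. ?G c x)" if "c \<in> used" for c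
    unfolding set_lebesgue_integral_def
    by (rule Bochner_Integration.integral_nonneg)
      (use G_nonneg[OF that] supp_subset[OF that] in \<open>auto simp: indicator_def\<close>)
  ultimately have "0 < volume X A g"
    unfolding volume_eq using finite_used c(1) by (intro sum_pos2[of _ c]) auto
  then show ?thesis by simp
qed

lemma two_volume_scaleR:
  assumes "0 < l" "g \<in> N"
  shows "2 * volume X A (l *\<^sub>R g) = l powr (real CARD('n) / 2) * (2 * volume X A g)"
proof -
  have "(LINT x:supp c|lborel. weight c x * sqrt (det (local_rep (l *\<^sub>R g) c x)))
      = (LINT x:supp c|lborel. l powr (real CARD('n) / 2) * (weight c x * sqrt (det (local_rep g c x))))" if c: "c \<in> used" for c
    unfolding set_lebesgue_integral_def
  proof (intro Bochner_Integration.integral_cong refl)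
    fix x show "indicat_real (supp c) x *\<^sub>R (weight c x * sqrt (det (local_rep (l *\<^sub>R g) c x)))
        = indicat_real (supp c) x *\<^sub>R (l powr (real CARD('n) / 2) * (weight c x * sqrt (det (local_rep g c x))))"
      using sqrt_det_scaleR[OF assms(1) metrics_det_pos[OF assms(2) c, of x]] supp_subset[OF c]
      by (cases "x \<in> supp c") (auto simp: local_rep_scaleR)
  qed
  then have "volume X A (l *\<^sub>R g) = l powr (real CARD('n) / 2) * volume X A g"
    by (simp add: volume_eq sum_distrib_left)
  then show ?thesis by simp
qed

section \<open>The Ebin metric\<close>

lemma ebin_eq:
  "ebin_metric X A g u v = (\<Sum>c\<in>used. LINT x:supp c|lborel. weight c x * ebin_density (local_rep g c x) (local_rep u c x) (local_rep v c x))"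
  by (simp add: ebin_metric_def integral_form_eq vol_form_def local_rep_def ebin_density_def metric_contract_def)

lemma continuous_ebin_integrand:
  assumes g: "g \<in> N" and u: "u \<in> sym_tensors X A" and v: "v \<in> sym_tensors X A" and c: "c \<in> used"
  shows "continuous_on (dom c) (\<lambda>x. weight c x * ebin_density (local_rep g c x) (local_rep u c x) (local_rep v c x))"
proof -
  have "continuous_on {x. 0 < det (fst x)} (\<lambda>(g :: real ^ 'n ^ 'n, u, v). ebin_density g u v)"
    using frechet_smooth_imp_continuous_map[OF frechet_smooth_ebin_density] by (simp add: ebin_density_def)
  moreover have "continuous_on (dom c) (\<lambda>x. (local_rep g c x, local_rep u c x, local_rep v c x))"
    by (intro continuous_intros continuous_local_rep used_in[OF c] metrics_in_sym[OF g] u v)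
  moreover have "(\<lambda>x. (local_rep g c x, local_rep u c x, local_rep v c x)) ` dom c \<subseteq> {x. 0 < det (fst x)}"
    using metrics_det_pos[OF g c] by auto
  ultimately have "continuous_on (dom c) (\<lambda>x. ebin_density (local_rep g c x) (local_rep u c x) (local_rep v c x))"
    using continuous_on_compose2[of _ "\<lambda>(g :: real ^ 'n ^ 'n, u, v). ebin_density g u v"] by fastforce
  then show ?thesis by (intro continuous_intros continuous_weight c)
qed

lemma frechet_smooth_ebin:
  "frechet_smooth (prod_topology T (prod_topology T T)) (N \<times> topspace T \<times> topspace T)
    euclideanreal (\<lambda>(g, u, v). ebin_metric X A g u v)"
proof -
  let ?T3 = "prod_topology T (prod_topology T T)"
  have "frechet_smooth ?T3 (N \<times> topspace T \<times> topspace T) euclideanreal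
    (\<lambda>q. \<Sum>c\<in>used. LINT x:supp c|lborel. weight c x * (\<lambda>(g, u, v). trace ((matrix_inv g ** u) ** (matrix_inv g ** v)) * sqrt (det g))
      (local_rep (fst q) c x, local_rep (fst (snd q)) c x, local_rep (snd (snd q)) c x))"
  proof (rule frechet_smooth_sum[OF finite_used])
    fix c assume c: "c \<in> used"
    let ?P = "prod_topology ?T3 (top_of_set (supp c))"
    have comp: "continuous_map ?P euclidean (\<lambda>q. local_rep (h q) c (snd q))" if "continuous_map ?P T h" for h
      using continuous_map_compose[OF continuous_map_pairedI[OF that continuous_map_snd] joint_local_rep[OF c]]
      by (simp add: o_def)
    have "continuous_map ?P euclidean
      (\<lambda>q. (local_rep (fst (fst q)) c (snd q), local_rep (fst (snd (fst q))) c (snd q), local_rep (snd (snd (fst q))) c (snd q)))"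
      by (intro continuous_map_euclidean_Pair comp continuous_map_fst_app[OF continuous_map_fst]
          continuous_map_fst_app[OF continuous_map_snd_app[OF continuous_map_fst]]
          continuous_map_snd_app[OF continuous_map_snd_app[OF continuous_map_fst]])
    then have joint: "continuous_map ?P euclidean
      (\<lambda>(q, x). (local_rep (fst q) c x, local_rep (fst (snd q)) c x, local_rep (snd (snd q)) c x))"
      by (simp add: case_prod_unfold)
    show "frechet_smooth ?T3 (N \<times> topspace T \<times> topspace T) euclideanreal
      (\<lambda>q. LINT x:supp c|lborel. weight c x * (\<lambda>(g, u, v). trace ((matrix_inv g ** u) ** (matrix_inv g ** v)) * sqrt (det g))
        (local_rep (fst q) c x, local_rep (fst (snd q)) c x, local_rep (snd (snd q)) c x))"
      by (rule frechet_smooth_weighted_integral[OF compact_supp[OF c] continuous_weight_supp[OF c] _ joint _ _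
            open_det_fst_pos frechet_smooth_ebin_density])
        (use supp_subset[OF c] metrics_subset metrics_det_pos[OF _ c] in \<open>auto simp: local_rep_add_scaleR\<close>)
  qed
  then show ?thesis by (simp add: ebin_eq ebin_density_def case_prod_unfold)
qed

lemma ebin_linear:
  assumes g: "g \<in> N" and u: "u \<in> sym_tensors X A" and v: "v \<in> sym_tensors X A" and w: "w \<in> sym_tensors X A"
  shows "ebin_metric X A g (a *\<^sub>R u + b *\<^sub>R v) w = a * ebin_metric X A g u w + b * ebin_metric X A g v w"
proof -
  let ?F = "\<lambda>c u x. weight c x * ebin_density (local_rep g c x) (local_rep u c x) (local_rep w c x)"
  have "(LINT x:supp c|lborel. ?F c (a *\<^sub>R u + b *\<^sub>R v) x) = a * (LINT x:supp c|lborel. ?F c u x) + b * (LINT x:supp c|lborel. ?F c v x)"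
    if c: "c \<in> used" for c
  proof -
    have int: "set_integrable lborel (supp c) (?F c h)" if "h \<in> sym_tensors X A" for h
      by (rule set_integrable_compact[OF compact_supp[OF c] continuous_on_subset[OF continuous_ebin_integrand[OF g that w c] supp_subset[OF c]]])
    have "local_rep (a *\<^sub>R u + b *\<^sub>R v) c x = a *\<^sub>R local_rep u c x + b *\<^sub>R local_rep v c x" for x
      by (simp add: local_rep_add_scaleR local_rep_scaleR)
    then have "(LINT x:supp c|lborel. ?F c (a *\<^sub>R u + b *\<^sub>R v) x) = (LINT x:supp c|lborel. a * ?F c u x + b * ?F c v x)"
      by (simp add: ebin_density_linear algebra_simps)
    also have "\<dots> = (LINT x:supp c|lborel. a * ?F c u x) + (LINT x:supp c|lborel. b * ?F c v x)"
      by (intro set_integral_add set_integrable_mult_right int u v impI)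
    finally show ?thesis by simp
  qed
  then show ?thesis by (simp add: ebin_eq sum.distrib sum_distrib_left)
qed

text \<open>The density of \<open>G(u, u)\<close> is nonnegative, so if the integral vanishes then the density vanishes wherever
  some weight is positive, that is, everywhere.\<close>

lemma ebin_nondegenerate:
  assumes g: "g \<in> N" and u: "u \<in> sym_tensors X A" and zero: "ebin_metric X A g u u = 0"
  shows "u = 0"
proof -
  let ?G = "\<lambda>c x. weight c x * ebin_density (local_rep g c x) (local_rep u c x) (local_rep u c x)"
  have sym: "transpose (local_rep h c x) = local_rep h c x" if "h \<in> sym_tensors X A" "c \<in> used" "x \<in> dom c" for h c x
    unfolding local_rep_def by (rule transpose_components[OF that(1) used_in[OF that(2)] chart_inv_in[OF that(3)]])
  note sq = trace_square_contract_eq_0[OF sym[OF metrics_in_sym[OF g]] metrics_local_rep_pos_def[OF g] sym[OF u]]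
  have density_nonneg: "0 \<le> ebin_density (local_rep g c x) (local_rep u c x) (local_rep u c x)"
    if "c \<in> used" "x \<in> dom c" for c x
    unfolding ebin_density_def using sq(1)[OF that that that] metrics_det_pos[OF g that] by simp
  have G_nonneg: "0 \<le> ?G c x" if "c \<in> used" "x \<in> dom c" for c x
    using density_nonneg[OF that] weight_nonneg[OF that] by simp
  have "0 \<le> (LINT x:supp c|lborel. ?G c x)" if "c \<in> used" for c
    unfolding set_lebesgue_integral_def
    by (rule Bochner_Integration.integral_nonneg)
      (use G_nonneg[OF that] supp_subset[OF that] in \<open>auto simp: indicator_def\<close>)
  then have int_zero: "(LINT x:supp c|lborel. ?G c x) = 0" if "c \<in> used" for c
    using zero that sum_nonneg_eq_0_iff[OF finite_used, of "\<lambda>c. LINT x:supp c|lborel. ?G c x"] by (simp add: ebin_eq)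
  show ?thesis
  proof (rule sym_tensor_eqI[OF u sym_tensors_0])
    fix p assume "p \<in> topspace X"
    then obtain c where c: "c \<in> used" "p \<in> fst c" "snd c p \<in> supp c" "0 < weight c (snd c p)"
      by (rule exists_chart_weight_pos)
    let ?x = "snd c p"
    have x: "?x \<in> dom c" using c(2) by (rule imageI)
    have "\<not> 0 < ?G c ?x"
    proof
      assume "0 < ?G c ?x"
      then have "0 < (LINT x:supp c|lborel. ?G c x)"
        by (intro integral_pos_if_pos_at[OF compact_supp[OF c(1)] supp_subset[OF c(1)] open_dom[OF used_in[OF c(1)]]
              continuous_ebin_integrand[OF g u u c(1)] _ _ x]) (simp_all add: G_nonneg c(1) weight_outside)
      then show False using int_zero[OF c(1)] by simp
    qed
    then have "ebin_density (local_rep g c ?x) (local_rep u c ?x) (local_rep u c ?x) = 0"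
      using c(4) density_nonneg[OF c(1) x] by (simp add: zero_less_mult_iff)
    then have "local_rep u c ?x = 0"
      using metrics_det_pos[OF g c(1) x] unfolding ebin_density_def by (intro sq(2)[OF c(1) x c(1) x c(1) x]) simp
    then have "components A u c p = components A 0 c p"
      using c(2) used_in[OF c(1)] by (simp add: local_rep_chart components_def[of A 0] vec_eq_iff)
    then show "\<exists>c\<in>A. p \<in> fst c \<and> components A u c p = components A 0 c p"
      using c(2) used_in[OF c(1)] by blast
  qed
qed

lemma ebin_scaleR:
  assumes "0 < l" "g \<in> N"
  shows "ebin_metric X A (l *\<^sub>R g) (l *\<^sub>R u) (l *\<^sub>R v) = l powr (real CARD('n) / 2) * ebin_metric X A g u v"
proof -
  let ?F = "\<lambda>c g u v x. weight c x * ebin_density (local_rep g c x) (local_rep u c x) (local_rep v c x)"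
  have "(LINT x:supp c|lborel. ?F c (l *\<^sub>R g) (l *\<^sub>R u) (l *\<^sub>R v) x)
      = (LINT x:supp c|lborel. l powr (real CARD('n) / 2) * ?F c g u v x)" if c: "c \<in> used" for c
    unfolding set_lebesgue_integral_def
  proof (intro Bochner_Integration.integral_cong refl)
    fix x show "indicat_real (supp c) x *\<^sub>R ?F c (l *\<^sub>R g) (l *\<^sub>R u) (l *\<^sub>R v) x
        = indicat_real (supp c) x *\<^sub>R (l powr (real CARD('n) / 2) * ?F c g u v x)"
      using ebin_density_scaleR[OF assms(1) metrics_det_pos[OF assms(2) c, of x]] supp_subset[OF c]
      by (cases "x \<in> supp c") (auto simp: local_rep_scaleR)
  qed
  then show ?thesis by (simp add: ebin_eq sum_distrib_left)
qed

text \<open>The Euler vector field at \<open>g\<close> is \<open>g\<close> itself, so this is the identity \<open>G(P, \<cdot>) = df\<close>.\<close>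

lemma ebin_self:
  assumes g: "g \<in> N" and v: "v \<in> sym_tensors X A"
  shows "ebin_metric X A g g v = dir_deriv euclideanreal (\<lambda>g. 2 * volume X A g) g v"
  unfolding two_volume_derivative[OF g v] ebin_eq set_lebesgue_integral_def
proof (intro sum.cong Bochner_Integration.integral_cong refl)
  fix c x assume c: "c \<in> used"
  show "indicat_real (supp c) x *\<^sub>R (weight c x * ebin_density (local_rep g c x) (local_rep g c x) (local_rep v c x))
      = indicat_real (supp c) x *\<^sub>R (weight c x * (trace (matrix_inv (local_rep g c x) ** local_rep v c x) * sqrt (det (local_rep g c x))))"
    using ebin_density_self[OF metrics_det_pos[OF g c, of x]] supp_subset[OF c] by (cases "x \<in> supp c") auto
qed

section \<open>The scaling action\<close>

text \<open>The action is the restriction of a bilinear map, so its derivatives are written down directly and vanish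
  from order three on.\<close>

lemma frechet_smooth_scaling:
  assumes U: "U \<subseteq> UNIV \<times> sym_tensors X A"
  shows "frechet_smooth (prod_topology euclideanreal T) U T (\<lambda>(l, g). l *\<^sub>R g)"
proof -
  let ?RT = "prod_topology euclideanreal T"
  define D :: "nat \<Rightarrow> real \<times> ('a, 'n) tensor2 \<Rightarrow> (nat \<Rightarrow> real \<times> ('a, 'n) tensor2) \<Rightarrow> ('a, 'n) tensor2"
    where "D k q v = (if k = 0 then fst q *\<^sub>R snd q
      else if k = 1 then fst (v 0) *\<^sub>R snd q + fst q *\<^sub>R snd (v 0)
      else if k = 2 then fst (v 0) *\<^sub>R snd (v 1) + fst (v 1) *\<^sub>R snd (v 0) else 0)" for k q v
  have cont: "continuous_map (prod_topology (subtopology ?RT U) (product_topology (\<lambda>_. ?RT) {..<k})) T (\<lambda>(q, v). D k q v)" for k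
  proof -
    let ?Z = "prod_topology (subtopology ?RT U) (product_topology (\<lambda>_. ?RT) {..<k})"
    have q: "continuous_map ?Z ?RT fst"
      by (rule continuous_map_into_fulltopology[OF continuous_map_fst])
    have v: "continuous_map ?Z ?RT (\<lambda>z. snd z i)" if "i < k" for i
      using continuous_map_compose[OF continuous_map_snd continuous_map_product_coordinates[of i "{..<k}" "\<lambda>_. ?RT"]] that
      by (simp add: o_def)
    note parts = continuous_map_fst_app[OF q] continuous_map_snd_app[OF q]
      continuous_map_fst_app[OF v] continuous_map_snd_app[OF v]
    consider "k = 0" | "k = 1" | "k = 2" | "2 < k" by linarith
    then have "continuous_map ?Z T (\<lambda>z. D k (fst z) (snd z))"
    proof cases
      case 1
      then have "(\<lambda>z. D k (fst z) (snd z)) = (\<lambda>z. fst (fst z) *\<^sub>R snd (fst z))" by (simp add: D_def fun_eq_iff)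
      then show ?thesis by (simp only:) (intro continuous_map_smooth_scaleR parts)
    next
      case 2
      then have "(\<lambda>z. D k (fst z) (snd z)) = (\<lambda>z. fst (snd z 0) *\<^sub>R snd (fst z) + fst (fst z) *\<^sub>R snd (snd z 0))"
        by (simp add: D_def fun_eq_iff)
      moreover have "0 < k" using 2 by simp
      ultimately show ?thesis by (simp only:) (intro continuous_map_smooth_add continuous_map_smooth_scaleR parts)
    next
      case 3
      then have "(\<lambda>z. D k (fst z) (snd z)) = (\<lambda>z. fst (snd z 0) *\<^sub>R snd (snd z 1) + fst (snd z 1) *\<^sub>R snd (snd z 0))"
        by (simp add: D_def fun_eq_iff)
      moreover have "0 < k" "1 < k" using 3 by simp_all
      ultimately show ?thesis by (simp only:) (intro continuous_map_smooth_add continuous_map_smooth_scaleR parts)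
    next
      case 4
      then have "(\<lambda>z. D k (fst z) (snd z)) = (\<lambda>z. 0)" by (simp add: D_def fun_eq_iff)
      then show ?thesis by (simp add: sym_tensors_0)
    qed
    then show ?thesis by (simp add: case_prod_unfold)
  qed
  have lim: "limitin T (\<lambda>t. (1 / t) *\<^sub>R (D k (q + t *\<^sub>R v k) (restrict v {..<k}) - D k q (restrict v {..<k})))
      (D (Suc k) q v) (at (0::real))" if q: "q \<in> U" and v: "v \<in> {..<Suc k} \<rightarrow>\<^sub>E topspace ?RT" for k q v
  proof -
    have snd_q: "snd q \<in> sym_tensors X A" using q U by auto
    have snd_v: "snd (v i) \<in> sym_tensors X A" if "i \<le> k" for i
      using PiE_mem[OF v, of i] that by (auto simp: mem_Times_iff)
    (* Only the quotient of order zero has a remainder, the quadratic term of the bilinear map. *)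
    have quotient: "\<forall>\<^sub>F t in at (0::real). (D (Suc k) q v + t *\<^sub>R (if k = 0 then fst (v 0) *\<^sub>R snd (v 0) else 0))
      = (1 / t) *\<^sub>R (D k (q + t *\<^sub>R v k) (restrict v {..<k}) - D k q (restrict v {..<k}))"
      unfolding eventually_at_filter
      by (intro always_eventually allI impI) (auto simp: D_def algebra_simps restrict_def)
    have "D (Suc k) q v \<in> sym_tensors X A"
      using snd_q snd_v by (auto simp: D_def intro!: sym_tensors_add sym_tensors_scaleR sym_tensors_0)
    moreover have "(if k = 0 then fst (v 0) *\<^sub>R snd (v 0) else 0) \<in> sym_tensors X A"
      using snd_v by (auto intro!: sym_tensors_scaleR sym_tensors_0)
    ultimately have "limitin T (\<lambda>t. D (Suc k) q v + t *\<^sub>R (if k = 0 then fst (v 0) *\<^sub>R snd (v 0) else 0))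
      (D (Suc k) q v + (0::real) *\<^sub>R (if k = 0 then fst (v 0) *\<^sub>R snd (v 0) else 0)) (at (0::real))"
      by (intro limitin_smooth_add limitin_smooth_scaleR limitin_smooth_const tendsto_ident_at)
    then have "limitin T (\<lambda>t. D (Suc k) q v + t *\<^sub>R (if k = 0 then fst (v 0) *\<^sub>R snd (v 0) else 0))
      (D (Suc k) q v) (at (0::real))" by simp
    then show ?thesis by (rule limitin_transform_eventually[OF quotient])
  qed
  show ?thesis
    unfolding frechet_smooth_def
    by (intro exI[of _ D] conjI allI ballI cont lim) (auto simp: D_def)
qed

lemma smooth_pos_action_scaling: "smooth_pos_action T N (\<lambda>l g. l *\<^sub>R g)"
  unfolding smooth_pos_action_def
  using metrics_subset by (auto intro!: metrics_scaleR frechet_smooth_scaling)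

lemma metric_nonzero: "g \<in> N \<Longrightarrow> g \<noteq> 0"
proof
  assume g: "g \<in> N" and "g = 0"
  obtain p c where c: "c \<in> A" "p \<in> fst c" using X_nonempty covered by blast
  have "components A 0 c p = (0 :: real ^ 'n ^ 'n)" by (simp add: components_def vec_eq_iff)
  then have "pos_def (0 :: real ^ 'n ^ 'n)" using metrics_pos_def[OF g c] \<open>g = 0\<close> by simp
  then have "\<xi> \<noteq> 0 \<longrightarrow> 0 < \<xi> \<bullet> (0 *v \<xi>)" for \<xi> :: "real ^ 'n"
    unfolding pos_def_def by (rule spec)
  from this[of "axis undefined 1"] show False by (simp add: axis_eq_0_iff)
qed

lemma free_pos_action_scaling: "free_pos_action N (\<lambda>l g. l *\<^sub>R g)"
  unfolding free_pos_action_def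
proof (intro allI impI ballI)
  fix l :: real and g assume g: "g \<in> N" and "l *\<^sub>R g = g"
  then have "(l - 1) *\<^sub>R g = 0" by (simp add: scaleR_left_diff_distrib)
  then show "l = 1" using metric_nonzero[OF g] by (simp only: scaleR_eq_0_iff) simp
qed

text \<open>The flow is \<open>t \<mapsto> exp t \<cdot> g\<close>, whose velocity at 0 is \<open>g\<close>.\<close>

lemma generator_scaling:
  assumes "g \<in> N"
  shows "generator T (\<lambda>l g. l *\<^sub>R g) g = g"
  unfolding generator_def
proof (rule dir_deriv_smooth_eqI)
  have "((\<lambda>t. (exp t - 1) / t) \<longlongrightarrow> (1::real)) (at 0)"
    using DERIV_exp[of "0::real"] by (simp add: DERIV_def)
  from limitin_smooth_scaleR[OF this limitin_smooth_const[OF metrics_in_sym[OF assms]]]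
  show "limitin T (\<lambda>t. (1 / t) *\<^sub>R (exp (0 + t *\<^sub>R 1) *\<^sub>R g - exp 0 *\<^sub>R g)) g (at (0::real))"
    by (simp add: scaleR_left_diff_distrib[symmetric] flip: scaleR_left_diff_distrib[of _ 1 g, simplified])
qed

lemma dir_deriv_scaling:
  assumes "u \<in> sym_tensors X A"
  shows "dir_deriv T (\<lambda>g. l *\<^sub>R g) g u = l *\<^sub>R u"
proof (rule dir_deriv_smooth_eqI)
  have "\<forall>\<^sub>F t in at (0::real). l *\<^sub>R u = (1 / t) *\<^sub>R (l *\<^sub>R (g + t *\<^sub>R u) - l *\<^sub>R g)"
    unfolding eventually_at_filter by (intro always_eventually) (simp add: scaleR_add_right)
  then show "limitin T (\<lambda>t. (1 / t) *\<^sub>R (l *\<^sub>R (g + t *\<^sub>R u) - l *\<^sub>R g)) (l *\<^sub>R u) (at (0::real))"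
    by (rule limitin_transform_eventually) (intro limitin_smooth_const sym_tensors_scaleR assms)
qed

lemma weak_pseudo_riemannian_ebin: "weak_pseudo_riemannian T N (ebin_metric X A)"
  unfolding weak_pseudo_riemannian_def
proof (intro conjI ballI allI impI frechet_smooth_ebin)
  fix g u v assume "g \<in> N" "u \<in> topspace T" "v \<in> topspace T"
  show "ebin_metric X A g u v = ebin_metric X A g v u"
    unfolding ebin_eq by (simp only: ebin_density_sym[of _ "local_rep u _ _"])
qed (simp_all add: ebin_linear ebin_nondegenerate)

theorem homogeneous_pair_ebin_volume:
  "homogeneous_pair T N (\<lambda>l g. l *\<^sub>R g) (ebin_metric X A) (\<lambda>g. 2 * volume X A g) (real CARD('n) / 2)"
  unfolding homogeneous_pair_def
  by (intro conjI allI ballI impI openin_metrics smooth_pos_action_scaling free_pos_action_scaling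
      weak_pseudo_riemannian_ebin frechet_smooth_two_volume volume_pos two_volume_scaleR)
    (simp_all add: dir_deriv_scaling ebin_scaleR generator_scaling ebin_self)

end

theorem proposition5p10:
  fixes X :: "'a topology" and A :: "('a, 'n::finite) chart set"
  assumes "compact_oriented_manifold X A"
  shows "homogeneous_pair (smooth_topology X A) (metrics X A) (\<lambda>l g. l *\<^sub>R g)
    (ebin_metric X A) (\<lambda>g. 2 * volume X A g) (real CARD('n) / 2)"
  using assms by (intro compact_oriented_mfd.homogeneous_pair_ebin_volume compact_oriented_mfd.intro)

end
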